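(* Let $k:\mathcal P\otimes\mathcal Q\to\mathbb R$ be differentiable at $P_0\otimes Q_0$ with canonical gradient $\widetilde k=\widetilde k_1\circ\pi_1+\widetilde k_2\circ\pi_2$, $\|\widetilde k\|_{L_2(P_0\otimes Q_0)}\neq0$, let $\alpha\in(0,1)$, and let $(n_1)_n,(n_2)_n\subset\mathbb N$ satisfy $n_1+n_2=n$ for all $n$ and $\lim_{n\to\infty}\frac{n_2}n=d\in(0,1)$. Suppose that, with respect to the $L_2(P_0\otimes Q_0)$-norm, the tangent cone $K(P_0\otimes Q_0,\mathcal P\otimes\mathcal Q)$ is dense in the tangent space $T(P_0\otimes Q_0,\mathcal P\otimes\mathcal Q)$ and the set $K(P_0\otimes Q_0,\mathcal P\otimes\mathcal Q)\cap N(\widetilde k,P_0\otimes Q_0,\mathcal P\otimes\mathcal Q)$ is dense in $N(\widetilde k,P_0\otimes Q_0,\mathcal P\otimes\mathcal Q)$. Let $\psi_n=1$ if $|T_n|>c$ and $\psi_n=0$ if $|T_n|\le c$, where $$T_n=\frac{\sqrt n}{n_1}\sum_{i=1}^{n_1}\widetilde k_1(\omega_{1,i})+\frac{\sqrt n}{n_2}\sum_{j=1}^{n_2}\widetilde k_2(\omega_{2,j}),\qquad c=u_{1-\frac\alpha2}\Bigl(\frac1{1-d}\int\widetilde k_1^2\,dP_0+\frac1d\int\widetilde k_2^2\,dQ_0\Bigr)^{1/2}.$$ Then $(\psi_n)_n$ is asymptotically optimal within the set of all test sequences for $\mathcal H_2$ against $\mathcal K_2$ that are asymptotically unbiased at level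 $\alpha$.
   Context: $\mathcal P,\mathcal Q$ are nonempty families of probability measures on $(\Omega_1,\mathcal A_1)$, $(\Omega_2,\mathcal A_2)$; $\mathcal P\otimes\mathcal Q=\{P\otimes Q:P\in\mathcal P,Q\in\mathcal Q\}$; $(\omega_{1,1},\dots,\omega_{1,n_1},\omega_{2,1},\dots,\omega_{2,n_2})$ is the generic point of $\Omega_1^{n_1}\times\Omega_2^{n_2}$. $\Phi$ is the standard normal distribution function, $u_p=\Phi^{-1}(p)$; tests are measurable $[0,1]$-valued functions. $L_2^{(0)}(P)=\{h\in L_2(P):\int h\,dP=0\}$. With $dP/dQ$ the density quotient (a $[0,\infty]$-valued measurable $L$ with $P(A)=\int_AL\,dQ+P(A\cap\{L=\infty\})$, $Q(L<\infty)=1$), a curve $t\mapsto R_t$, $|t|<\varepsilon$, in a family $\mathcal R$ is $L_2(R_0)$-differentiable with tangent $g\in L_2(R_0)$ if $\|2((dR_t/dR_0)^{1/2}-1)-tg\|_{L_2(R_0)}=o(|t|)$ and $R_t(dR_t/dR_0=\infty)=o(t^2)$ as $t\to0$. The tangent cone $K(R,\mathcal R)$ is the set of tangents of all such curves in $\mathcal R$ with $R_0=R$; the tangent space $T(R,\mathcal R)$ is the $L_2(R)$-closure of its linear span. A functional $k$ on $\mathcal R$ is differentiable at $R\in\mathcal R$ with gradient $\dot k\in L_2^{(0)}(R)$ if $\lim_{t\downarrow0}t^{-1}(k(R_t)-k(R))=\int\dot kg\,dR$ for each $L_2$-differentiable curve in $\mathcal R$ with $R_0=R$ and tangent $g$;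 the canonical gradient $\widetilde k$ is the unique gradient in $T(R,\mathcal R)$. $N(\widetilde k,R,\mathcal R)=\{h\in T(R,\mathcal R):\int\widetilde kh\,dR=0\}$. At $P_0\otimes Q_0$ the canonical gradient decomposes uniquely as $\widetilde k(\omega_1,\omega_2)=\widetilde k_1(\omega_1)+\widetilde k_2(\omega_2)$ with $\widetilde k_1\in L_2^{(0)}(P_0)$, $\widetilde k_2\in L_2^{(0)}(Q_0)$. $\mathcal F_2$ is the set of all sequences $(P_{t_n}\otimes Q_{t_n})_n$ (identified with the sequences $(P_{t_n}^{n_1}\otimes Q_{t_n}^{n_2})_n$) such that $t_n\to0$, $\lim_nt_n\sqrt n>0$, and there are $\varepsilon>0$ and an $L_2(P_0\otimes Q_0)$-differentiable curve $f:(-\varepsilon,\varepsilon)\to\mathcal P\otimes\mathcal Q$, $t\mapsto P_t\otimes Q_t$ (through $P_0\otimes Q_0$ at $t=0$) with $f(t_n)=P_{t_n}\otimes Q_{t_n}$ for all $n$. For an element of $\mathcal F_2$ put $\vartheta=\lim_n\sqrt n(k(P_{t_n}\otimes Q_{t_n})-k(P_0\otimes Q_0))$. $\mathcal K_2$ (implicit alternatives) is the set of elements of $\mathcal F_2$ with $\vartheta\ne0$, $\mathcal H_2$ (implicit hypotheses) the set of those with $\vartheta=0$. A sequence of tests $\varphi_n$ on $\Omega_1^{n_1}\times\Omega_2^{n_2}$ is asymptotically unbiased at level $\alpha$ for $\mathcal H_2$ against $\mathcal K_2$ if $\limsup_n\int\varphi_n\,dP_{t_n}^{n_1}\otimes Q_{t_n}^{n_2}\le\alpha$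 on $\mathcal H_2$ and $\liminf_n\int\varphi_n\,dP_{t_n}^{n_1}\otimes Q_{t_n}^{n_2}\ge\alpha$ on $\mathcal K_2$. "$(\psi_n)$ is asymptotically optimal" in this class means: $(\psi_n)$ belongs to the class, and for every $(\varphi_n)$ in the class: $\limsup_n\int\varphi_n\,dP_{t_n}^{n_1}\otimes Q_{t_n}^{n_2}\le\lim_n\int\psi_n\,dP_{t_n}^{n_1}\otimes Q_{t_n}^{n_2}$ for all elements of $\mathcal K_2$, and $\liminf_n\int\varphi_n\,dP_{t_n}^{n_1}\otimes Q_{t_n}^{n_2}\ge\lim_n\int\psi_n\,dP_{t_n}^{n_1}\otimes Q_{t_n}^{n_2}$ for all elements of $\mathcal H_2$ (the limits for $\psi_n$ existing). *)

theory Defs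
  imports "HOL-Probability.Probability" "HOL-Library.Landau_Symbols"
begin

(* Square-integrable functions are represented by functions, not by classes modulo a.e. equality.
   A measurable space (Omega, A) is represented by a value of type measure, of which only
   space and sets are used. *)

definition L2_space :: "'a measure \<Rightarrow> ('a \<Rightarrow> real) set" where
  "L2_space M = {h \<in> borel_measurable M. integrable M (\<lambda>x. (h x)\<^sup>2)}"

definition L2_zero :: "'a measure \<Rightarrow> ('a \<Rightarrow> real) set" where
  "L2_zero M = {h \<in> L2_space M. (\<integral>x. h x \<partial>M) = 0}"

(* Only meaningful for functions in L2_space M. *)
definition L2_norm :: "'a measure \<Rightarrow> ('a \<Rightarrow> real) \<Rightarrow> real" where
  "L2_norm M h = sqrt (\<integral>x. (h x)\<^sup>2 \<partial>M)"

definition L2_closure :: "'a measure \<Rightarrow> ('a \<Rightarrow> real) set \<Rightarrow> ('a \<Rightarrow> real) set" where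
  "L2_closure M S = {h \<in> L2_space M. \<forall>e>0. \<exists>s\<in>S. L2_norm M (\<lambda>x. h x - s x) < e}"

definition L2_dense_in :: "'a measure \<Rightarrow> ('a \<Rightarrow> real) set \<Rightarrow> ('a \<Rightarrow> real) set \<Rightarrow> bool" where
  "L2_dense_in M S T \<longleftrightarrow> S \<subseteq> T \<and> T \<subseteq> L2_closure M S"

(* Function types carry no real_vector instance, so the library's span is not applicable. *)
definition fun_span :: "('a \<Rightarrow> real) set \<Rightarrow> ('a \<Rightarrow> real) set" where
  "fun_span S = {\<lambda>x. \<Sum>i<m. c i * s i x | (m::nat) (c :: nat \<Rightarrow> real) s. \<forall>i<m. s i \<in> S}"

definition prob_family :: "'a measure \<Rightarrow> 'a measure set \<Rightarrow> bool" where
  "prob_family A F \<longleftrightarrow> F \<noteq> {} \<and> (\<forall>P\<in>F. prob_space P \<and> sets P = sets A)"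

definition prod_family :: "'a measure set \<Rightarrow> 'b measure set \<Rightarrow> ('a \<times> 'b) measure set" where
  "prod_family F G = {P \<Otimes>\<^sub>M Q | P Q. P \<in> F \<and> Q \<in> G}"

(* L is a version of dP/dQ; P need not be absolutely continuous with respect to Q. The function L
   is unique Q-a.e., and the singular mass P(L = infinity) does not depend on the version. *)
definition is_density_quotient ::
    "'a measure \<Rightarrow> 'a measure \<Rightarrow> ('a \<Rightarrow> ennreal) \<Rightarrow> bool" where
  "is_density_quotient P Q L \<longleftrightarrow>
     L \<in> borel_measurable Q \<and>
     (AE x in Q. L x < \<infinity>) \<and>
     (\<forall>A\<in>sets Q. emeasure P A = (\<integral>\<^sup>+x\<in>A. L x \<partial>Q) + emeasure P (A \<inter> {x. L x = \<infinity>}))"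

(* The curve is the restriction of R to (-e, e). The value of enn2real where the quotient is
   infinite is irrelevant, that set being a null set for R 0. *)
definition L2_differentiable_curve ::
    "'a measure set \<Rightarrow> real \<Rightarrow> (real \<Rightarrow> 'a measure) \<Rightarrow> ('a \<Rightarrow> real) \<Rightarrow> bool" where
  "L2_differentiable_curve F e R g \<longleftrightarrow>
     e > 0 \<and> (\<forall>t. \<bar>t\<bar> < e \<longrightarrow> R t \<in> F) \<and> g \<in> L2_space (R 0) \<and>
     (\<exists>L. (\<forall>t. \<bar>t\<bar> < e \<longrightarrow> is_density_quotient (R t) (R 0) (L t)) \<and>
        (\<lambda>t. L2_norm (R 0) (\<lambda>x. 2 * (sqrt (enn2real (L t x)) - 1) - t * g x))
           \<in> o[at 0](\<lambda>t. \<bar>t\<bar>) \<and>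
        (\<lambda>t. measure (R t) {x \<in> space (R t). L t x = \<infinity>}) \<in> o[at 0](\<lambda>t. t\<^sup>2))"

definition tangent_cone :: "'a measure \<Rightarrow> 'a measure set \<Rightarrow> ('a \<Rightarrow> real) set" where
  "tangent_cone R0 F = {g. \<exists>e R. L2_differentiable_curve F e R g \<and> R 0 = R0}"

definition tangent_space :: "'a measure \<Rightarrow> 'a measure set \<Rightarrow> ('a \<Rightarrow> real) set" where
  "tangent_space R0 F = L2_closure R0 (fun_span (tangent_cone R0 F))"

definition is_gradient ::
    "('a measure \<Rightarrow> real) \<Rightarrow> 'a measure \<Rightarrow> 'a measure set \<Rightarrow> ('a \<Rightarrow> real) \<Rightarrow> bool" where
  "is_gradient k R0 F kd \<longleftrightarrow>
     kd \<in> L2_zero R0 \<and>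
     (\<forall>e R g. L2_differentiable_curve F e R g \<and> R 0 = R0 \<longrightarrow>
        ((\<lambda>t. (k (R t) - k R0) / t) \<longlongrightarrow> (\<integral>x. kd x * g x \<partial>R0)) (at_right 0))"

definition is_canonical_gradient ::
    "('a measure \<Rightarrow> real) \<Rightarrow> 'a measure \<Rightarrow> 'a measure set \<Rightarrow> ('a \<Rightarrow> real) \<Rightarrow> bool" where
  "is_canonical_gradient k R0 F kt \<longleftrightarrow> is_gradient k R0 F kt \<and> kt \<in> tangent_space R0 F"

definition tangent_null_space ::
    "('a \<Rightarrow> real) \<Rightarrow> 'a measure \<Rightarrow> 'a measure set \<Rightarrow> ('a \<Rightarrow> real) set" where
  "tangent_null_space kt R0 F = {h \<in> tangent_space R0 F. (\<integral>x. kt x * h x \<partial>R0) = 0}"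

definition sample_measure :: "nat \<Rightarrow> nat \<Rightarrow> 'a measure \<Rightarrow> 'b measure
    \<Rightarrow> ((nat \<Rightarrow> 'a) \<times> (nat \<Rightarrow> 'b)) measure" where
  "sample_measure m1 m2 P Q = (\<Pi>\<^sub>M i\<in>{1..m1}. P) \<Otimes>\<^sub>M (\<Pi>\<^sub>M j\<in>{1..m2}. Q)"

(* A sequence of products P n (x) Q n of probability measures is represented by the pair (P, Q),
   which it determines through its marginals. The limit of t n * sqrt n is finite. *)
definition local_sequences :: "'a measure set \<Rightarrow> 'b measure set \<Rightarrow> 'a measure \<Rightarrow> 'b measure
    \<Rightarrow> ((nat \<Rightarrow> 'a measure) \<times> (nat \<Rightarrow> 'b measure)) set" where
  "local_sequences F G P0 Q0 = {(P, Q).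
     (\<forall>n. P n \<in> F \<and> Q n \<in> G) \<and>
     (\<exists>t :: nat \<Rightarrow> real. t \<longlonglongrightarrow> 0 \<and>
        (\<exists>a>0. (\<lambda>n. t n * sqrt (real n)) \<longlonglongrightarrow> a) \<and>
        (\<exists>e R g. L2_differentiable_curve (prod_family F G) e R g \<and> R 0 = P0 \<Otimes>\<^sub>M Q0 \<and>
           (\<forall>n. \<bar>t n\<bar> < e \<and> R (t n) = P n \<Otimes>\<^sub>M Q n)))}"

definition local_param :: "(('a \<times> 'b) measure \<Rightarrow> real) \<Rightarrow> 'a measure \<Rightarrow> 'b measure
    \<Rightarrow> (nat \<Rightarrow> 'a measure) \<Rightarrow> (nat \<Rightarrow> 'b measure) \<Rightarrow> real" where
  "local_param k P0 Q0 P Q = lim (\<lambda>n. sqrt (real n) * (k (P n \<Otimes>\<^sub>M Q n) - k (P0 \<Otimes>\<^sub>M Q0)))"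

definition implicit_alternatives :: "(('a \<times> 'b) measure \<Rightarrow> real)
    \<Rightarrow> 'a measure set \<Rightarrow> 'b measure set \<Rightarrow> 'a measure \<Rightarrow> 'b measure
    \<Rightarrow> ((nat \<Rightarrow> 'a measure) \<times> (nat \<Rightarrow> 'b measure)) set" where
  "implicit_alternatives k F G P0 Q0 =
     {(P, Q) \<in> local_sequences F G P0 Q0. local_param k P0 Q0 P Q \<noteq> 0}"

definition implicit_hypotheses :: "(('a \<times> 'b) measure \<Rightarrow> real)
    \<Rightarrow> 'a measure set \<Rightarrow> 'b measure set \<Rightarrow> 'a measure \<Rightarrow> 'b measure
    \<Rightarrow> ((nat \<Rightarrow> 'a measure) \<times> (nat \<Rightarrow> 'b measure)) set" where
  "implicit_hypotheses k F G P0 Q0 =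
     {(P, Q) \<in> local_sequences F G P0 Q0. local_param k P0 Q0 P Q = 0}"

definition test_sequence :: "'a measure \<Rightarrow> 'b measure \<Rightarrow> (nat \<Rightarrow> nat) \<Rightarrow> (nat \<Rightarrow> nat)
    \<Rightarrow> (nat \<Rightarrow> (nat \<Rightarrow> 'a) \<times> (nat \<Rightarrow> 'b) \<Rightarrow> real) \<Rightarrow> bool" where
  "test_sequence A1 A2 n1 n2 \<phi> \<longleftrightarrow>
     (\<forall>n. \<phi> n \<in> borel_measurable (sample_measure (n1 n) (n2 n) A1 A2) \<and>
          (\<forall>\<omega>\<in>space (sample_measure (n1 n) (n2 n) A1 A2). 0 \<le> \<phi> n \<omega> \<and> \<phi> n \<omega> \<le> 1))"

definition test_mean :: "(nat \<Rightarrow> nat) \<Rightarrow> (nat \<Rightarrow> nat)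
    \<Rightarrow> (nat \<Rightarrow> (nat \<Rightarrow> 'a) \<times> (nat \<Rightarrow> 'b) \<Rightarrow> real)
    \<Rightarrow> (nat \<Rightarrow> 'a measure) \<Rightarrow> (nat \<Rightarrow> 'b measure) \<Rightarrow> nat \<Rightarrow> real" where
  "test_mean n1 n2 \<phi> P Q n = (\<integral>\<omega>. \<phi> n \<omega> \<partial>sample_measure (n1 n) (n2 n) (P n) (Q n))"

definition asymptotically_unbiased :: "'a measure \<Rightarrow> 'b measure \<Rightarrow> (nat \<Rightarrow> nat) \<Rightarrow> (nat \<Rightarrow> nat)
    \<Rightarrow> real
    \<Rightarrow> ((nat \<Rightarrow> 'a measure) \<times> (nat \<Rightarrow> 'b measure)) set
    \<Rightarrow> ((nat \<Rightarrow> 'a measure) \<times> (nat \<Rightarrow> 'b measure)) set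
    \<Rightarrow> (nat \<Rightarrow> (nat \<Rightarrow> 'a) \<times> (nat \<Rightarrow> 'b) \<Rightarrow> real) \<Rightarrow> bool" where
  "asymptotically_unbiased A1 A2 n1 n2 \<alpha> H K \<phi> \<longleftrightarrow>
     test_sequence A1 A2 n1 n2 \<phi> \<and>
     (\<forall>(P, Q)\<in>H. limsup (\<lambda>n. ereal (test_mean n1 n2 \<phi> P Q n)) \<le> ereal \<alpha>) \<and>
     (\<forall>(P, Q)\<in>K. ereal \<alpha> \<le> liminf (\<lambda>n. ereal (test_mean n1 n2 \<phi> P Q n)))"

definition asymptotically_optimal_unbiased ::
    "'a measure \<Rightarrow> 'b measure \<Rightarrow> (nat \<Rightarrow> nat) \<Rightarrow> (nat \<Rightarrow> nat) \<Rightarrow> real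
    \<Rightarrow> ((nat \<Rightarrow> 'a measure) \<times> (nat \<Rightarrow> 'b measure)) set
    \<Rightarrow> ((nat \<Rightarrow> 'a measure) \<times> (nat \<Rightarrow> 'b measure)) set
    \<Rightarrow> (nat \<Rightarrow> (nat \<Rightarrow> 'a) \<times> (nat \<Rightarrow> 'b) \<Rightarrow> real) \<Rightarrow> bool" where
  "asymptotically_optimal_unbiased A1 A2 n1 n2 \<alpha> H K \<psi> \<longleftrightarrow>
     asymptotically_unbiased A1 A2 n1 n2 \<alpha> H K \<psi> \<and>
     (\<forall>(P, Q)\<in>H \<union> K. convergent (test_mean n1 n2 \<psi> P Q)) \<and>
     (\<forall>\<phi>. asymptotically_unbiased A1 A2 n1 n2 \<alpha> H K \<phi> \<longrightarrow>
        (\<forall>(P, Q)\<in>K. limsup (\<lambda>n. ereal (test_mean n1 n2 \<phi> P Q n))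
                        \<le> ereal (lim (test_mean n1 n2 \<psi> P Q))) \<and>
        (\<forall>(P, Q)\<in>H. ereal (lim (test_mean n1 n2 \<psi> P Q))
                        \<le> liminf (\<lambda>n. ereal (test_mean n1 n2 \<phi> P Q n))))"

definition std_normal_quantile :: "real \<Rightarrow> real" where
  "std_normal_quantile p = inv (cdf std_normal_distribution) p"

definition T_stat :: "(nat \<Rightarrow> nat) \<Rightarrow> (nat \<Rightarrow> nat) \<Rightarrow> ('a \<Rightarrow> real) \<Rightarrow> ('b \<Rightarrow> real)
    \<Rightarrow> nat \<Rightarrow> (nat \<Rightarrow> 'a) \<times> (nat \<Rightarrow> 'b) \<Rightarrow> real" where
  "T_stat n1 n2 kt1 kt2 n = (\<lambda>(\<omega>1, \<omega>2).
     sqrt (real n) / real (n1 n) * (\<Sum>i=1..n1 n. kt1 (\<omega>1 i)) +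
     sqrt (real n) / real (n2 n) * (\<Sum>j=1..n2 n. kt2 (\<omega>2 j)))"

definition crit_value :: "real \<Rightarrow> real \<Rightarrow> ('a \<Rightarrow> real) \<Rightarrow> ('b \<Rightarrow> real) \<Rightarrow> 'a measure \<Rightarrow> 'b measure
    \<Rightarrow> real" where
  "crit_value \<alpha> d kt1 kt2 P0 Q0 =
     std_normal_quantile (1 - \<alpha> / 2) *
       sqrt (1 / (1 - d) * (\<integral>x. (kt1 x)\<^sup>2 \<partial>P0) + 1 / d * (\<integral>y. (kt2 y)\<^sup>2 \<partial>Q0))"

definition psi_test :: "real \<Rightarrow> (nat \<Rightarrow> nat) \<Rightarrow> (nat \<Rightarrow> nat) \<Rightarrow> ('a \<Rightarrow> real) \<Rightarrow> ('b \<Rightarrow> real)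
    \<Rightarrow> nat \<Rightarrow> (nat \<Rightarrow> 'a) \<times> (nat \<Rightarrow> 'b) \<Rightarrow> real" where
  "psi_test c n1 n2 kt1 kt2 n \<omega> = (if \<bar>T_stat n1 n2 kt1 kt2 n \<omega>\<bar> > c then 1 else 0)"

end

theory Submission
  imports Defs
begin

text \<open>
  Every local alternative is compared with an explicit exponential tilt of the null sample. The total
  variation distance of the two product measures is bounded by their Hellinger distance, hence
  asymptotically by the \<open>L\<^sub>2\<close>-distance of the tangents; the singular parts contribute only
  \<open>n * o(t\<^sub>n\<^sup>2)\<close>. Neither local asymptotic normality nor a limit experiment is needed.

  Relative to the inner product \<open>(1 - d) \<integral> f\<^sub>1 h\<^sub>1 dP\<^sub>0 + d \<integral> f\<^sub>2 h\<^sub>2 dQ\<^sub>0\<close>, the functional has the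
  gradient \<open>\<kappa> = k\<^sub>1 / (1 - d) + k\<^sub>2 / d\<close>, where \<open>k\<^sub>1 + k\<^sub>2\<close> is the canonical gradient. It lies in the
  tangent space because the marginal curves of a differentiable curve of products are differentiable.
  A tangent \<open>w\<close> splits as \<open>b + s \<kappa>\<close> with \<open>b\<close> orthogonal to the canonical gradient. Tilting in the
  direction \<open>\<kappa>\<close> gives an exact one-parameter exponential family through \<open>b\<close>, to which the generalised
  Neyman-Pearson lemma applies: \<open>exp (s x) + B exp (- \<epsilon> s x)\<close> is convex, and for a suitable \<open>B\<close> it takes
  the same value at \<open>c\<close> and \<open>- c\<close>. Density of the tangent cone supplies the level at \<open>b\<close> and
  unbiasedness at \<open>b - \<epsilon> s \<kappa>\<close>. The loss vanishes as \<open>\<epsilon> \<rightarrow> 0\<close> because the two-sided power is flat at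
  the hypothesis.
\<close>

section \<open>Density quotients\<close>

text \<open>An arbitrary test is controlled only along sequences inside the model, by one-sided
  asymptotic inequalities. Its power has no usable derivative at the hypothesis; the classical
  condition that this derivative vanishes is replaced by an inequality at a fixed distance
  \<epsilon>, and n tends to infinity before \<epsilon> tends to 0. The multiplier
  \<open>B = sinh (s * c) / sinh (\<epsilon> * (s * c))\<close> grows like 1 / \<epsilon>, while the
  two-sided power at \<open>b - \<epsilon> s \<kappa>\<close> exceeds \<alpha> only by
  o(\<epsilon>), so their product vanishes. The points \<open>b\<close> and
  \<open>b - \<epsilon> s \<kappa>\<close> lie in the tangent space but need not be tangents, and
  the tilts need not belong to the model. The total variation comparison moves the inequalities from
  curves to tilts, at the price of the L2-distance to a tangent nearby. Tangents are merely
  square-integrable, so a literal tilt by \<open>v / sqrt n\<close> may fail to be integrable; the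
  tilts run along truncated and recentred arrays converging to \<open>v\<close>.\<close>

definition finite_part :: "('a \<Rightarrow> ennreal) \<Rightarrow> 'a \<Rightarrow> ennreal" where
  "finite_part L x = (if L x = \<infinity> then 0 else 1)"

lemma finite_part_measurable [measurable]:
  "L \<in> borel_measurable M \<Longrightarrow> finite_part L \<in> borel_measurable M"
  unfolding finite_part_def by measurable

text \<open>Turns the setwise Lebesgue decomposition into one equation between measures: the 0/1
  density \<open>finite_part L\<close> deletes from \<open>P\<close> the set where \<open>L\<close>
  is infinite, and what remains is the absolutely continuous part. The singular mass is cancelled
  from both sides, which is where finiteness of \<open>P\<close> enters. Products and uniqueness
  then follow from the calculus of \<open>density\<close>.\<close>

lemma is_density_quotient_iff:
  assumes [measurable_cong]: "sets P = sets Q" and "finite_measure P"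
  shows "is_density_quotient P Q L \<longleftrightarrow>
    L \<in> borel_measurable Q \<and> (AE x in Q. L x < \<infinity>) \<and> density P (finite_part L) = density Q L"
proof (cases "L \<in> borel_measurable Q \<and> (AE x in Q. L x < \<infinity>)")
  case True
  interpret finite_measure P by fact
  have [measurable]: "L \<in> borel_measurable Q" and fin: "AE x in Q. L x < \<infinity>"
    using True by auto
  have Lm[measurable]: "L \<in> borel_measurable P" by measurable
  \<comment> \<open>The set where \<open>L\<close> is infinite is taken in the whole type; only its
    trace on the space is measurable.\<close>
  have inf_set: "A \<inter> {x. L x = \<infinity>} \<in> sets P" if "A \<in> sets Q" for A
  proof -
    have "A \<inter> {x. L x = \<infinity>} = A \<inter> {x \<in> space P. L x = \<infinity>}"
      using sets.sets_into_space[OF that] sets_eq_imp_space_eq[OF assms(1)] by auto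
    moreover have "{x \<in> space P. L x = \<infinity>} \<in> sets P" by measurable
    ultimately show ?thesis using that assms(1) by (simp only:) (rule sets.Int, simp_all)
  qed
  have split: "emeasure P A = emeasure (density P (finite_part L)) A + emeasure P (A \<inter> {x. L x = \<infinity>})"
    if A: "A \<in> sets Q" for A
  proof -
    have A': "A \<in> sets P" using A assms(1) by simp
    have "emeasure (density P (finite_part L)) A = emeasure P (A - {x. L x = \<infinity>})"
    proof -
      have "emeasure (density P (finite_part L)) A = (\<integral>\<^sup>+x. indicator (A - {x. L x = \<infinity>}) x \<partial>P)"
        using A' by (subst emeasure_density)
          (auto intro!: nn_integral_cong simp: finite_part_def split: split_indicator)
      also have "\<dots> = emeasure P (A - (A \<inter> {x. L x = \<infinity>}))"
        using sets.Diff[OF A' inf_set[OF A]] by (simp add: Diff_Int)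
      finally show ?thesis by (simp add: Diff_Int)
    qed
    moreover have "emeasure P A = emeasure P ((A - {x. L x = \<infinity>}) \<union> (A \<inter> {x. L x = \<infinity>}))"
      by (rule arg_cong[where f="emeasure P"]) auto
    moreover have "A - {x. L x = \<infinity>} \<in> sets P"
      using sets.Diff[OF A' inf_set[OF A]] by (simp add: Diff_Int)
    ultimately show ?thesis
      using inf_set[OF A] by (simp add: plus_emeasure[symmetric] Int_Diff disjoint_iff)
  qed
  have dens: "emeasure (density Q L) A = (\<integral>\<^sup>+x\<in>A. L x \<partial>Q)" if "A \<in> sets Q" for A
    using that by (simp add: emeasure_density)
  show ?thesis
  proof
    assume "is_density_quotient P Q L"
    then have *: "emeasure P A = (\<integral>\<^sup>+x\<in>A. L x \<partial>Q) + emeasure P (A \<inter> {x. L x = \<infinity>})"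
      if "A \<in> sets Q" for A using that unfolding is_density_quotient_def by auto
    have "density P (finite_part L) = density Q L"
    proof (rule measure_eqI)
      fix A assume "A \<in> sets (density P (finite_part L))"
      then have A: "A \<in> sets Q" using assms(1) by simp
      have "emeasure P (A \<inter> {x. L x = \<infinity>}) \<noteq> \<infinity>" by simp
      then show "emeasure (density P (finite_part L)) A = emeasure (density Q L) A"
        using split[OF A] *[OF A] dens[OF A] 
        by (metis ennreal_add_left_cancel add.commute infinity_ennreal_def)
    qed (use assms(1) in simp)
    then show "L \<in> borel_measurable Q \<and> (AE x in Q. L x < \<infinity>) \<and> density P (finite_part L) = density Q L"
      using True by blast
  next
    assume "L \<in> borel_measurable Q \<and> (AE x in Q. L x < \<infinity>) \<and> density P (finite_part L) = density Q L"
    then show "is_density_quotient P Q L"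
      using split dens unfolding is_density_quotient_def by metis
  qed
qed (auto simp: is_density_quotient_def)

lemma density_quotientD:
  assumes "is_density_quotient P Q L" "sets P = sets Q" "prob_space P"
  shows "L \<in> borel_measurable Q" "AE x in Q. L x < \<infinity>" "density P (finite_part L) = density Q L"
proof -
  interpret prob_space P by fact
  show "L \<in> borel_measurable Q" "AE x in Q. L x < \<infinity>" "density P (finite_part L) = density Q L"
    using is_density_quotient_iff[OF assms(2) finite_measure_axioms, THEN iffD1, OF assms(1)] by auto
qed

text \<open>Both measures are absolutely continuous with respect to their sum, so the quotient is
  the ratio of the two Radon-Nikodym derivatives.\<close>

lemma ex_density_quotient:
  assumes P: "finite_measure P" and Q: "finite_measure Q" and sets_eq: "sets P = sets Q"
  shows "\<exists>L. is_density_quotient P Q L"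
proof -
  interpret P: finite_measure P by fact
  interpret Q: finite_measure Q by fact
  note space_eq = sets_eq_imp_space_eq[OF sets_eq]
  define M where "M = measure_of (space Q) (sets Q) (\<lambda>A. emeasure P A + emeasure Q A)"
  have M_sets[measurable_cong, simp]: "sets M = sets Q" and M_space[simp]: "space M = space Q"
    unfolding M_def by (auto simp: sets.sigma_sets_eq)
  have M_em: "emeasure M A = emeasure P A + emeasure Q A" if "A \<in> sets Q" for A
  proof (rule emeasure_measure_of[OF M_def sets.space_closed])
    show "positive (sets M) (\<lambda>A. emeasure P A + emeasure Q A)" by (simp add: positive_def)
    show "countably_additive (sets M) (\<lambda>A. emeasure P A + emeasure Q A)"
      unfolding countably_additive_def using sets_eq
      by (auto simp: suminf_add[symmetric] suminf_emeasure)
  qed (use that in simp)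
  interpret M: finite_measure M
    by (rule finite_measureI) (simp add: M_em ennreal_add_eq_top P.emeasure_finite)
  have acP: "absolutely_continuous M P" and acQ: "absolutely_continuous M Q"
    unfolding absolutely_continuous_def null_sets_def using M_em sets_eq by auto
  obtain h where h[measurable]: "h \<in> borel_measurable M" and Ph: "density M h = P"
    using M.Radon_Nikodym[OF acP] sets_eq by auto
  obtain f where f[measurable]: "f \<in> borel_measurable M" and Qf: "density M f = Q"
    using M.Radon_Nikodym[OF acQ] by auto
  have [measurable]: "h \<in> borel_measurable Q" "f \<in> borel_measurable Q"
    using h f by (simp_all cong: measurable_cong_sets)
  have int_eq: "integral\<^sup>N M u = emeasure (density M u) (space M)"
    if "u \<in> borel_measurable M" for u
    using that by (subst emeasure_density) (auto intro!: nn_integral_cong)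
  have fin_h: "AE x in M. h x \<noteq> \<infinity>"
    by (rule nn_integral_PInf_AE[OF h]) (simp add: int_eq Ph P.emeasure_finite)
  have fin_f: "AE x in M. f x \<noteq> \<infinity>"
    by (rule nn_integral_PInf_AE[OF f]) (simp add: int_eq Qf Q.emeasure_finite)
  \<comment> \<open>The set where \<open>f\<close> vanishes is \<open>Q\<close>-null and may carry
    the singular part of \<open>P\<close>, hence the value infinity there.\<close>
  define L where "L x = (if f x = 0 then \<infinity> else h x / f x)" for x
  have [measurable]: "L \<in> borel_measurable M" "L \<in> borel_measurable Q"
    unfolding L_def by measurable
  have "AE x in density M f. L x < \<infinity>"
    unfolding AE_density[OF f] using fin_h fin_f
  proof eventually_elim
    case (elim x)
    then show ?case by (auto simp: L_def less_top[symmetric] ennreal_divide_eq_top_iff)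
  qed
  moreover have "density P (finite_part L) = density Q L"
  proof -
    have "density (density M h) (finite_part L) = density (density M f) L"
      unfolding density_density_eq[OF h finite_part_measurable[OF \<open>L \<in> borel_measurable M\<close>]]
        density_density_eq[OF f \<open>L \<in> borel_measurable M\<close>]
    proof (rule density_cong)
      show "AE x in M. h x * finite_part L x = f x * L x"
        using fin_h fin_f
      proof eventually_elim
        case (elim x)
        then show ?case
          using ennreal_mult_divide_eq[of "f x" "h x"]
          by (cases "f x = 0")
            (auto simp: L_def finite_part_def ennreal_divide_eq_top_iff ennreal_times_divide ac_simps)
      qed
    qed measurable
    then show ?thesis by (simp add: Ph Qf)
  qed
  ultimately have "is_density_quotient P Q L"
    using is_density_quotient_iff[OF sets_eq P] Qf by auto
  then show ?thesis by blast
qed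

text \<open>The regular part of a product is the product of the regular parts. Two indicators are
  kept instead of \<open>finite_part\<close> of the product: with infinity times 0 equal to 0, the
  product of the quotients can be finite where one factor is infinite.\<close>

lemma density_quotient_pair:
  assumes P: "prob_space P" and P0: "prob_space P0" and Q: "prob_space Q" and Q0: "prob_space Q0"
    and sP[measurable_cong]: "sets P = sets P0" and sQ[measurable_cong]: "sets Q = sets Q0"
    and l: "is_density_quotient P P0 l" and m: "is_density_quotient Q Q0 m"
  shows "density (P \<Otimes>\<^sub>M Q) (\<lambda>(x, y). finite_part l x * finite_part m y) =
    density (P0 \<Otimes>\<^sub>M Q0) (\<lambda>(x, y). l x * m y)"
proof -
  interpret P: prob_space P by fact
  interpret Q: prob_space Q by fact
  interpret P0: prob_space P0 by fact
  interpret Q0: prob_space Q0 by fact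
  have [measurable]: "l \<in> borel_measurable P0" "m \<in> borel_measurable Q0"
    and dl: "density P (finite_part l) = density P0 l" and dm: "density Q (finite_part m) = density Q0 m"
    using density_quotientD[OF l sP P] density_quotientD[OF m sQ Q] by auto
  have "emeasure (density Q (finite_part m)) (space Q) = (\<integral>\<^sup>+x. finite_part m x * indicator (space Q) x \<partial>Q)"
    by (rule emeasure_density) auto
  also have "\<dots> \<le> (\<integral>\<^sup>+x. 1 \<partial>Q)"
    by (intro nn_integral_mono) (auto simp: finite_part_def)
  also have "\<dots> = 1" by (simp add: Q.emeasure_space_1)
  finally have "emeasure (density Q (finite_part m)) (space (density Q (finite_part m))) \<noteq> \<infinity>"
    by (auto simp: top_unique)
  then have fm: "finite_measure (density Q (finite_part m))" by (rule finite_measureI)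
  have "density (P \<Otimes>\<^sub>M Q) (\<lambda>(x, y). finite_part l x * finite_part m y) =
      density P (finite_part l) \<Otimes>\<^sub>M density Q (finite_part m)"
    by (intro pair_measure_density[symmetric] Q.sigma_finite_measure_axioms 
        finite_measure.axioms(1)[OF fm]) auto
  also have "\<dots> = density P0 l \<Otimes>\<^sub>M density Q0 m" by (simp add: dl dm)
  also have "\<dots> = density (P0 \<Otimes>\<^sub>M Q0) (\<lambda>(x, y). l x * m y)"
    by (intro pair_measure_density Q0.sigma_finite_measure_axioms 
        finite_measure.axioms(1)[OF fm[unfolded dm]]) auto
  finally show ?thesis .
qed

text \<open>\<open>L\<close> and the product of \<open>l\<close> and \<open>m\<close> are both
  densities of \<open>P \<Otimes>\<^sub>M Q\<close>, but with different exceptional sets removed;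
  uniqueness of densities applies only after these have been made equal.\<close>

lemma density_quotient_pair_AE:
  assumes P: "prob_space P" and P0: "prob_space P0" and Q: "prob_space Q" and Q0: "prob_space Q0"
    and sP[measurable_cong]: "sets P = sets P0" and sQ[measurable_cong]: "sets Q = sets Q0"
    and l: "is_density_quotient P P0 l" and m: "is_density_quotient Q Q0 m"
    and L: "is_density_quotient (P \<Otimes>\<^sub>M Q) (P0 \<Otimes>\<^sub>M Q0) L"
  shows "AE z in P0 \<Otimes>\<^sub>M Q0. L z = l (fst z) * m (snd z)"
proof -
  interpret P: prob_space P by fact
  interpret Q: prob_space Q by fact
  interpret P0: prob_space P0 by fact
  interpret Q0: prob_space Q0 by fact
  interpret PQ0: pair_prob_space P0 Q0 ..
  interpret PQ: pair_prob_space P Q ..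
  have sPQ[measurable_cong]: "sets (P \<Otimes>\<^sub>M Q) = sets (P0 \<Otimes>\<^sub>M Q0)"
    by (intro sets_pair_measure_cong sP sQ)
  have [measurable]: "l \<in> borel_measurable P0" "m \<in> borel_measurable Q0"
      "L \<in> borel_measurable (P0 \<Otimes>\<^sub>M Q0)"
    and fl: "AE x in P0. l x < \<infinity>" and fmm: "AE x in Q0. m x < \<infinity>"
    and fL: "AE x in P0 \<Otimes>\<^sub>M Q0. L x < \<infinity>"
    and dL: "density (P \<Otimes>\<^sub>M Q) (finite_part L) = density (P0 \<Otimes>\<^sub>M Q0) L"
    using density_quotientD[OF l sP P] density_quotientD[OF m sQ Q]
      density_quotientD[OF L sPQ PQ.prob_space_axioms] by auto
  define lm where "lm = (\<lambda>(x, y). l x * m y)"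
  define flm where "flm = (\<lambda>(x, y). finite_part l x * finite_part m y)"
  have [measurable]: "lm \<in> borel_measurable (P0 \<Otimes>\<^sub>M Q0)" "flm \<in> borel_measurable (P0 \<Otimes>\<^sub>M Q0)"
    unfolding lm_def flm_def by measurable
  have dlm: "density (P \<Otimes>\<^sub>M Q) flm = density (P0 \<Otimes>\<^sub>M Q0) lm"
    unfolding lm_def flm_def by (rule density_quotient_pair[OF assms(1-8)])
  \<comment> \<open>Removes both exceptional sets at once: weighting either equation by
    \<open>S\<close> gives \<open>density (P \<Otimes>\<^sub>M Q) S\<close>, and \<open>S\<close>
    equals 1 almost everywhere under the null product.\<close>
  define S where "S z = finite_part L z * flm z" for z
  have [measurable]: "S \<in> borel_measurable (P0 \<Otimes>\<^sub>M Q0)" unfolding S_def by measurable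
  have "density (density (P \<Otimes>\<^sub>M Q) (finite_part L)) S = density (P \<Otimes>\<^sub>M Q) S"
    by (subst density_density_eq) (auto intro!: density_cong simp: S_def finite_part_def)
  moreover have "density (density (P \<Otimes>\<^sub>M Q) flm) S = density (P \<Otimes>\<^sub>M Q) S"
    by (subst density_density_eq) (auto intro!: density_cong simp: S_def finite_part_def flm_def)
  ultimately have "density (density (P0 \<Otimes>\<^sub>M Q0) L) S = density (density (P0 \<Otimes>\<^sub>M Q0) lm) S"
    unfolding dL dlm by simp
  then have "AE z in P0 \<Otimes>\<^sub>M Q0. L z * S z = lm z * S z"
    by (subst (asm) (1 2) density_density_eq) (auto intro!: PQ0.density_unique)
  moreover have "AE z in P0 \<Otimes>\<^sub>M Q0. l (fst z) < \<infinity>"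
    using fl by (intro PQ0.AE_pair_measure) auto
  moreover have "AE z in P0 \<Otimes>\<^sub>M Q0. m (snd z) < \<infinity>"
    using fmm by (intro PQ0.AE_pair_measure) auto
  ultimately show ?thesis using fL
  proof eventually_elim
    case (elim z)
    then have "l (fst z) \<noteq> \<top>" "m (snd z) \<noteq> \<top>" "L z \<noteq> \<top>" by auto
    with elim(1) show ?case by (simp add: S_def flm_def lm_def finite_part_def case_prod_beta)
  qed
qed

text \<open>The pair result with the constant quotient 1 in the second factor. It supplies the
  quotient along a curve whose second factor is frozen at \<open>Q0\<close>.\<close>

lemma density_quotient_fst:
  assumes P: "prob_space P" and P0: "prob_space P0" and Q0: "prob_space Q0"
    and sP[measurable_cong]: "sets P = sets P0"
    and l: "is_density_quotient P P0 l"
  shows "is_density_quotient (P \<Otimes>\<^sub>M Q0) (P0 \<Otimes>\<^sub>M Q0) (\<lambda>z. l (fst z))"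
proof -
  interpret P: prob_space P by fact
  interpret P0: prob_space P0 by fact
  interpret Q0: prob_space Q0 by fact
  interpret PQ0: pair_prob_space P0 Q0 ..
  interpret PQ: pair_prob_space P Q0 ..
  have sPQ[measurable_cong]: "sets (P \<Otimes>\<^sub>M Q0) = sets (P0 \<Otimes>\<^sub>M Q0)"
    by (intro sets_pair_measure_cong sP refl)
  have [measurable]: "l \<in> borel_measurable P0" and fl: "AE x in P0. l x < \<infinity>"
    using density_quotientD[OF l sP P] by auto
  have "is_density_quotient Q0 Q0 (\<lambda>_. 1)"
    by (auto simp: is_density_quotient_def)
  note d = density_quotient_pair[OF P P0 Q0 Q0 sP refl l this]
  have e: "(\<lambda>(x, y). finite_part l x * finite_part (\<lambda>_. 1) y) = finite_part (\<lambda>z. l (fst z))"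
    "(\<lambda>(x, y). l x * 1) = (\<lambda>z. l (fst z))"
    by (auto simp: finite_part_def fun_eq_iff)
  have "density (P \<Otimes>\<^sub>M Q0) (finite_part (\<lambda>z. l (fst z))) = density (P0 \<Otimes>\<^sub>M Q0) (\<lambda>z. l (fst z))"
    by (rule d[unfolded e])
  moreover have "AE z in P0 \<Otimes>\<^sub>M Q0. l (fst z) < \<infinity>"
    using fl by (intro PQ0.AE_pair_measure) auto
  ultimately show ?thesis
    by (subst is_density_quotient_iff[OF sPQ PQ.finite_measure]) auto
qed

section \<open>Integrals of test functions against samples and their regular parts\<close>

lemma density_quotient_nn_integral:
  assumes "prob_space P" and s[measurable_cong]: "sets P = sets P0" and l: "is_density_quotient P P0 l"
    and [measurable]: "f \<in> borel_measurable P0"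
  shows "(\<integral>\<^sup>+x. l x * f x \<partial>P0) \<le> (\<integral>\<^sup>+x. f x \<partial>P)"
proof -
  have [measurable]: "l \<in> borel_measurable P0"
    and d: "density P (finite_part l) = density P0 l"
    using density_quotientD[OF l s assms(1)] by auto
  have "(\<integral>\<^sup>+x. l x * f x \<partial>P0) = (\<integral>\<^sup>+x. f x \<partial>density P (finite_part l))"
    unfolding d by (simp add: nn_integral_density)
  also have "\<dots> = (\<integral>\<^sup>+x. finite_part l x * f x \<partial>P)"
    by (simp add: nn_integral_density)
  also have "\<dots> \<le> (\<integral>\<^sup>+x. f x \<partial>P)"
    by (intro nn_integral_mono) (auto simp: finite_part_def)
  finally show ?thesis .
qed

lemma density_quotient_singular_mass:
  assumes "prob_space P" and s[measurable_cong]: "sets P = sets P0" and l: "is_density_quotient P P0 l"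
  shows "ennreal (measure P {x \<in> space P. l x = \<infinity>}) + (\<integral>\<^sup>+x. l x \<partial>P0) = 1"
proof -
  interpret P: prob_space P by fact
  have [measurable]: "l \<in> borel_measurable P0" using l by (simp add: is_density_quotient_def)
  have "emeasure P (space P) = (\<integral>\<^sup>+x\<in>space P0. l x \<partial>P0) + emeasure P (space P0 \<inter> {x. l x = \<infinity>})"
    using l sets.top[of P0] sets_eq_imp_space_eq[OF s] unfolding is_density_quotient_def by metis
  also have "(\<integral>\<^sup>+x\<in>space P0. l x \<partial>P0) = (\<integral>\<^sup>+x. l x \<partial>P0)"
    by (auto intro!: nn_integral_cong)
  also have "space P0 \<inter> {x. l x = \<infinity>} = {x \<in> space P. l x = \<infinity>}"
    using sets_eq_imp_space_eq[OF s] by auto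
  finally show ?thesis by (simp add: P.prob_space P.emeasure_eq_measure add.commute)
qed

text \<open>Induction on the index set; each coordinate loses the singular part of its law, so only
  an inequality survives. It suffices for a two-sided estimate because it will be applied to a test
  and to its complement.\<close>

lemma nn_integral_PiM_density_le:
  assumes P: "prob_space P" and P0: "prob_space P0" and s[measurable_cong]: "sets P = sets P0"
    and l: "is_density_quotient P P0 l" and "finite I"
    and f: "f \<in> borel_measurable (Pi\<^sub>M I (\<lambda>_. P0))"
  shows "(\<integral>\<^sup>+\<omega>. (\<Prod>i\<in>I. l (\<omega> i)) * f \<omega> \<partial>Pi\<^sub>M I (\<lambda>_. P0)) \<le> (\<integral>\<^sup>+\<omega>. f \<omega> \<partial>Pi\<^sub>M I (\<lambda>_. P))"
  using \<open>finite I\<close> f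
proof (induction I arbitrary: f)
  case empty
  then show ?case by (simp add: PiM_empty)
next
  case (insert i I)
  interpret P: prob_space P by fact
  interpret P0: prob_space P0 by fact
  interpret pP: product_sigma_finite "\<lambda>_. P" by unfold_locales
  interpret pP0: product_sigma_finite "\<lambda>_. P0" by unfold_locales
  have [measurable]: "l \<in> borel_measurable P0" using l by (simp add: is_density_quotient_def)
  note insert.prems[measurable]
  have sI[measurable_cong]: "sets (Pi\<^sub>M J (\<lambda>_. P)) = sets (Pi\<^sub>M J (\<lambda>_. P0))" for J
    by (intro sets_PiM_cong refl s)
  have f'[measurable]: "f \<in> borel_measurable (Pi\<^sub>M (insert i I) (\<lambda>_. P))"
    using insert.prems by (simp cong: measurable_cong_sets)
  have "(\<integral>\<^sup>+\<omega>. (\<Prod>i\<in>insert i I. l (\<omega> i)) * f \<omega> \<partial>Pi\<^sub>M (insert i I) (\<lambda>_. P0)) =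
     (\<integral>\<^sup>+\<omega>. (\<integral>\<^sup>+y. (\<Prod>j\<in>insert i I. l (fun_upd \<omega> i y j)) * f (fun_upd \<omega> i y) \<partial>P0) \<partial>Pi\<^sub>M I (\<lambda>_. P0))"
    using insert.hyps by (intro pP0.product_nn_integral_insert) measurable
  also have "\<dots> = (\<integral>\<^sup>+\<omega>. (\<Prod>j\<in>I. l (\<omega> j)) * (\<integral>\<^sup>+y. l y * f (fun_upd \<omega> i y) \<partial>P0) \<partial>Pi\<^sub>M I (\<lambda>_. P0))"
  proof (intro nn_integral_cong)
    fix \<omega> assume "\<omega> \<in> space (Pi\<^sub>M I (\<lambda>_. P0))"
    then have [measurable]: "(\<lambda>y. f (fun_upd \<omega> i y)) \<in> borel_measurable P0"
      using insert.hyps by (intro measurable_compose[OF measurable_component_update insert.prems]) auto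
    have "(\<Prod>j\<in>insert i I. l (fun_upd \<omega> i y j)) * f (fun_upd \<omega> i y) = (\<Prod>j\<in>I. l (\<omega> j)) * (l y * f (fun_upd \<omega> i y))" for y
    proof -
      have "(\<Prod>j\<in>I. l (fun_upd \<omega> i y j)) = (\<Prod>j\<in>I. l (\<omega> j))"
        using insert.hyps by (intro prod.cong) auto
      then show ?thesis using insert.hyps by (simp add: mult_ac)
    qed
    then show "(\<integral>\<^sup>+y. (\<Prod>j\<in>insert i I. l (fun_upd \<omega> i y j)) * f (fun_upd \<omega> i y) \<partial>P0) =
        (\<Prod>j\<in>I. l (\<omega> j)) * (\<integral>\<^sup>+y. l y * f (fun_upd \<omega> i y) \<partial>P0)"
      by (simp add: nn_integral_cmult)
  qed
  also have "\<dots> \<le> (\<integral>\<^sup>+\<omega>. (\<integral>\<^sup>+y. l y * f (fun_upd \<omega> i y) \<partial>P0) \<partial>Pi\<^sub>M I (\<lambda>_. P))"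
    by (rule insert.IH) measurable
  also have "\<dots> \<le> (\<integral>\<^sup>+\<omega>. (\<integral>\<^sup>+y. f (fun_upd \<omega> i y) \<partial>P) \<partial>Pi\<^sub>M I (\<lambda>_. P))"
  proof (intro nn_integral_mono density_quotient_nn_integral[OF P s l])
    fix \<omega> assume "\<omega> \<in> space (Pi\<^sub>M I (\<lambda>_. P))"
    then show "(\<lambda>y. f (fun_upd \<omega> i y)) \<in> borel_measurable P0"
      using insert.hyps sets_eq_imp_space_eq[OF sI]
      by (intro measurable_compose[OF measurable_component_update insert.prems]) auto
  qed
  also have "\<dots> = (\<integral>\<^sup>+\<omega>. f \<omega> \<partial>Pi\<^sub>M (insert i I) (\<lambda>_. P))"
    using insert.hyps by (intro pP.product_nn_integral_insert[symmetric]) auto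
  finally show ?case .
qed

lemma nn_integral_sample_density_le:
  assumes P: "prob_space P" and P0: "prob_space P0" and sP[measurable_cong]: "sets P = sets P0"
    and Q: "prob_space Q" and Q0: "prob_space Q0" and sQ[measurable_cong]: "sets Q = sets Q0"
    and l: "is_density_quotient P P0 l" and m: "is_density_quotient Q Q0 m"
    and f: "f \<in> borel_measurable (sample_measure m1 m2 P0 Q0)"
  shows "(\<integral>\<^sup>+z. (\<Prod>i=1..m1. l (fst z i)) * (\<Prod>j=1..m2. m (snd z j)) * f z \<partial>sample_measure m1 m2 P0 Q0)
     \<le> (\<integral>\<^sup>+z. f z \<partial>sample_measure m1 m2 P Q)"
proof -
  interpret P: prob_space P by fact
  interpret P0: prob_space P0 by fact
  interpret Q: prob_space Q by fact
  interpret Q0: prob_space Q0 by fact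
  define I where "I = {1..m1}"
  define J where "J = {1..m2}"
  have fin: "finite I" "finite J" by (auto simp: I_def J_def)
  interpret pQ: prob_space "Pi\<^sub>M J (\<lambda>_. Q)" by (intro prob_space_PiM Q)
  interpret pQ0: prob_space "Pi\<^sub>M J (\<lambda>_. Q0)" by (intro prob_space_PiM Q0)
  have [measurable]: "l \<in> borel_measurable P0" "m \<in> borel_measurable Q0"
    using l m by (auto simp: is_density_quotient_def)
  have sI[measurable_cong]: "sets (Pi\<^sub>M I (\<lambda>_. P)) = sets (Pi\<^sub>M I (\<lambda>_. P0))"
    by (intro sets_PiM_cong refl sP)
  have sJ[measurable_cong]: "sets (Pi\<^sub>M J (\<lambda>_. Q)) = sets (Pi\<^sub>M J (\<lambda>_. Q0))"
    by (intro sets_PiM_cong refl sQ)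
  note f[unfolded sample_measure_def, folded I_def J_def, measurable]
  have f'[measurable]: "f \<in> borel_measurable (Pi\<^sub>M I (\<lambda>_. P) \<Otimes>\<^sub>M Pi\<^sub>M J (\<lambda>_. Q))" by measurable
  have "(\<integral>\<^sup>+z. (\<Prod>i\<in>I. l (fst z i)) * (\<Prod>j\<in>J. m (snd z j)) * f z \<partial>(Pi\<^sub>M I (\<lambda>_. P0) \<Otimes>\<^sub>M Pi\<^sub>M J (\<lambda>_. Q0)))
     = (\<integral>\<^sup>+x. (\<integral>\<^sup>+y. (\<Prod>i\<in>I. l (x i)) * (\<Prod>j\<in>J. m (y j)) * f (x, y) \<partial>Pi\<^sub>M J (\<lambda>_. Q0)) \<partial>Pi\<^sub>M I (\<lambda>_. P0))"
    by (subst pQ0.nn_integral_fst[symmetric]) (auto)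
  also have "\<dots> = (\<integral>\<^sup>+x. (\<Prod>i\<in>I. l (x i)) * (\<integral>\<^sup>+y. (\<Prod>j\<in>J. m (y j)) * f (x, y) \<partial>Pi\<^sub>M J (\<lambda>_. Q0)) \<partial>Pi\<^sub>M I (\<lambda>_. P0))"
    by (intro nn_integral_cong) (simp add: nn_integral_cmult[symmetric] mult.assoc)
  also have "\<dots> \<le> (\<integral>\<^sup>+x. (\<integral>\<^sup>+y. (\<Prod>j\<in>J. m (y j)) * f (x, y) \<partial>Pi\<^sub>M J (\<lambda>_. Q0)) \<partial>Pi\<^sub>M I (\<lambda>_. P))"
    by (intro nn_integral_PiM_density_le[OF P P0 sP l fin(1)]) measurable
  also have "\<dots> \<le> (\<integral>\<^sup>+x. (\<integral>\<^sup>+y. f (x, y) \<partial>Pi\<^sub>M J (\<lambda>_. Q)) \<partial>Pi\<^sub>M I (\<lambda>_. P))"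
    using sets_eq_imp_space_eq[OF sI]
    by (intro nn_integral_mono nn_integral_PiM_density_le[OF Q Q0 sQ m fin(2)]) auto
  also have "\<dots> = (\<integral>\<^sup>+z. f z \<partial>(Pi\<^sub>M I (\<lambda>_. P) \<Otimes>\<^sub>M Pi\<^sub>M J (\<lambda>_. Q)))"
    by (rule pQ.nn_integral_fst) auto
  finally show ?thesis by (simp add: sample_measure_def I_def J_def)
qed

section \<open>Square-integrable functions\<close>

lemma L2_spaceD:
  "h \<in> L2_space M \<Longrightarrow> h \<in> borel_measurable M" "h \<in> L2_space M \<Longrightarrow> integrable M (\<lambda>x. (h x)\<^sup>2)"
  by (auto simp: L2_space_def)

lemma L2_zeroD:
  "h \<in> L2_zero M \<Longrightarrow> h \<in> L2_space M" "h \<in> L2_zero M \<Longrightarrow> (\<integral>x. h x \<partial>M) = 0"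
  by (auto simp: L2_zero_def)

lemma L2_integrable_mult:
  assumes "f \<in> L2_space M" "g \<in> L2_space M"
  shows "integrable M (\<lambda>x. f x * g x)"
proof (rule Bochner_Integration.integrable_bound)
  show "integrable M (\<lambda>x. (f x)\<^sup>2 + (g x)\<^sup>2)" using assms by (auto simp: L2_space_def)
  show "(\<lambda>x. f x * g x) \<in> borel_measurable M"
    using assms[THEN L2_spaceD(1)] by measurable
  have "\<bar>a * b\<bar> \<le> a\<^sup>2 + b\<^sup>2" for a b :: real
    using sum_squares_bound[of "\<bar>a\<bar>" "\<bar>b\<bar>"] abs_ge_zero[of "a * b"] unfolding abs_mult power2_abs
    by linarith
  then show "AE x in M. norm (f x * g x) \<le> norm ((f x)\<^sup>2 + (g x)\<^sup>2)" by auto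
qed

lemma L2_space_add [intro]:
  assumes "f \<in> L2_space M" "g \<in> L2_space M"
  shows "(\<lambda>x. f x + g x) \<in> L2_space M"
  using assms L2_integrable_mult[OF assms] unfolding L2_space_def
  by (auto simp: power2_sum mult.assoc)

lemma L2_space_cmult [intro]: "f \<in> L2_space M \<Longrightarrow> (\<lambda>x. c * f x) \<in> L2_space M"
  by (auto simp: L2_space_def power_mult_distrib)

lemma L2_space_diff [intro]:
  assumes "f \<in> L2_space M" "g \<in> L2_space M"
  shows "(\<lambda>x. f x - g x) \<in> L2_space M"
  using L2_space_add[OF assms(1) L2_space_cmult[OF assms(2), of "-1"]] by simp

lemma (in finite_measure) L2_space_const [intro]: "(\<lambda>x. c) \<in> L2_space M"
  by (auto simp: L2_space_def)

lemma (in finite_measure) L2_integrable: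
  assumes "f \<in> L2_space M" shows "integrable M f"
  using L2_integrable_mult[OF assms L2_space_const[of 1]] by simp

lemma L2_space_bound:
  assumes "f \<in> L2_space M" "g \<in> borel_measurable M" "AE x in M. \<bar>g x\<bar> \<le> \<bar>f x\<bar>"
  shows "g \<in> L2_space M"
proof -
  have "integrable M (\<lambda>x. (g x)\<^sup>2)"
  proof (rule Bochner_Integration.integrable_bound[OF L2_spaceD(2)[OF assms(1)]])
    show "AE x in M. norm ((g x)\<^sup>2) \<le> norm ((f x)\<^sup>2)"
      using assms(3) by eventually_elim (simp add: abs_le_square_iff)
  qed (use assms in measurable)
  then show ?thesis using assms by (auto simp: L2_space_def)
qed

lemma L2_norm_nonneg [simp]: "0 \<le> L2_norm M f"
  by (simp add: L2_norm_def)

lemma L2_norm_power2: "(L2_norm M f)\<^sup>2 = (\<integral>x. (f x)\<^sup>2 \<partial>M)"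
  by (simp add: L2_norm_def)

lemma L2_norm_cmult: "L2_norm M (\<lambda>x. c * f x) = \<bar>c\<bar> * L2_norm M f"
  by (simp add: L2_norm_def power_mult_distrib real_sqrt_mult)

lemma L2_norm_minus_commute: "L2_norm M (\<lambda>x. f x - g x) = L2_norm M (\<lambda>x. g x - f x)"
  by (simp add: L2_norm_def power2_commute)

lemma L2_norm_cong_AE:
  assumes "f \<in> borel_measurable M" "g \<in> borel_measurable M" "AE x in M. f x = g x"
  shows "L2_norm M f = L2_norm M g"
  unfolding L2_norm_def by (intro arg_cong[where f=sqrt] integral_cong_AE) (use assms in auto)

lemma L2_Cauchy_Schwarz:
  assumes f: "f \<in> L2_space M" and g: "g \<in> L2_space M"
  shows "\<bar>\<integral>x. f x * g x \<partial>M\<bar> \<le> L2_norm M f * L2_norm M g"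
proof -
  define a where "a = (\<integral>x. (f x)\<^sup>2 \<partial>M)"
  define b where "b = (\<integral>x. f x * g x \<partial>M)"
  define c where "c = (\<integral>x. (g x)\<^sup>2 \<partial>M)"
  note i = L2_spaceD(2)[OF f] L2_spaceD(2)[OF g] L2_integrable_mult[OF f g]
  have q: "0 \<le> s\<^sup>2 * a + 2 * s * b + c" for s
  proof -
    have "0 \<le> (\<integral>x. (s * f x + g x)\<^sup>2 \<partial>M)" by simp
    also have "\<dots> = (\<integral>x. s\<^sup>2 * (f x)\<^sup>2 + (2 * s * (f x * g x) + (g x)\<^sup>2) \<partial>M)"
      by (intro Bochner_Integration.integral_cong) (auto simp: power2_eq_square algebra_simps)
    also have "\<dots> = s\<^sup>2 * a + (2 * s * b + c)"
      unfolding a_def b_def c_def using i by simp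
    finally show ?thesis by (simp add: algebra_simps)
  qed
  have "b\<^sup>2 \<le> a * c"
  proof (cases "a = 0")
    case True
    have "b = 0"
    proof (rule ccontr)
      assume "b \<noteq> 0"
      \<comment> \<open>With \<open>a = 0\<close> the quadratic is affine in \<open>s\<close>, and
        this \<open>s\<close> gives it the value -1.\<close>
      with q[of "- (c + 1) / (2 * b)"] True show False by (simp add: field_simps)
    qed
    then show ?thesis using True by simp
  next
    case False
    moreover have "a \<ge> 0" by (simp add: a_def)
    ultimately have "a > 0" by simp
    with q[of "- b / a"] show ?thesis by (simp add: field_simps power2_eq_square)
  qed
  then have "\<bar>b\<bar> \<le> sqrt (a * c)"
    using real_le_rsqrt[of "\<bar>b\<bar>" "a * c"] by simp
  then show ?thesis unfolding L2_norm_def a_def b_def c_def by (simp add: real_sqrt_mult)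
qed

lemma L2_norm_triangle:
  assumes f: "f \<in> L2_space M" and g: "g \<in> L2_space M"
  shows "L2_norm M (\<lambda>x. f x + g x) \<le> L2_norm M f + L2_norm M g"
proof (rule power2_le_imp_le)
  note i = L2_spaceD(2)[OF f] L2_spaceD(2)[OF g] L2_integrable_mult[OF f g]
  have "(L2_norm M (\<lambda>x. f x + g x))\<^sup>2 = (\<integral>x. (f x)\<^sup>2 + ((g x)\<^sup>2 + 2 * (f x * g x)) \<partial>M)"
    unfolding L2_norm_power2 by (intro Bochner_Integration.integral_cong) (auto simp: power2_sum)
  also have "\<dots> = (L2_norm M f)\<^sup>2 + ((L2_norm M g)\<^sup>2 + 2 * (\<integral>x. f x * g x \<partial>M))"
    unfolding L2_norm_power2 using i by simp
  also have "\<dots> \<le> (L2_norm M f + L2_norm M g)\<^sup>2"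
    using L2_Cauchy_Schwarz[OF f g] by (simp add: power2_sum)
  finally show "(L2_norm M (\<lambda>x. f x + g x))\<^sup>2 \<le> (L2_norm M f + L2_norm M g)\<^sup>2" .
qed simp

lemma L2_norm_triangle_diff:
  assumes "f \<in> L2_space M" "g \<in> L2_space M" "h \<in> L2_space M"
  shows "L2_norm M (\<lambda>x. f x - h x) \<le> L2_norm M (\<lambda>x. f x - g x) + L2_norm M (\<lambda>x. g x - h x)"
  using L2_norm_triangle[OF L2_space_diff[OF assms(1,2)] L2_space_diff[OF assms(2,3)]] by simp

lemma (in prob_space) L2_integral_le_norm:
  assumes "f \<in> L2_space M" shows "\<bar>\<integral>x. f x \<partial>M\<bar> \<le> L2_norm M f"
  using L2_Cauchy_Schwarz[OF assms L2_space_const[of 1]] by (simp add: L2_norm_def prob_space)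

lemma L2_norm_eq_0_AE:
  assumes "f \<in> L2_space M" "L2_norm M f = 0"
  shows "AE x in M. f x = 0"
  using assms integral_nonneg_eq_0_iff_AE[OF L2_spaceD(2)[OF assms(1)]] by (simp add: L2_norm_def)

section \<open>Square-integrable functions on a product of probability spaces\<close>

context pair_prob_space
begin

lemma pair_integral_mult:
  fixes f :: "'a \<Rightarrow> 'c::{real_normed_field, banach, second_countable_topology}"
  assumes f: "integrable M1 f" and h: "integrable M2 h"
  shows "integrable (M1 \<Otimes>\<^sub>M M2) (\<lambda>z. f (fst z) * h (snd z))"
    and "(\<integral>z. f (fst z) * h (snd z) \<partial>(M1 \<Otimes>\<^sub>M M2)) = (\<integral>x. f x \<partial>M1) * (\<integral>y. h y \<partial>M2)"
proof -
  have [measurable]: "f \<in> borel_measurable M1" "h \<in> borel_measurable M2" using f h by auto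
  show i: "integrable (M1 \<Otimes>\<^sub>M M2) (\<lambda>z. f (fst z) * h (snd z))"
    by (rule Fubini_integrable) (use f h in \<open>auto simp: norm_mult\<close>)
  show "(\<integral>z. f (fst z) * h (snd z) \<partial>(M1 \<Otimes>\<^sub>M M2)) = (\<integral>x. f x \<partial>M1) * (\<integral>y. h y \<partial>M2)"
    using integral_fst'[OF i] f h by simp
qed

lemma pair_integral_fst:
  fixes f :: "'a \<Rightarrow> 'c::{real_normed_field, banach, second_countable_topology}"
  assumes "integrable M1 f"
  shows "integrable (M1 \<Otimes>\<^sub>M M2) (\<lambda>z. f (fst z))" "(\<integral>z. f (fst z) \<partial>(M1 \<Otimes>\<^sub>M M2)) = (\<integral>x. f x \<partial>M1)"
  using pair_integral_mult[OF assms, of "\<lambda>_. 1"] by (simp_all add: M2.prob_space)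

lemma pair_integral_snd:
  fixes f :: "'b \<Rightarrow> 'c::{real_normed_field, banach, second_countable_topology}"
  assumes "integrable M2 f"
  shows "integrable (M1 \<Otimes>\<^sub>M M2) (\<lambda>z. f (snd z))" "(\<integral>z. f (snd z) \<partial>(M1 \<Otimes>\<^sub>M M2)) = (\<integral>x. f x \<partial>M2)"
  using pair_integral_mult[OF _ assms, of "\<lambda>_. 1"] by (simp_all add: M1.prob_space)

lemma L2_space_fst: "f \<in> L2_space M1 \<Longrightarrow> (\<lambda>z. f (fst z)) \<in> L2_space (M1 \<Otimes>\<^sub>M M2)"
  using pair_integral_fst(1)[of "\<lambda>x. (f x)\<^sup>2"] by (auto simp: L2_space_def)

lemma L2_space_snd: "f \<in> L2_space M2 \<Longrightarrow> (\<lambda>z. f (snd z)) \<in> L2_space (M1 \<Otimes>\<^sub>M M2)"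
  using pair_integral_snd(1)[of "\<lambda>x. (f x)\<^sup>2"] by (auto simp: L2_space_def)

lemma L2_norm_fst: "f \<in> L2_space M1 \<Longrightarrow> L2_norm (M1 \<Otimes>\<^sub>M M2) (\<lambda>z. f (fst z)) = L2_norm M1 f"
  using pair_integral_fst(2)[of "\<lambda>x. (f x)\<^sup>2"] by (auto simp: L2_space_def L2_norm_def)

lemma L2_norm_snd: "f \<in> L2_space M2 \<Longrightarrow> L2_norm (M1 \<Otimes>\<^sub>M M2) (\<lambda>z. f (snd z)) = L2_norm M2 f"
  using pair_integral_snd(2)[of "\<lambda>x. (f x)\<^sup>2"] by (auto simp: L2_space_def L2_norm_def)

lemma L2_pair_mult:
  assumes "f \<in> L2_space M1" "h \<in> L2_space M2"
  shows "(\<lambda>z. f (fst z) * h (snd z)) \<in> L2_space (M1 \<Otimes>\<^sub>M M2)"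
    and "L2_norm (M1 \<Otimes>\<^sub>M M2) (\<lambda>z. f (fst z) * h (snd z)) = L2_norm M1 f * L2_norm M2 h"
  using pair_integral_mult[of "\<lambda>x. (f x)\<^sup>2" "\<lambda>y. (h y)\<^sup>2"] assms
  by (auto simp: L2_space_def L2_norm_def power_mult_distrib real_sqrt_mult)

text \<open>Integrating out a coordinate is an L2-contraction: Cauchy-Schwarz on almost every
  section, then Fubini.\<close>

lemma L2_section_integral:
  assumes r: "r \<in> L2_space (M1 \<Otimes>\<^sub>M M2)"
  shows "(\<lambda>x. \<integral>y. r (x, y) \<partial>M2) \<in> L2_space M1"
    and "L2_norm M1 (\<lambda>x. \<integral>y. r (x, y) \<partial>M2) \<le> L2_norm (M1 \<Otimes>\<^sub>M M2) r"
proof -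
  have [measurable]: "r \<in> borel_measurable (M1 \<Otimes>\<^sub>M M2)" using r by (rule L2_spaceD)
  note i2 = L2_spaceD(2)[OF r]
  have le: "AE x in M1. (\<integral>y. r (x, y) \<partial>M2)\<^sup>2 \<le> (\<integral>y. (r (x, y))\<^sup>2 \<partial>M2)"
    using AE_integrable_fst'[OF i2] AE_space
  proof eventually_elim
    case (elim x)
    then have "(\<lambda>y. r (x, y)) \<in> L2_space M2" by (auto simp: L2_space_def)
    from M2.L2_integral_le_norm[OF this] show ?case
      using L2_norm_power2[of M2 "\<lambda>y. r (x, y)"] power_mono[of "\<bar>\<integral>y. r (x, y) \<partial>M2\<bar>" _ 2] by fastforce
  qed
  have m: "(\<lambda>x. \<integral>y. r (x, y) \<partial>M2) \<in> borel_measurable M1" by measurable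
  have i: "integrable M1 (\<lambda>x. (\<integral>y. r (x, y) \<partial>M2)\<^sup>2)"
    by (rule Bochner_Integration.integrable_bound[OF integrable_fst'[OF i2]])
      (use le in \<open>auto elim!: eventually_mono\<close>)
  then show "(\<lambda>x. \<integral>y. r (x, y) \<partial>M2) \<in> L2_space M1"
    using m by (simp add: L2_space_def)
  have "(\<integral>x. (\<integral>y. r (x, y) \<partial>M2)\<^sup>2 \<partial>M1) \<le> (\<integral>x. (\<integral>y. (r (x, y))\<^sup>2 \<partial>M2) \<partial>M1)"
    by (rule integral_mono_AE[OF i integrable_fst'[OF i2] le])
  then show "L2_norm M1 (\<lambda>x. \<integral>y. r (x, y) \<partial>M2) \<le> L2_norm (M1 \<Otimes>\<^sub>M M2) r"
    unfolding L2_norm_def integral_fst'[OF i2] by simp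
qed

end

section \<open>Marginals of differentiable curves\<close>

lemma density_quotient_snd:
  assumes Q: "prob_space Q" and P0: "prob_space P0" and Q0: "prob_space Q0"
    and sQ[measurable_cong]: "sets Q = sets Q0"
    and m: "is_density_quotient Q Q0 m"
  shows "is_density_quotient (P0 \<Otimes>\<^sub>M Q) (P0 \<Otimes>\<^sub>M Q0) (\<lambda>z. m (snd z))"
proof -
  interpret Q: prob_space Q by fact
  interpret P0: prob_space P0 by fact
  interpret Q0: prob_space Q0 by fact
  interpret PQ0: pair_prob_space P0 Q0 ..
  interpret PQ: pair_prob_space P0 Q ..
  have sPQ[measurable_cong]: "sets (P0 \<Otimes>\<^sub>M Q) = sets (P0 \<Otimes>\<^sub>M Q0)"
    by (intro sets_pair_measure_cong sQ refl)
  have [measurable]: "m \<in> borel_measurable Q0" and fm: "AE x in Q0. m x < \<infinity>"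
    using density_quotientD[OF m sQ Q] by auto
  have "is_density_quotient P0 P0 (\<lambda>_. 1)"
    by (auto simp: is_density_quotient_def)
  note d = density_quotient_pair[OF P0 P0 Q Q0 refl sQ this m]
  have e: "(\<lambda>(x, y). finite_part (\<lambda>_. 1) x * finite_part m y) = finite_part (\<lambda>z. m (snd z))"
    "(\<lambda>(x, y). 1 * m y) = (\<lambda>z. m (snd z))"
    by (auto simp: finite_part_def fun_eq_iff)
  have "density (P0 \<Otimes>\<^sub>M Q) (finite_part (\<lambda>z. m (snd z))) = density (P0 \<Otimes>\<^sub>M Q0) (\<lambda>z. m (snd z))"
    by (rule d[unfolded e])
  moreover have "AE z in P0 \<Otimes>\<^sub>M Q0. m (snd z) < \<infinity>"
    using fm by (intro PQ0.AE_pair_measure) auto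
  ultimately show ?thesis
    by (subst is_density_quotient_iff[OF sPQ PQ.finite_measure]) auto
qed

text \<open>The quotient integrates to the mass of the regular part only; the deficit from 1 is the
  singular mass, which therefore enters the Hellinger computations as a separate term.\<close>

lemma density_quotient_root:
  assumes "prob_space P" "sets P = sets P0" "is_density_quotient P P0 l"
  shows "(\<lambda>x. sqrt (enn2real (l x))) \<in> L2_space P0"
    and "(\<integral>x. (sqrt (enn2real (l x)))\<^sup>2 \<partial>P0) = 1 - measure P {x \<in> space P. l x = \<infinity>}"
proof -
  note m = density_quotient_singular_mass[OF assms] and D = density_quotientD[OF assms(3,2,1)]
  have [measurable]: "l \<in> borel_measurable P0" by (rule D)
  have "(\<integral>\<^sup>+x. l x \<partial>P0) = ennreal (1 - measure P {x \<in> space P. l x = \<infinity>})"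
  proof (cases "\<integral>\<^sup>+x. l x \<partial>P0" rule: ennreal_cases)
    case (real r)
    with m have "ennreal (measure P {x \<in> space P. l x = \<infinity>} + r) = 1" by (simp add: ennreal_plus)
    then have "measure P {x \<in> space P. l x = \<infinity>} + r = 1"
      using ennreal_eq_1 by blast
    with real show ?thesis by (simp add: algebra_simps eq_diff_eq)
  qed (use m in simp)
  moreover have "(\<integral>\<^sup>+x. l x \<partial>P0) = (\<integral>\<^sup>+x. ennreal (enn2real (l x)) \<partial>P0)"
    using D(2) by (intro nn_integral_cong_AE) (auto elim: eventually_mono simp: less_top)
  ultimately have n: "(\<integral>\<^sup>+x. ennreal (enn2real (l x)) \<partial>P0) = ennreal (1 - measure P {x \<in> space P. l x = \<infinity>})"
    by simp
  moreover have "measure P {x \<in> space P. l x = \<infinity>} \<le> 1"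
    by (rule prob_space.prob_le_1[OF assms(1)])
  ultimately have "has_bochner_integral P0 (\<lambda>x. enn2real (l x)) (1 - measure P {x \<in> space P. l x = \<infinity>})"
    by (intro has_bochner_integral_nn_integral) auto
  then show "(\<lambda>x. sqrt (enn2real (l x))) \<in> L2_space P0"
      "(\<integral>x. (sqrt (enn2real (l x)))\<^sup>2 \<partial>P0) = 1 - measure P {x \<in> space P. l x = \<infinity>}"
    by (auto simp: L2_space_def has_bochner_integral_iff)
qed

text \<open>Exchanges the factors, so that the statement about first marginals also yields the
  second one.\<close>

lemma (in pair_prob_space) L2_swap:
  assumes "f \<in> L2_space (M1 \<Otimes>\<^sub>M M2)"
  shows "(\<lambda>z. f (snd z, fst z)) \<in> L2_space (M2 \<Otimes>\<^sub>M M1)"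
    and "L2_norm (M2 \<Otimes>\<^sub>M M1) (\<lambda>z. f (snd z, fst z)) = L2_norm (M1 \<Otimes>\<^sub>M M2) f"
proof -
  have [measurable]: "f \<in> borel_measurable (M1 \<Otimes>\<^sub>M M2)" using assms by (rule L2_spaceD)
  show "(\<lambda>z. f (snd z, fst z)) \<in> L2_space (M2 \<Otimes>\<^sub>M M1)"
    using integrable_product_swap[OF L2_spaceD(2)[OF assms]]
    by (auto simp: L2_space_def case_prod_beta')
  show "L2_norm (M2 \<Otimes>\<^sub>M M1) (\<lambda>z. f (snd z, fst z)) = L2_norm (M1 \<Otimes>\<^sub>M M2) f"
    using integral_product_swap[of "\<lambda>z. (f z)\<^sup>2"]
    by (simp add: L2_norm_def case_prod_beta')
qed

text \<open>Integrating the joint remainder over the second coordinate leaves \<open>a t\<close>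
  multiplied by the mean \<open>\<beta> t\<close> of \<open>b t\<close>. Since \<open>g\<close> has
  mean 0, \<open>1 - \<beta> t\<close> is bounded by the norm of that remainder, so replacing
  \<open>\<beta> t\<close> by 1 costs the same order once more. Norms at most 1, rather than equal
  to 1, allow for singular parts.\<close>

lemma (in pair_prob_space) root_marginal_derivative:
  assumes g: "g \<in> L2_space (M1 \<Otimes>\<^sub>M M2)"
    and a: "\<And>t. a t \<in> L2_space M1" "\<And>t x. 0 \<le> a t x" "\<And>t. L2_norm M1 (a t) \<le> 1"
    and b: "\<And>t. b t \<in> L2_space M2" "\<And>t y. 0 \<le> b t y" "\<And>t. L2_norm M2 (b t) \<le> 1"
    and R: "((\<lambda>t. L2_norm (M1 \<Otimes>\<^sub>M M2) (\<lambda>z. a t (fst z) * b t (snd z) - 1 - t / 2 * g z) / \<bar>t\<bar>) \<longlongrightarrow> 0) (at (0::real))"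
  shows "(\<integral>z. g z \<partial>(M1 \<Otimes>\<^sub>M M2)) = 0"
    and "((\<lambda>t. L2_norm M1 (\<lambda>x. a t x - 1 - t / 2 * (\<integral>y. g (x, y) \<partial>M2)) / \<bar>t\<bar>) \<longlongrightarrow> 0) (at 0)"
proof -
  let ?M = "M1 \<Otimes>\<^sub>M M2"
  define r where "r t z = a t (fst z) * b t (snd z) - 1 - t / 2 * g z" for t z
  define N where "N t = L2_norm ?M (r t)" for t
  define \<gamma> where "\<gamma> t = (\<integral>x. a t x \<partial>M1)" for t
  define \<beta> where "\<beta> t = (\<integral>y. b t y \<partial>M2)" for t
  define G where "G = (\<integral>z. g z \<partial>?M)"
  have N0: "((\<lambda>t. N t / \<bar>t\<bar>) \<longlongrightarrow> 0) (at 0)" using R unfolding N_def r_def .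
  have ab: "(\<lambda>z. a t (fst z) * b t (snd z)) \<in> L2_space ?M" for t
    by (rule L2_pair_mult) (use a b in auto)
  have r2: "r t \<in> L2_space ?M" for t
    unfolding r_def by (intro L2_space_diff L2_space_cmult ab g L2_space_const)
  have intr: "(\<integral>z. r t z \<partial>?M) = \<gamma> t * \<beta> t - 1 - t / 2 * G" for t
    unfolding r_def G_def \<gamma>_def \<beta>_def
    using L2_integrable[OF ab, of t] L2_integrable[OF g] M1.L2_integrable[OF a(1)] M2.L2_integrable[OF b(1)]
    by (simp add: pair_integral_mult prob_space)
  have bound: "\<bar>\<gamma> t * \<beta> t - 1 - t / 2 * G\<bar> \<le> N t" for t
    using L2_integral_le_norm[OF r2, of t] by (simp add: intr N_def)
  have g01: "0 \<le> \<gamma> t" "\<gamma> t \<le> 1" "0 \<le> \<beta> t" "\<beta> t \<le> 1" for t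
    using M1.L2_integral_le_norm[OF a(1), of t] a(3)[of t] M2.L2_integral_le_norm[OF b(1), of t] b(3)[of t] a(2) b(2)
    by (auto simp: \<gamma>_def \<beta>_def)
  have gb1: "\<gamma> t * \<beta> t \<le> 1" for t
    using g01[of t] by (intro mult_le_one) auto
  have tG: "t / 2 * G \<le> N t" for t using bound[of t] gb1[of t] by linarith
  \<comment> \<open>Since \<open>\<gamma> \<beta> \<le> 1\<close>, the affinity has a maximum at \<open>t = 0\<close>, so its derivative \<open>G / 2\<close> vanishes.\<close>
  have "G / 2 \<le> 0"
  proof (rule tendsto_lowerbound[OF tendsto_mono[OF at_le N0]])
    show "\<forall>\<^sub>F t in at_right 0. G / 2 \<le> N t / \<bar>t\<bar>"
      using tG by (auto simp: eventually_at_filter field_simps)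
  qed auto
  moreover have "- G / 2 \<le> 0"
  proof (rule tendsto_lowerbound[OF tendsto_mono[OF at_le N0]])
    show "\<forall>\<^sub>F t in at_left 0. - G / 2 \<le> N t / \<bar>t\<bar>"
      using tG by (auto simp: eventually_at_filter field_simps)
  qed auto
  ultimately have G0: "G = 0" by simp
  then show "(\<integral>z. g z \<partial>?M) = 0" by (simp add: G_def)
  have b1: "1 - \<beta> t \<le> N t" for t
  proof -
    have "\<gamma> t * \<beta> t \<le> \<beta> t" using g01[of t] by (simp add: mult_left_le_one_le)
    then show ?thesis using bound[of t] G0 by simp
  qed
  have le: "L2_norm M1 (\<lambda>x. a t x - 1 - t / 2 * (\<integral>y. g (x, y) \<partial>M2)) \<le> 2 * N t" for t
  proof -
    define r1 where "r1 x = (\<integral>y. r t (x, y) \<partial>M2)" for x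
    have r1: "r1 \<in> L2_space M1" "L2_norm M1 r1 \<le> N t"
      unfolding r1_def N_def by (rule L2_section_integral[OF r2])+
    have g1: "(\<lambda>x. \<integral>y. g (x, y) \<partial>M2) \<in> L2_space M1" by (rule L2_section_integral[OF g])
    \<comment> \<open>The integrated remainder contains \<open>a t x * \<beta> t\<close>; adding
      \<open>(1 - \<beta> t) * a t x\<close> restores \<open>a t x\<close>. Sections of
      \<open>g\<close> are integrable only almost everywhere.\<close>
    have "AE x in M1. a t x - 1 - t / 2 * (\<integral>y. g (x, y) \<partial>M2) = r1 x + (1 - \<beta> t) * a t x"
      using AE_integrable_fst'[OF L2_integrable[OF g]]
    proof eventually_elim
      case (elim x)
      then have "r1 x = a t x * \<beta> t - 1 - t / 2 * (\<integral>y. g (x, y) \<partial>M2)"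
        unfolding r1_def r_def \<beta>_def using M2.L2_integrable[OF b(1), of t] by (simp add: M2.prob_space)
      then show ?case by (simp add: algebra_simps)
    qed
    then have "L2_norm M1 (\<lambda>x. a t x - 1 - t / 2 * (\<integral>y. g (x, y) \<partial>M2)) = L2_norm M1 (\<lambda>x. r1 x + (1 - \<beta> t) * a t x)"
      by (intro L2_norm_cong_AE L2_spaceD(1)[of _ M1] L2_space_add L2_space_diff L2_space_cmult a g1 r1 M1.L2_space_const)
    also have "\<dots> \<le> L2_norm M1 r1 + L2_norm M1 (\<lambda>x. (1 - \<beta> t) * a t x)"
      by (intro L2_norm_triangle L2_space_cmult a r1)
    also have "L2_norm M1 (\<lambda>x. (1 - \<beta> t) * a t x) \<le> N t * 1"
      unfolding L2_norm_cmult using g01[of t] b1[of t] a(3) by (intro mult_mono) auto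
    finally show ?thesis using r1 by simp
  qed
  show "((\<lambda>t. L2_norm M1 (\<lambda>x. a t x - 1 - t / 2 * (\<integral>y. g (x, y) \<partial>M2)) / \<bar>t\<bar>) \<longlongrightarrow> 0) (at 0)"
  proof (rule tendsto_sandwich[OF _ _ tendsto_const])
    show "((\<lambda>t. 2 * (N t / \<bar>t\<bar>)) \<longlongrightarrow> 0) (at 0)" using tendsto_mult_right_zero[OF N0] .
    show "\<forall>\<^sub>F t in at 0. L2_norm M1 (\<lambda>x. a t x - 1 - t / 2 * (\<integral>y. g (x, y) \<partial>M2)) / \<bar>t\<bar> \<le> 2 * (N t / \<bar>t\<bar>)"
      using le by (auto intro!: always_eventually divide_right_mono)
  qed (auto intro!: always_eventually)
qed

text \<open>Differentiability along a product curve forces an additive tangent: in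
  \<open>a b - 1 = (a - 1) + (b - 1) + (a - 1) (b - 1)\<close> the last term has norm of order
  \<open>t^2\<close>. The deviation \<open>q\<close> from additivity does not depend on
  \<open>t\<close>, yet \<open>t / 2 * q\<close> is o(t) in norm, so \<open>q\<close> vanishes
  almost everywhere.\<close>

lemma (in pair_prob_space) root_product_derivative:
  assumes g: "g \<in> L2_space (M1 \<Otimes>\<^sub>M M2)" "g1 \<in> L2_space M1" "g2 \<in> L2_space M2"
    and a: "\<And>t. a t \<in> L2_space M1" and b: "\<And>t. b t \<in> L2_space M2"
    and R: "((\<lambda>t. L2_norm (M1 \<Otimes>\<^sub>M M2) (\<lambda>z. a t (fst z) * b t (snd z) - 1 - t / 2 * g z) / \<bar>t\<bar>) \<longlongrightarrow> 0) (at (0::real))"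
    and A: "((\<lambda>t. L2_norm M1 (\<lambda>x. a t x - 1 - t / 2 * g1 x) / \<bar>t\<bar>) \<longlongrightarrow> 0) (at 0)"
    and B: "((\<lambda>t. L2_norm M2 (\<lambda>x. b t x - 1 - t / 2 * g2 x) / \<bar>t\<bar>) \<longlongrightarrow> 0) (at 0)"
  shows "AE z in M1 \<Otimes>\<^sub>M M2. g z = g1 (fst z) + g2 (snd z)"
proof -
  let ?M = "M1 \<Otimes>\<^sub>M M2"
  define q where "q z = g z - (g1 (fst z) + g2 (snd z))" for z
  define ra where "ra t x = a t x - 1 - t / 2 * g1 x" for t x
  define rb where "rb t y = b t y - 1 - t / 2 * g2 y" for t y
  define r where "r t z = a t (fst z) * b t (snd z) - 1 - t / 2 * g z" for t z
  have ra: "ra t \<in> L2_space M1" for t unfolding ra_def by (intro L2_space_diff L2_space_cmult a g M1.L2_space_const)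
  have rb: "rb t \<in> L2_space M2" for t unfolding rb_def by (intro L2_space_diff L2_space_cmult b g M2.L2_space_const)
  have r: "r t \<in> L2_space ?M" for t
    unfolding r_def by (intro L2_space_diff L2_space_cmult L2_pair_mult a b g L2_space_const)
  have q: "q \<in> L2_space ?M"
    unfolding q_def by (intro L2_space_diff L2_space_add L2_space_fst L2_space_snd g)
  have a1: "(\<lambda>x. a t x - 1) \<in> L2_space M1" for t by (intro L2_space_diff a M1.L2_space_const)
  have b1: "(\<lambda>x. b t x - 1) \<in> L2_space M2" for t by (intro L2_space_diff b M2.L2_space_const)
  have na: "L2_norm M1 (\<lambda>x. a t x - 1) \<le> L2_norm M1 (ra t) + \<bar>t\<bar> / 2 * L2_norm M1 g1" for t
    using L2_norm_triangle[OF ra L2_space_cmult[OF g(2)], of t "t / 2"] unfolding L2_norm_cmult by (simp add: ra_def)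
  have nb: "L2_norm M2 (\<lambda>x. b t x - 1) \<le> L2_norm M2 (rb t) + \<bar>t\<bar> / 2 * L2_norm M2 g2" for t
    using L2_norm_triangle[OF rb L2_space_cmult[OF g(3)], of t "t / 2"] unfolding L2_norm_cmult by (simp add: rb_def)
  define X where "X t = L2_norm ?M (r t) + (L2_norm M1 (ra t) + L2_norm M2 (rb t) +
      (L2_norm M1 (ra t) + \<bar>t\<bar> / 2 * L2_norm M1 g1) * (L2_norm M2 (rb t) + \<bar>t\<bar> / 2 * L2_norm M2 g2))" for t
  have main: "\<bar>t\<bar> / 2 * L2_norm ?M q \<le> X t" for t
  proof -
    define w where "w z = (ra t (fst z) + rb t (snd z)) + (a t (fst z) - 1) * (b t (snd z) - 1)" for z
    have s1: "(\<lambda>z. ra t (fst z) + rb t (snd z)) \<in> L2_space ?M"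
      by (intro L2_space_add L2_space_fst L2_space_snd ra rb)
    have s2: "(\<lambda>z. (a t (fst z) - 1) * (b t (snd z) - 1)) \<in> L2_space ?M"
      by (intro L2_pair_mult(1) a1 b1)
    have w: "w \<in> L2_space ?M" unfolding w_def by (intro L2_space_add s1 s2)
    \<comment> \<open>The expansion of \<open>a b - 1\<close>, with the linear parts of the three
      remainders collected in \<open>q\<close>.\<close>
    have eq: "(\<lambda>z. t / 2 * q z) = (\<lambda>z. w z - r t z)"
      by (auto simp: w_def r_def q_def ra_def rb_def algebra_simps)
    have "\<bar>t / 2\<bar> * L2_norm ?M q = L2_norm ?M (\<lambda>z. w z - r t z)"
      by (simp only: L2_norm_cmult[symmetric] eq)
    also have "\<dots> \<le> L2_norm ?M w + L2_norm ?M (r t)"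
      using L2_norm_triangle[OF w L2_space_cmult[OF r, of "-1" t]] L2_norm_cmult[of ?M "-1" "r t"] by simp
    also have "L2_norm ?M w \<le> L2_norm ?M (\<lambda>z. ra t (fst z) + rb t (snd z)) + L2_norm ?M (\<lambda>z. (a t (fst z) - 1) * (b t (snd z) - 1))"
      unfolding w_def by (intro L2_norm_triangle s1 s2)
    also have "L2_norm ?M (\<lambda>z. ra t (fst z) + rb t (snd z)) \<le> L2_norm M1 (ra t) + L2_norm M2 (rb t)"
      using L2_norm_triangle[OF L2_space_fst[OF ra] L2_space_snd[OF rb], of t t] by (simp add: L2_norm_fst L2_norm_snd ra rb)
    also have "L2_norm ?M (\<lambda>z. (a t (fst z) - 1) * (b t (snd z) - 1)) = L2_norm M1 (\<lambda>x. a t x - 1) * L2_norm M2 (\<lambda>x. b t x - 1)"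
      by (rule L2_pair_mult(2)[OF a1 b1])
    also have "\<dots> \<le> (L2_norm M1 (ra t) + \<bar>t\<bar> / 2 * L2_norm M1 g1) * (L2_norm M2 (rb t) + \<bar>t\<bar> / 2 * L2_norm M2 g2)"
      by (intro mult_mono na nb) auto
    finally show ?thesis by (simp add: X_def)
  qed
  have A': "((\<lambda>t. L2_norm M1 (ra t) / \<bar>t\<bar>) \<longlongrightarrow> 0) (at 0)" using A by (simp add: ra_def[abs_def])
  have B': "((\<lambda>t. L2_norm M2 (rb t) / \<bar>t\<bar>) \<longlongrightarrow> 0) (at 0)" using B by (simp add: rb_def[abs_def])
  have R': "((\<lambda>t. L2_norm ?M (r t) / \<bar>t\<bar>) \<longlongrightarrow> 0) (at 0)" using R by (simp add: r_def[abs_def])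
  have t0: "((\<lambda>t::real. \<bar>t\<bar>) \<longlongrightarrow> 0) (at 0)"
    using tendsto_rabs[OF tendsto_ident_at, of 0 UNIV] by simp
  have "((\<lambda>t. L2_norm ?M (r t) / \<bar>t\<bar> + (L2_norm M1 (ra t) / \<bar>t\<bar> + L2_norm M2 (rb t) / \<bar>t\<bar> +
      \<bar>t\<bar> * ((L2_norm M1 (ra t) / \<bar>t\<bar> + L2_norm M1 g1 / 2) * (L2_norm M2 (rb t) / \<bar>t\<bar> + L2_norm M2 g2 / 2)))) \<longlongrightarrow>
      0 + (0 + 0 + 0 * ((0 + L2_norm M1 g1 / 2) * (0 + L2_norm M2 g2 / 2)))) (at 0)"
    by (intro tendsto_intros A' B' R' t0)
  then have lim: "((\<lambda>t. L2_norm ?M (r t) / \<bar>t\<bar> + (L2_norm M1 (ra t) / \<bar>t\<bar> + L2_norm M2 (rb t) / \<bar>t\<bar> +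
      \<bar>t\<bar> * ((L2_norm M1 (ra t) / \<bar>t\<bar> + L2_norm M1 g1 / 2) * (L2_norm M2 (rb t) / \<bar>t\<bar> + L2_norm M2 g2 / 2)))) \<longlongrightarrow> 0) (at 0)"
    by simp
  have "L2_norm ?M q / 2 \<le> 0"
  proof (rule tendsto_lowerbound[OF lim])
    show "\<forall>\<^sub>F t in at 0. L2_norm ?M q / 2 \<le> L2_norm ?M (r t) / \<bar>t\<bar> + (L2_norm M1 (ra t) / \<bar>t\<bar> + L2_norm M2 (rb t) / \<bar>t\<bar> +
      \<bar>t\<bar> * ((L2_norm M1 (ra t) / \<bar>t\<bar> + L2_norm M1 g1 / 2) * (L2_norm M2 (rb t) / \<bar>t\<bar> + L2_norm M2 g2 / 2)))"
      using eventually_neq_at_within[of 0]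
    proof eventually_elim
      case (elim t)
      then have "L2_norm ?M q / 2 \<le> X t / \<bar>t\<bar>" using main[of t] by (simp add: field_simps)
      also have "X t / \<bar>t\<bar> = L2_norm ?M (r t) / \<bar>t\<bar> + (L2_norm M1 (ra t) / \<bar>t\<bar> + L2_norm M2 (rb t) / \<bar>t\<bar> +
        \<bar>t\<bar> * ((L2_norm M1 (ra t) / \<bar>t\<bar> + L2_norm M1 g1 / 2) * (L2_norm M2 (rb t) / \<bar>t\<bar> + L2_norm M2 g2 / 2)))"
        using elim unfolding X_def by (simp add: field_simps)
      finally show ?case .
    qed
  qed simp
  then have "L2_norm ?M q = 0" using L2_norm_nonneg[of ?M q] by linarith
  from L2_norm_eq_0_AE[OF q this] show ?thesis by (auto elim!: eventually_mono simp: q_def)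
qed

lemma L2_norm_div_abs_smallo:
  "((\<lambda>t::real. L2_norm M (f t) / \<bar>t\<bar>) \<longlongrightarrow> 0) (at 0) \<longleftrightarrow> (\<lambda>t. L2_norm M (f t)) \<in> o[at 0](\<lambda>t. \<bar>t\<bar>)"
proof
  show "(\<lambda>t. L2_norm M (f t)) \<in> o[at 0](\<lambda>t. \<bar>t\<bar>)" if "((\<lambda>t. L2_norm M (f t) / \<bar>t\<bar>) \<longlongrightarrow> 0) (at 0)"
    by (rule smalloI_tendsto[OF that]) (auto simp: eventually_at_filter)
qed (rule smalloD_tendsto)

text \<open>Freezing one factor of a product curve at time 0 gives again a curve in the product
  family, since the family contains all pairs. Its tangent is the section integral of
  \<open>g\<close>. Hence each additive component of a tangent is itself a tangent, which later
  permits the two components to be rescaled separately.\<close>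

lemma L2_differentiable_marginals:
  fixes P0 :: "'a measure" and Q0 :: "'b measure"
  assumes F: "prob_family A1 F" and G: "prob_family A2 G" and P0F: "P0 \<in> F" and Q0G: "Q0 \<in> G"
    and curve: "L2_differentiable_curve (prod_family F G) e R g" and R0: "R 0 = P0 \<Otimes>\<^sub>M Q0"
  obtains g1 g2 where "g1 \<in> L2_zero P0" "g2 \<in> L2_zero Q0"
    "AE z in P0 \<Otimes>\<^sub>M Q0. g z = g1 (fst z) + g2 (snd z)"
    "(\<lambda>z. g1 (fst z)) \<in> tangent_cone (P0 \<Otimes>\<^sub>M Q0) (prod_family F G)"
    "(\<lambda>z. g2 (snd z)) \<in> tangent_cone (P0 \<Otimes>\<^sub>M Q0) (prod_family F G)"
proof -
  have psF: "prob_space P" and sF: "sets P = sets A1" if "P \<in> F" for P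
    using F that by (auto simp: prob_family_def)
  have psG: "prob_space Q" and sG: "sets Q = sets A2" if "Q \<in> G" for Q
    using G that by (auto simp: prob_family_def)
  interpret P0: prob_space P0 by (rule psF[OF P0F])
  interpret Q0: prob_space Q0 by (rule psG[OF Q0G])
  interpret PQ: pair_prob_space P0 Q0 ..
  interpret QP: pair_prob_space Q0 P0 ..
  let ?M = "P0 \<Otimes>\<^sub>M Q0"
  obtain L where e: "e > 0" and RF: "\<And>t. \<bar>t\<bar> < e \<Longrightarrow> R t \<in> prod_family F G" and g: "g \<in> L2_space ?M"
    and L: "\<And>t. \<bar>t\<bar> < e \<Longrightarrow> is_density_quotient (R t) ?M (L t)"
    and L1: "(\<lambda>t. L2_norm ?M (\<lambda>x. 2 * (sqrt (enn2real (L t x)) - 1) - t * g x)) \<in> o[at 0](\<lambda>t. \<bar>t\<bar>)"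
    and L2: "(\<lambda>t. measure (R t) {x \<in> space (R t). L t x = \<infinity>}) \<in> o[at 0](\<lambda>t. t\<^sup>2)"
    using curve unfolding L2_differentiable_curve_def R0 by auto
  \<comment> \<open>At \<open>t = 0\<close> the factors are prescribed, and outside the domain of
    the curve any members of the families are taken. Both factor curves are then defined for every
    real \<open>t\<close> and stay in their families.\<close>
  have "\<forall>t. \<exists>P Q. P \<in> F \<and> Q \<in> G \<and> (\<bar>t\<bar> < e \<longrightarrow> R t = P \<Otimes>\<^sub>M Q) \<and> (t = 0 \<longrightarrow> P = P0 \<and> Q = Q0)"
  proof
    fix t show "\<exists>P Q. P \<in> F \<and> Q \<in> G \<and> (\<bar>t\<bar> < e \<longrightarrow> R t = P \<Otimes>\<^sub>M Q) \<and> (t = 0 \<longrightarrow> P = P0 \<and> Q = Q0)"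
      using RF[of t] R0 P0F Q0G unfolding prod_family_def by (cases "t = 0"; cases "\<bar>t\<bar> < e") auto
  qed
  then obtain P Q where PF: "\<And>t. P t \<in> F" and QG: "\<And>t. Q t \<in> G"
    and RPQ: "\<And>t. \<bar>t\<bar> < e \<Longrightarrow> R t = P t \<Otimes>\<^sub>M Q t" and PQ0: "P 0 = P0" "Q 0 = Q0"
    by metis
  have sP: "sets (P t) = sets P0" and sQ: "sets (Q t) = sets Q0" for t
    using sF[OF PF] sF[OF P0F] sG[OF QG] sG[OF Q0G] by auto
  have "\<forall>t. \<exists>l. is_density_quotient (P t) P0 l"
    by (intro allI ex_density_quotient) (use psF[OF PF] P0.finite_measure_axioms sP in \<open>auto intro: prob_space.finite_measure\<close>)
  then obtain l where l: "\<And>t. is_density_quotient (P t) P0 (l t)" by metis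
  have "\<forall>t. \<exists>l. is_density_quotient (Q t) Q0 l"
    by (intro allI ex_density_quotient) (use psG[OF QG] Q0.finite_measure_axioms sQ in \<open>auto intro: prob_space.finite_measure\<close>)
  then obtain m where m: "\<And>t. is_density_quotient (Q t) Q0 (m t)" by metis
  define a where "a t x = sqrt (enn2real (l t x))" for t x
  define b where "b t y = sqrt (enn2real (m t y))" for t y
  define pa where "pa t = measure (P t) {x \<in> space (P t). l t x = \<infinity>}" for t
  define qb where "qb t = measure (Q t) {x \<in> space (Q t). m t x = \<infinity>}" for t
  note ra = density_quotient_root[OF psF[OF PF] sP l] and rb = density_quotient_root[OF psG[OF QG] sQ m]
  have a2: "a t \<in> L2_space P0" and an: "(L2_norm P0 (a t))\<^sup>2 = 1 - pa t" for t
    using ra[of t] by (simp_all add: a_def[abs_def] L2_norm_power2 pa_def)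
  have b2: "b t \<in> L2_space Q0" and bn: "(L2_norm Q0 (b t))\<^sup>2 = 1 - qb t" for t
    using rb[of t] by (simp_all add: b_def[abs_def] L2_norm_power2 qb_def)
  have a1: "L2_norm P0 (a t) \<le> 1" for t
    by (rule power2_le_imp_le) (auto simp: an pa_def)
  have b1: "L2_norm Q0 (b t) \<le> 1" for t
    by (rule power2_le_imp_le) (auto simp: bn qb_def)
  have ab2: "(\<lambda>z. a t (fst z) * b t (snd z)) \<in> L2_space ?M" for t
    by (rule PQ.L2_pair_mult[OF a2 b2])
  have AE_L: "AE z in ?M. sqrt (enn2real (L t z)) = a t (fst z) * b t (snd z)" if "\<bar>t\<bar> < e" for t
    using density_quotient_pair_AE[OF psF[OF PF[of t]] P0.prob_space_axioms psG[OF QG[of t]] Q0.prob_space_axioms sP sQ l m, of "L t"]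
      L[OF that] RPQ[OF that]
    by (auto elim!: eventually_mono simp: a_def b_def enn2real_mult real_sqrt_mult)
  have Lm: "(\<lambda>z. sqrt (enn2real (L t z))) \<in> borel_measurable ?M" if "\<bar>t\<bar> < e" for t
    using L[OF that] by (auto simp: is_density_quotient_def)
  have ev: "\<forall>\<^sub>F t in at 0. \<bar>t\<bar> < e"
    using e by (auto simp: eventually_at dist_real_def intro!: exI[of _ e])
  \<comment> \<open>Halves the differentiability condition and replaces the root of the joint
    quotient by the product of the marginal roots, which agrees with it almost everywhere.\<close>
  have R: "((\<lambda>t. L2_norm ?M (\<lambda>z. a t (fst z) * b t (snd z) - 1 - t / 2 * g z) / \<bar>t\<bar>) \<longlongrightarrow> 0) (at 0)"
  proof (rule Lim_transform_eventually)
    show "((\<lambda>t. 1/2 * (L2_norm ?M (\<lambda>x. 2 * (sqrt (enn2real (L t x)) - 1) - t * g x) / \<bar>t\<bar>)) \<longlongrightarrow> 0) (at 0)"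
      by (intro tendsto_mult_right_zero smalloD_tendsto L1)
    show "\<forall>\<^sub>F t in at 0. 1/2 * (L2_norm ?M (\<lambda>x. 2 * (sqrt (enn2real (L t x)) - 1) - t * g x) / \<bar>t\<bar>) =
        L2_norm ?M (\<lambda>z. a t (fst z) * b t (snd z) - 1 - t / 2 * g z) / \<bar>t\<bar>"
      using ev
    proof eventually_elim
      case (elim t)
      have "L2_norm ?M (\<lambda>z. a t (fst z) * b t (snd z) - 1 - t / 2 * g z) =
          L2_norm ?M (\<lambda>x. 1/2 * (2 * (sqrt (enn2real (L t x)) - 1) - t * g x))"
      proof (rule L2_norm_cong_AE)
        show "AE z in ?M. a t (fst z) * b t (snd z) - 1 - t / 2 * g z = 1/2 * (2 * (sqrt (enn2real (L t z)) - 1) - t * g z)"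
          using AE_L[OF elim] by eventually_elim (simp add: field_simps)
      qed (use L2_spaceD(1)[OF ab2] L2_spaceD(1)[OF g] Lm[OF elim] in measurable)
      then show ?case by (simp only: L2_norm_cmult)
    qed
  qed
  define g1 where "g1 x = (\<integral>y. g (x, y) \<partial>Q0)" for x
  define g2 where "g2 y = (\<integral>x. g (x, y) \<partial>P0)" for y
  have ga: "(\<integral>z. g z \<partial>?M) = 0"
    by (rule PQ.root_marginal_derivative(1)[OF g a2 _ a1 b2 _ b1 R]) (simp_all add: a_def b_def)
  have la: "((\<lambda>t. L2_norm P0 (\<lambda>x. a t x - 1 - t / 2 * g1 x) / \<bar>t\<bar>) \<longlongrightarrow> 0) (at 0)"
    unfolding g1_def
    by (rule PQ.root_marginal_derivative(2)[OF g a2 _ a1 b2 _ b1 R]) (simp_all add: a_def b_def)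
  have g_swap: "(\<lambda>z. g (snd z, fst z)) \<in> L2_space (Q0 \<Otimes>\<^sub>M P0)" by (rule PQ.L2_swap[OF g])
  have R': "((\<lambda>t. L2_norm (Q0 \<Otimes>\<^sub>M P0) (\<lambda>z. b t (fst z) * a t (snd z) - 1 - t / 2 * g (snd z, fst z)) / \<bar>t\<bar>) \<longlongrightarrow> 0) (at 0)"
  proof -
    have "(\<lambda>z. a t (fst z) * b t (snd z) - 1 - t / 2 * g z) \<in> L2_space ?M" for t
      by (intro L2_space_diff L2_space_cmult ab2 g PQ.L2_space_const)
    from PQ.L2_swap(2)[OF this] R show ?thesis by (simp add: mult.commute)
  qed
  have lb: "((\<lambda>t. L2_norm Q0 (\<lambda>y. b t y - 1 - t / 2 * g2 y) / \<bar>t\<bar>) \<longlongrightarrow> 0) (at 0)"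
    using QP.root_marginal_derivative(2)[OF g_swap b2 _ b1 a2 _ a1 R'] by (simp add: a_def b_def g2_def)
  have g1: "g1 \<in> L2_space P0" unfolding g1_def[abs_def] by (rule PQ.L2_section_integral[OF g])
  have g2: "g2 \<in> L2_space Q0" using QP.L2_section_integral(1)[OF g_swap] by (simp add: g2_def[abs_def])
  have z1: "(\<integral>x. g1 x \<partial>P0) = 0"
    unfolding g1_def using PQ.integral_fst'[OF PQ.L2_integrable[OF g]] ga by simp
  have z2: "(\<integral>y. g2 y \<partial>Q0) = 0"
    unfolding g2_def using PQ.integral_snd[of "\<lambda>x y. g (x, y)"] PQ.L2_integrable[OF g] ga by simp
  have sum: "AE z in ?M. g z = g1 (fst z) + g2 (snd z)"
    by (rule PQ.root_product_derivative[OF g g1 g2 a2 b2 R la lb])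
  \<comment> \<open>The regular mass of a product is the product of the regular masses. Hence each
    marginal singular mass is at most the joint one and inherits its o(t^2).\<close>
  have mass: "measure (R t) {x \<in> space (R t). L t x = \<infinity>} = 1 - (1 - pa t) * (1 - qb t)" if "\<bar>t\<bar> < e" for t
  proof -
    have "prob_space (R t)"
    proof -
      interpret prob_space "P t" by (rule psF[OF PF])
      interpret q: prob_space "Q t" by (rule psG[OF QG])
      interpret pair_prob_space "P t" "Q t" ..
      show ?thesis unfolding RPQ[OF that] by unfold_locales
    qed
    moreover have "sets (R t) = sets ?M" unfolding RPQ[OF that] by (intro sets_pair_measure_cong sP sQ)
    ultimately have "1 - measure (R t) {x \<in> space (R t). L t x = \<infinity>} = (\<integral>x. (sqrt (enn2real (L t x)))\<^sup>2 \<partial>?M)"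
      using density_quotient_root(2)[OF _ _ L[OF that]] by simp
    also have "\<dots> = (\<integral>z. (a t (fst z) * b t (snd z))\<^sup>2 \<partial>?M)"
    proof (rule integral_cong_AE)
      show "AE z in ?M. (sqrt (enn2real (L t z)))\<^sup>2 = (a t (fst z) * b t (snd z))\<^sup>2"
        using AE_L[OF that] by eventually_elim (simp only:)
    qed (intro borel_measurable_power Lm that L2_spaceD(1)[OF ab2])+
    also have "\<dots> = (L2_norm P0 (a t) * L2_norm Q0 (b t))\<^sup>2"
      using PQ.L2_pair_mult(2)[OF a2 b2, of t t] by (simp add: L2_norm_power2[symmetric])
    also have "\<dots> = (1 - pa t) * (1 - qb t)" by (simp add: power_mult_distrib an bn)
    finally show ?thesis by simp
  qed
  have pq01: "0 \<le> pa t" "0 \<le> qb t" "pa t \<le> 1" "qb t \<le> 1" for t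
    using prob_space.prob_le_1[OF psF[OF PF]] prob_space.prob_le_1[OF psG[OF QG]] by (auto simp: pa_def qb_def)
  have le1: "pa t \<le> 1 - (1 - pa t) * (1 - qb t)" and le2: "qb t \<le> 1 - (1 - pa t) * (1 - qb t)" for t
    using pq01[of t] mult_nonneg_nonneg[of "1 - pa t" "qb t"] mult_nonneg_nonneg[of "pa t" "1 - qb t"]
    by (auto simp: algebra_simps)
  have small: "h \<in> o[at 0](\<lambda>t. t\<^sup>2)" if "\<And>t. 0 \<le> h t" "\<And>t. h t \<le> 1 - (1 - pa t) * (1 - qb t)" for h
  proof (rule landau_o.big_small_trans[OF _ L2])
    show "h \<in> O[at 0](\<lambda>t. measure (R t) {x \<in> space (R t). L t x = \<infinity>})"
    proof (rule bigoI[where c=1])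
      show "\<forall>\<^sub>F t in at 0. norm (h t) \<le> 1 * norm (measure (R t) {x \<in> space (R t). L t x = \<infinity>})"
        using ev
      proof eventually_elim
        case (elim t)
        then show ?case using mass[OF elim] that(1)[of t] that(2)[of t] by simp
      qed
    qed
  qed
  have c1: "(\<lambda>z. g1 (fst z)) \<in> tangent_cone ?M (prod_family F G)"
  proof -
    let ?R = "\<lambda>t. P t \<Otimes>\<^sub>M Q0"
    have sing: "measure (?R t) {z \<in> space (?R t). l t (fst z) = \<infinity>} = pa t" for t
    proof -
      interpret prob_space "P t" by (rule psF[OF PF])
      interpret pq: pair_prob_space "P t" Q0 ..
      have "sets (?R t) = sets ?M" by (intro sets_pair_measure_cong sP refl)
      from density_quotient_root(2)[OF pq.prob_space_axioms this density_quotient_fst[OF psF[OF PF] P0.prob_space_axioms Q0.prob_space_axioms sP l]]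
      have "1 - measure (?R t) {z \<in> space (?R t). l t (fst z) = \<infinity>} = (L2_norm ?M (\<lambda>z. a t (fst z)))\<^sup>2"
        by (simp add: L2_norm_power2 a_def)
      also have "\<dots> = 1 - pa t" by (simp add: PQ.L2_norm_fst[OF a2] an)
      finally show ?thesis by simp
    qed
    \<comment> \<open>The radius 1 is an arbitrary choice, as \<open>P t\<close> belongs to
      \<open>F\<close> for all real \<open>t\<close>.\<close>
    have "L2_differentiable_curve (prod_family F G) 1 ?R (\<lambda>z. g1 (fst z))"
      unfolding L2_differentiable_curve_def PQ0
    proof (intro conjI exI[of _ "\<lambda>t z. l t (fst z)"] allI impI)
      show "?R t \<in> prod_family F G" for t using PF Q0G by (auto simp: prod_family_def)
      show "(\<lambda>z. g1 (fst z)) \<in> L2_space ?M" by (rule PQ.L2_space_fst[OF g1])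
      show "is_density_quotient (?R t) ?M (\<lambda>z. l t (fst z))" for t
        by (rule density_quotient_fst[OF psF[OF PF] P0.prob_space_axioms Q0.prob_space_axioms sP l])
      have "L2_norm ?M (\<lambda>z. 2 * (sqrt (enn2real (l t (fst z))) - 1) - t * g1 (fst z)) =
          2 * L2_norm P0 (\<lambda>x. a t x - 1 - t / 2 * g1 x)" for t
      proof -
        have "(\<lambda>x. a t x - 1 - t / 2 * g1 x) \<in> L2_space P0"
          by (intro L2_space_diff L2_space_cmult a2 g1 P0.L2_space_const)
        from PQ.L2_norm_fst[OF this] have "L2_norm ?M (\<lambda>z. 2 * (a t (fst z) - 1 - t / 2 * g1 (fst z))) = 2 * L2_norm P0 (\<lambda>x. a t x - 1 - t / 2 * g1 x)"
          unfolding L2_norm_cmult by simp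
        then show ?thesis by (simp add: a_def algebra_simps)
      qed
      then show "(\<lambda>t. L2_norm ?M (\<lambda>z. 2 * (sqrt (enn2real (l t (fst z))) - 1) - t * g1 (fst z))) \<in> o[at 0](\<lambda>t. \<bar>t\<bar>)"
        using la by (simp add: L2_norm_div_abs_smallo)
      show "(\<lambda>t. measure (?R t) {z \<in> space (?R t). l t (fst z) = \<infinity>}) \<in> o[at 0](\<lambda>t. t\<^sup>2)"
        unfolding sing by (rule small) (use pq01 le1 in auto)
    qed simp
    then show ?thesis unfolding tangent_cone_def using PQ0 by blast
  qed
  have c2: "(\<lambda>z. g2 (snd z)) \<in> tangent_cone ?M (prod_family F G)"
  proof -
    let ?R = "\<lambda>t. P0 \<Otimes>\<^sub>M Q t"
    have sing: "measure (?R t) {z \<in> space (?R t). m t (snd z) = \<infinity>} = qb t" for t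
    proof -
      interpret prob_space "Q t" by (rule psG[OF QG])
      interpret pq: pair_prob_space P0 "Q t" ..
      have "sets (?R t) = sets ?M" by (intro sets_pair_measure_cong sQ refl)
      from density_quotient_root(2)[OF pq.prob_space_axioms this density_quotient_snd[OF psG[OF QG] P0.prob_space_axioms Q0.prob_space_axioms sQ m]]
      have "1 - measure (?R t) {z \<in> space (?R t). m t (snd z) = \<infinity>} = (L2_norm ?M (\<lambda>z. b t (snd z)))\<^sup>2"
        by (simp add: L2_norm_power2 b_def)
      also have "\<dots> = 1 - qb t" by (simp add: PQ.L2_norm_snd[OF b2] bn)
      finally show ?thesis by simp
    qed
    have "L2_differentiable_curve (prod_family F G) 1 ?R (\<lambda>z. g2 (snd z))"
      unfolding L2_differentiable_curve_def PQ0
    proof (intro conjI exI[of _ "\<lambda>t z. m t (snd z)"] allI impI)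
      show "?R t \<in> prod_family F G" for t using P0F QG by (auto simp: prod_family_def)
      show "(\<lambda>z. g2 (snd z)) \<in> L2_space ?M" by (rule PQ.L2_space_snd[OF g2])
      show "is_density_quotient (?R t) ?M (\<lambda>z. m t (snd z))" for t
        by (rule density_quotient_snd[OF psG[OF QG] P0.prob_space_axioms Q0.prob_space_axioms sQ m])
      have "L2_norm ?M (\<lambda>z. 2 * (sqrt (enn2real (m t (snd z))) - 1) - t * g2 (snd z)) =
          2 * L2_norm Q0 (\<lambda>x. b t x - 1 - t / 2 * g2 x)" for t
      proof -
        have "(\<lambda>x. b t x - 1 - t / 2 * g2 x) \<in> L2_space Q0"
          by (intro L2_space_diff L2_space_cmult b2 g2 Q0.L2_space_const)
        from PQ.L2_norm_snd[OF this] have "L2_norm ?M (\<lambda>z. 2 * (b t (snd z) - 1 - t / 2 * g2 (snd z))) = 2 * L2_norm Q0 (\<lambda>x. b t x - 1 - t / 2 * g2 x)"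
          unfolding L2_norm_cmult by simp
        then show ?thesis by (simp add: b_def algebra_simps)
      qed
      then show "(\<lambda>t. L2_norm ?M (\<lambda>z. 2 * (sqrt (enn2real (m t (snd z))) - 1) - t * g2 (snd z))) \<in> o[at 0](\<lambda>t. \<bar>t\<bar>)"
        using lb by (simp add: L2_norm_div_abs_smallo)
      show "(\<lambda>t. measure (?R t) {z \<in> space (?R t). m t (snd z) = \<infinity>}) \<in> o[at 0](\<lambda>t. t\<^sup>2)"
        unfolding sing by (rule small) (use pq01 le2 in auto)
    qed simp
    then show ?thesis unfolding tangent_cone_def using PQ0 by blast
  qed
  show thesis
    by (rule that[OF _ _ sum c1 c2]) (use g1 g2 z1 z2 in \<open>auto simp: L2_zero_def\<close>)
qed

section \<open>Tangent spaces of products\<close>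

lemma fun_span_superset: "S \<subseteq> fun_span S"
proof
  fix s assume "s \<in> S"
  then have "(\<lambda>x. \<Sum>i<Suc 0. 1 * s x) \<in> fun_span S"
    unfolding fun_span_def by (intro CollectI exI[of _ "Suc 0"] exI[of _ "\<lambda>_. 1"] exI[of _ "\<lambda>_. s"]) auto
  then show "s \<in> fun_span S" by simp
qed

lemma fun_spanE:
  assumes "s \<in> fun_span S"
  obtains c u m where "s = (\<lambda>x. \<Sum>i<m. c i * u i x)" "\<forall>i<m::nat. u i \<in> S"
  using assms unfolding fun_span_def mem_Collect_eq by (elim exE conjE) (rule that, auto)

lemma fun_span_cmult:
  assumes "s \<in> fun_span S" shows "(\<lambda>x. r * s x) \<in> fun_span S"
proof -
  obtain c u and m :: nat where s: "s = (\<lambda>x. \<Sum>i<m. c i * u i x)" and u: "\<forall>i<m. u i \<in> S"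
    by (rule fun_spanE[OF assms]) (rule that)
  have "(\<lambda>x. r * s x) = (\<lambda>x. \<Sum>i<m. (r * c i) * u i x)"
    by (auto simp: s sum_distrib_left mult.assoc)
  then show ?thesis using u unfolding fun_span_def
    by (intro CollectI exI[of _ m] exI[of _ "\<lambda>i. r * c i"] exI[of _ u]) auto
qed

lemma fun_span_add:
  assumes "s \<in> fun_span S" "s' \<in> fun_span S" shows "(\<lambda>x. s x + s' x) \<in> fun_span S"
proof -
  obtain c u and m :: nat where s: "s = (\<lambda>x. \<Sum>i<m. c i * u i x)" and u: "\<forall>i<m. u i \<in> S"
    by (rule fun_spanE[OF assms(1)]) (rule that)
  obtain c' u' and m' :: nat where s': "s' = (\<lambda>x. \<Sum>i<m'. c' i * u' i x)" and u': "\<forall>i<m'. u' i \<in> S"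
    by (rule fun_spanE[OF assms(2)]) (rule that)
  let ?c = "\<lambda>i. if i < m then c i else c' (i - m)" and ?u = "\<lambda>i. if i < m then u i else u' (i - m)"
  have split: "(\<Sum>i<m + n. f i) = (\<Sum>i<m. f i) + (\<Sum>i<n. f (m + i))" for f :: "nat \<Rightarrow> real" and n
    by (induction n) simp_all
  have "(\<lambda>x. s x + s' x) = (\<lambda>x. \<Sum>i<m + m'. ?c i * ?u i x)"
    unfolding split s s' by simp
  then show ?thesis using u u' unfolding fun_span_def
    by (intro CollectI exI[of _ "m + m'"] exI[of _ ?c] exI[of _ ?u] conjI allI impI) simp_all
qed

lemma L2_space_sum: "(\<And>i. i < m \<Longrightarrow> u i \<in> L2_space M) \<Longrightarrow> (\<lambda>x. \<Sum>i<m. c i * u i x) \<in> L2_space M" for m :: nat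
proof (induction m)
  case 0
  show ?case by (simp add: L2_space_def)
next
  case (Suc m)
  then show ?case by (simp add: L2_space_add L2_space_cmult)
qed

lemma fun_span_L2: "S \<subseteq> L2_space M \<Longrightarrow> fun_span S \<subseteq> L2_space M"
  unfolding fun_span_def by (auto intro!: L2_space_sum)

lemma L2_closure_cmult:
  assumes S: "S \<subseteq> L2_space M" and h: "h \<in> L2_closure M (fun_span S)"
  shows "(\<lambda>x. r * h x) \<in> L2_closure M (fun_span S)"
proof -
  have h2: "h \<in> L2_space M" using h by (simp add: L2_closure_def)
  have "\<exists>s\<in>fun_span S. L2_norm M (\<lambda>x. r * h x - s x) < \<epsilon>" if "\<epsilon> > 0" for \<epsilon>
  proof -
    have "\<epsilon> / (\<bar>r\<bar> + 1) > 0" using that by simp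
    then obtain s where s: "s \<in> fun_span S" "L2_norm M (\<lambda>x. h x - s x) < \<epsilon> / (\<bar>r\<bar> + 1)"
      using h unfolding L2_closure_def by blast
    have "(\<bar>r\<bar> + 1) * L2_norm M (\<lambda>x. h x - s x) < \<epsilon>"
      using s(2) by (simp add: field_simps)
    moreover have "L2_norm M (\<lambda>x. r * h x - r * s x) \<le> (\<bar>r\<bar> + 1) * L2_norm M (\<lambda>x. h x - s x)"
      by (simp add: L2_norm_cmult mult_right_mono flip: right_diff_distrib)
    ultimately show ?thesis using fun_span_cmult[OF s(1), of r] by force
  qed
  then show ?thesis using L2_space_cmult[OF h2] by (auto simp: L2_closure_def)
qed

lemma L2_closure_add:
  assumes S: "S \<subseteq> L2_space M" and h: "h \<in> L2_closure M (fun_span S)" and h': "h' \<in> L2_closure M (fun_span S)"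
  shows "(\<lambda>x. h x + h' x) \<in> L2_closure M (fun_span S)"
proof -
  have h2: "h \<in> L2_space M" "h' \<in> L2_space M" using h h' by (simp_all add: L2_closure_def)
  have "\<exists>s\<in>fun_span S. L2_norm M (\<lambda>x. h x + h' x - s x) < \<epsilon>" if "\<epsilon> > 0" for \<epsilon>
  proof -
    have "\<epsilon> / 2 > 0" using that by simp
    then obtain s s' where s: "s \<in> fun_span S" "L2_norm M (\<lambda>x. h x - s x) < \<epsilon> / 2"
      "s' \<in> fun_span S" "L2_norm M (\<lambda>x. h' x - s' x) < \<epsilon> / 2"
      using h h' unfolding L2_closure_def by blast
    then have i: "s \<in> L2_space M" "s' \<in> L2_space M" using fun_span_L2[OF S] by auto
    have "L2_norm M (\<lambda>x. (h x - s x) + (h' x - s' x)) < \<epsilon>"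
      using L2_norm_triangle[OF L2_space_diff[OF h2(1) i(1)] L2_space_diff[OF h2(2) i(2)]] s by simp
    then have "L2_norm M (\<lambda>x. h x + h' x - (s x + s' x)) < \<epsilon>" by (simp add: algebra_simps)
    then show ?thesis using fun_span_add[OF s(1,3)] by (intro bexI[of _ "\<lambda>x. s x + s' x"])
  qed
  then show ?thesis using L2_space_add[OF h2] by (auto simp: L2_closure_def)
qed

lemma tangent_cone_L2: "tangent_cone R0 F \<subseteq> L2_space R0"
  by (auto simp: tangent_cone_def L2_differentiable_curve_def)

lemma tangent_cone_subset_space: "tangent_cone R0 F \<subseteq> tangent_space R0 F"
proof
  fix h assume h: "h \<in> tangent_cone R0 F"
  have "L2_norm R0 (\<lambda>x. h x - h x) = 0" by (simp add: L2_norm_def)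
  then show "h \<in> tangent_space R0 F"
    using h subsetD[OF tangent_cone_L2 h] subsetD[OF fun_span_superset h]
    unfolding tangent_space_def L2_closure_def by (auto intro!: bexI[of _ h])
qed

lemma tangent_space_L2: "tangent_space R0 F \<subseteq> L2_space R0"
  by (auto simp: tangent_space_def L2_closure_def)

lemma tangent_space_cmult: "h \<in> tangent_space R0 F \<Longrightarrow> (\<lambda>x. r * h x) \<in> tangent_space R0 F"
  unfolding tangent_space_def by (rule L2_closure_cmult[OF tangent_cone_L2])

lemma tangent_space_add:
  "h \<in> tangent_space R0 F \<Longrightarrow> h' \<in> tangent_space R0 F \<Longrightarrow> (\<lambda>x. h x + h' x) \<in> tangent_space R0 F"
  unfolding tangent_space_def by (rule L2_closure_add[OF tangent_cone_L2])

text \<open>Tangents are functions and not classes, while additive decompositions hold only almost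
  everywhere; this transports membership to the exactly additive version.\<close>

lemma tangent_space_cong_AE:
  assumes h: "h \<in> tangent_space R0 F" and h': "h' \<in> borel_measurable R0" and eq: "AE x in R0. h x = h' x"
  shows "h' \<in> tangent_space R0 F"
proof -
  have h2: "h \<in> L2_space R0" using h tangent_space_L2 by blast
  then have h'2: "h' \<in> L2_space R0"
    by (rule L2_space_bound[OF _ h']) (use eq in \<open>auto elim: eventually_mono\<close>)
  have "L2_norm R0 (\<lambda>x. h' x - s x) = L2_norm R0 (\<lambda>x. h x - s x)" if "s \<in> fun_span (tangent_cone R0 F)" for s
  proof -
    have "s \<in> L2_space R0" using that fun_span_L2[OF tangent_cone_L2] by blast
    then show ?thesis
      by (intro L2_norm_cong_AE L2_spaceD(1)[OF L2_space_diff] h2 h'2) (use eq in \<open>auto elim: eventually_mono\<close>)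
  qed
  then show ?thesis using h h'2 unfolding tangent_space_def L2_closure_def by auto
qed

definition direct_sum :: "('a \<Rightarrow> real) \<Rightarrow> ('b \<Rightarrow> real) \<Rightarrow> 'a \<times> 'b \<Rightarrow> real" (infixr "\<oplus>\<^sub>f" 65) where
  "direct_sum f h z = f (fst z) + h (snd z)"

context pair_prob_space
begin

lemma direct_sum_L2:
  "f \<in> L2_space M1 \<Longrightarrow> h \<in> L2_space M2 \<Longrightarrow> f \<oplus>\<^sub>f h \<in> L2_space (M1 \<Otimes>\<^sub>M M2)"
  unfolding direct_sum_def[abs_def] by (intro L2_space_add L2_space_fst L2_space_snd)

text \<open>The cross terms factor into products of means, which are 0 by centring; centred
  functions of different coordinates are therefore orthogonal.\<close>

lemma direct_sum_inner:
  assumes f: "f \<in> L2_zero M1" "f' \<in> L2_zero M1" and h: "h \<in> L2_zero M2" "h' \<in> L2_zero M2"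
  shows "(\<integral>z. (f \<oplus>\<^sub>f h) z * (f' \<oplus>\<^sub>f h') z \<partial>(M1 \<Otimes>\<^sub>M M2)) = (\<integral>x. f x * f' x \<partial>M1) + (\<integral>y. h y * h' y \<partial>M2)"
proof -
  note D = f[THEN L2_zeroD(1)] h[THEN L2_zeroD(1)]
  note I = D(1,2)[THEN M1.L2_integrable] D(3,4)[THEN M2.L2_integrable]
  have "(\<integral>z. (f \<oplus>\<^sub>f h) z * (f' \<oplus>\<^sub>f h') z \<partial>(M1 \<Otimes>\<^sub>M M2)) =
     (\<integral>z. (f (fst z) * f' (fst z) + h (snd z) * h' (snd z)) + (f (fst z) * h' (snd z) + f' (fst z) * h (snd z)) \<partial>(M1 \<Otimes>\<^sub>M M2))"
    by (intro Bochner_Integration.integral_cong) (auto simp: direct_sum_def algebra_simps)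
  also have "\<dots> = ((\<integral>x. f x * f' x \<partial>M1) + (\<integral>y. h y * h' y \<partial>M2)) +
      ((\<integral>x. f x \<partial>M1) * (\<integral>y. h' y \<partial>M2) + (\<integral>x. f' x \<partial>M1) * (\<integral>y. h y \<partial>M2))"
    using pair_integral_fst[OF L2_integrable_mult[OF D(1,2)]] pair_integral_snd[OF L2_integrable_mult[OF D(3,4)]]
      pair_integral_mult[OF I(1,4)] pair_integral_mult[OF I(2,3)]
    by simp
  finally show ?thesis using f h by (simp add: L2_zeroD)
qed

lemma direct_sum_norm2:
  assumes "f \<in> L2_zero M1" "h \<in> L2_zero M2"
  shows "(L2_norm (M1 \<Otimes>\<^sub>M M2) (f \<oplus>\<^sub>f h))\<^sup>2 = (L2_norm M1 f)\<^sup>2 + (L2_norm M2 h)\<^sup>2"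
  using direct_sum_inner[OF assms(1,1) assms(2,2)] unfolding L2_norm_power2 by (simp add: power2_eq_square)

end

lemma (in prob_space) L2_zero_add: "f \<in> L2_zero M \<Longrightarrow> g \<in> L2_zero M \<Longrightarrow> (\<lambda>x. f x + g x) \<in> L2_zero M"
  using L2_integrable by (auto simp: L2_zero_def)

lemma (in prob_space) L2_zero_cmult: "f \<in> L2_zero M \<Longrightarrow> (\<lambda>x. c * f x) \<in> L2_zero M"
  using L2_integrable by (auto simp: L2_zero_def)

lemma (in prob_space) L2_zero_diff: "f \<in> L2_zero M \<Longrightarrow> g \<in> L2_zero M \<Longrightarrow> (\<lambda>x. f x - g x) \<in> L2_zero M"
  using L2_integrable by (auto simp: L2_zero_def)

lemma (in prob_space) L2_zero_sum:
  "(\<And>i. i < m \<Longrightarrow> u i \<in> L2_zero M) \<Longrightarrow> (\<lambda>x. \<Sum>i<m. c i * u i x) \<in> L2_zero M" for m :: nat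
proof (induction m)
  case 0
  show ?case by (simp add: L2_zero_def L2_space_def)
next
  case (Suc m)
  then show ?case by (simp add: L2_zero_add L2_zero_cmult)
qed

lemma tangent_cone_marginals:
  assumes "prob_family A1 F" "prob_family A2 G" "P0 \<in> F" "Q0 \<in> G"
    and "g \<in> tangent_cone (P0 \<Otimes>\<^sub>M Q0) (prod_family F G)"
  obtains g1 g2 where "g1 \<in> L2_zero P0" "g2 \<in> L2_zero Q0"
    "AE z in P0 \<Otimes>\<^sub>M Q0. g z = (g1 \<oplus>\<^sub>f g2) z"
    "(\<lambda>z. g1 (fst z)) \<in> tangent_cone (P0 \<Otimes>\<^sub>M Q0) (prod_family F G)"
    "(\<lambda>z. g2 (snd z)) \<in> tangent_cone (P0 \<Otimes>\<^sub>M Q0) (prod_family F G)"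
proof -
  obtain e R where "L2_differentiable_curve (prod_family F G) e R g" "R 0 = P0 \<Otimes>\<^sub>M Q0"
    using assms(5) by (auto simp: tangent_cone_def)
  then show thesis
    by (rule L2_differentiable_marginals[OF assms(1-4)]) (rule that, auto simp: direct_sum_def)
qed

text \<open>Each approximating combination of tangents splits into a combination of first and one of
  second components, which are again tangents. By Pythagoras either component error is at most the
  joint error. The components are wanted singly because the weights \<open>1 / (1 - d)\<close> and
  \<open>1 / d\<close> given to them later differ in general.\<close>

lemma tangent_space_components:
  fixes P0 :: "'a measure" and Q0 :: "'b measure"
  assumes fam: "prob_family A1 F" "prob_family A2 G" "P0 \<in> F" "Q0 \<in> G"
    and kt: "kt \<in> tangent_space (P0 \<Otimes>\<^sub>M Q0) (prod_family F G)"
    and k1: "kt1 \<in> L2_zero P0" and k2: "kt2 \<in> L2_zero Q0"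
    and eq: "AE z in P0 \<Otimes>\<^sub>M Q0. kt z = (kt1 \<oplus>\<^sub>f kt2) z"
  shows "(\<lambda>z. kt1 (fst z)) \<in> tangent_space (P0 \<Otimes>\<^sub>M Q0) (prod_family F G)"
    and "(\<lambda>z. kt2 (snd z)) \<in> tangent_space (P0 \<Otimes>\<^sub>M Q0) (prod_family F G)"
proof -
  interpret P0: prob_space P0 using fam by (auto simp: prob_family_def)
  interpret Q0: prob_space Q0 using fam by (auto simp: prob_family_def)
  interpret PQ: pair_prob_space P0 Q0 ..
  let ?M = "P0 \<Otimes>\<^sub>M Q0" and ?K = "tangent_cone (P0 \<Otimes>\<^sub>M Q0) (prod_family F G)"
  have kt2: "kt \<in> L2_space ?M" using kt tangent_space_L2 by blast
  have approx: "\<exists>s1 s2. s1 \<in> L2_zero P0 \<and> s2 \<in> L2_zero Q0 \<and> (\<lambda>z. s1 (fst z)) \<in> fun_span ?K \<and>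
      (\<lambda>z. s2 (snd z)) \<in> fun_span ?K \<and> L2_norm P0 (\<lambda>x. kt1 x - s1 x) < \<epsilon> \<and> L2_norm Q0 (\<lambda>y. kt2 y - s2 y) < \<epsilon>"
    if "\<epsilon> > 0" for \<epsilon>
  proof -
    obtain s where s: "s \<in> fun_span ?K" and se: "L2_norm ?M (\<lambda>z. kt z - s z) < \<epsilon>"
      using kt \<open>\<epsilon> > 0\<close> unfolding tangent_space_def L2_closure_def by blast
    obtain c u and m :: nat where sm: "s = (\<lambda>x. \<Sum>i<m. c i * u i x)" and um: "\<forall>i<m. u i \<in> ?K"
      by (rule fun_spanE[OF s]) (rule that)
    from um have u: "\<And>i. i < m \<Longrightarrow> u i \<in> ?K" by blast
    \<comment> \<open>The bound \<open>i < m\<close> sits inside the predicate, so that both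
      components can be chosen for all \<open>i\<close> simultaneously.\<close>
    define \<Phi> where "\<Phi> i g1 g2 \<longleftrightarrow> (i < m \<longrightarrow> g1 \<in> L2_zero P0 \<and> g2 \<in> L2_zero Q0 \<and>
        (AE z in ?M. u i z = (g1 \<oplus>\<^sub>f g2) z) \<and> (\<lambda>z. g1 (fst z)) \<in> ?K \<and> (\<lambda>z. g2 (snd z)) \<in> ?K)" for i g1 g2
    have ex: "\<forall>i. \<exists>g1 g2. \<Phi> i g1 g2"
    proof
      fix i show "\<exists>g1 g2. \<Phi> i g1 g2"
      proof (cases "i < m")
        case True
        show ?thesis
          by (rule tangent_cone_marginals[OF fam u[OF True]]) (unfold \<Phi>_def, blast)
      qed (auto simp: \<Phi>_def)
    qed
    from choice[OF ex] obtain v where ex': "\<forall>i. \<exists>g2. \<Phi> i (v i) g2" by blast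
    from choice[OF ex'] obtain w where vw: "\<forall>i. \<Phi> i (v i) (w i)" by blast
    have v: "\<And>i. i < m \<Longrightarrow> v i \<in> L2_zero P0" "\<And>i. i < m \<Longrightarrow> (\<lambda>z. v i (fst z)) \<in> ?K"
      and w: "\<And>i. i < m \<Longrightarrow> w i \<in> L2_zero Q0" "\<And>i. i < m \<Longrightarrow> (\<lambda>z. w i (snd z)) \<in> ?K"
      and uvw: "\<And>i. i < m \<Longrightarrow> AE z in ?M. u i z = (v i \<oplus>\<^sub>f w i) z"
      using vw unfolding \<Phi>_def by blast+
    define s1 where "s1 x = (\<Sum>i<m. c i * v i x)" for x
    define s2 where "s2 x = (\<Sum>i<m. c i * w i x)" for x
    have z1: "s1 \<in> L2_zero P0" unfolding s1_def[abs_def] by (rule P0.L2_zero_sum[OF v(1)])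
    have z2: "s2 \<in> L2_zero Q0" unfolding s2_def[abs_def] by (rule Q0.L2_zero_sum[OF w(1)])
    have f1: "(\<lambda>z. s1 (fst z)) \<in> fun_span ?K"
      unfolding fun_span_def s1_def by (intro CollectI exI[of _ m] exI[of _ c] exI[of _ "\<lambda>i z. v i (fst z)"]) (auto simp: v)
    have f2: "(\<lambda>z. s2 (snd z)) \<in> fun_span ?K"
      unfolding fun_span_def s2_def by (intro CollectI exI[of _ m] exI[of _ c] exI[of _ "\<lambda>i z. w i (snd z)"]) (auto simp: w)
    have "AE z in ?M. \<forall>i\<in>{..<m}. u i z = (v i \<oplus>\<^sub>f w i) z"
      by (rule AE_finite_allI) (auto intro: uvw)
    then have AE_s: "AE z in ?M. kt z - s z = ((\<lambda>x. kt1 x - s1 x) \<oplus>\<^sub>f (\<lambda>y. kt2 y - s2 y)) z"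
      using eq
    proof eventually_elim
      case (elim z)
      have "s z = (\<Sum>i<m. c i * (v i \<oplus>\<^sub>f w i) z)"
        unfolding sm using elim(1) by (intro sum.cong) auto
      then show ?case using elim(2)
        by (simp add: s1_def s2_def direct_sum_def distrib_left sum.distrib)
    qed
    have d1: "(\<lambda>x. kt1 x - s1 x) \<in> L2_zero P0" by (rule P0.L2_zero_diff[OF k1 z1])
    have d2: "(\<lambda>y. kt2 y - s2 y) \<in> L2_zero Q0" by (rule Q0.L2_zero_diff[OF k2 z2])
    have sL2: "s \<in> L2_space ?M" using s fun_span_L2[OF tangent_cone_L2] by blast
    have "L2_norm ?M (\<lambda>z. kt z - s z) = L2_norm ?M ((\<lambda>x. kt1 x - s1 x) \<oplus>\<^sub>f (\<lambda>y. kt2 y - s2 y))"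
      by (rule L2_norm_cong_AE[OF L2_spaceD(1)[OF L2_space_diff[OF kt2 sL2]]
          L2_spaceD(1)[OF PQ.direct_sum_L2[OF L2_zeroD(1)[OF d1] L2_zeroD(1)[OF d2]]] AE_s])
    then have *: "(L2_norm ?M (\<lambda>z. kt z - s z))\<^sup>2 = (L2_norm P0 (\<lambda>x. kt1 x - s1 x))\<^sup>2 + (L2_norm Q0 (\<lambda>y. kt2 y - s2 y))\<^sup>2"
      by (simp add: PQ.direct_sum_norm2[OF d1 d2])
    have "L2_norm P0 (\<lambda>x. kt1 x - s1 x) \<le> L2_norm ?M (\<lambda>z. kt z - s z)"
      by (rule power2_le_imp_le) (simp_all add: *)
    moreover have "L2_norm Q0 (\<lambda>y. kt2 y - s2 y) \<le> L2_norm ?M (\<lambda>z. kt z - s z)"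
      by (rule power2_le_imp_le) (simp_all add: *)
    ultimately show ?thesis using z1 z2 f1 f2 se by (intro exI[of _ s1] exI[of _ s2]) auto
  qed
  show "(\<lambda>z. kt1 (fst z)) \<in> tangent_space ?M (prod_family F G)"
    unfolding tangent_space_def L2_closure_def
  proof (intro CollectI conjI allI impI PQ.L2_space_fst L2_zeroD(1)[OF k1])
    fix \<epsilon> :: real assume "\<epsilon> > 0"
    from approx[OF this] obtain s1 where s: "s1 \<in> L2_zero P0" "(\<lambda>z. s1 (fst z)) \<in> fun_span ?K" "L2_norm P0 (\<lambda>x. kt1 x - s1 x) < \<epsilon>"
      by blast
    have "L2_norm ?M (\<lambda>z. kt1 (fst z) - s1 (fst z)) = L2_norm P0 (\<lambda>x. kt1 x - s1 x)"
      by (rule PQ.L2_norm_fst[OF L2_space_diff[OF L2_zeroD(1)[OF k1] L2_zeroD(1)[OF s(1)]]])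
    with s show "\<exists>s\<in>fun_span ?K. L2_norm ?M (\<lambda>x. kt1 (fst x) - s x) < \<epsilon>" by (intro bexI[OF _ s(2)]) simp
  qed
  show "(\<lambda>z. kt2 (snd z)) \<in> tangent_space ?M (prod_family F G)"
    unfolding tangent_space_def L2_closure_def
  proof (intro CollectI conjI allI impI PQ.L2_space_snd L2_zeroD(1)[OF k2])
    fix \<epsilon> :: real assume "\<epsilon> > 0"
    from approx[OF this] obtain s2 where s: "s2 \<in> L2_zero Q0" "(\<lambda>z. s2 (snd z)) \<in> fun_span ?K" "L2_norm Q0 (\<lambda>x. kt2 x - s2 x) < \<epsilon>"
      by blast
    have "L2_norm ?M (\<lambda>z. kt2 (snd z) - s2 (snd z)) = L2_norm Q0 (\<lambda>x. kt2 x - s2 x)"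
      by (rule PQ.L2_norm_snd[OF L2_space_diff[OF L2_zeroD(1)[OF k2] L2_zeroD(1)[OF s(1)]]])
    with s show "\<exists>s\<in>fun_span ?K. L2_norm ?M (\<lambda>x. kt2 (snd x) - s x) < \<epsilon>" by (intro bexI[OF _ s(2)]) simp
  qed
qed

section \<open>Exponential tilts\<close>

lemma exp_lagrange1: "\<exists>t. \<bar>t\<bar> \<le> \<bar>x\<bar> \<and> exp x = 1 + exp t * x" for x :: real
  using Maclaurin_exp_le[of x 1] by simp

lemma exp_lagrange2: "\<exists>t. \<bar>t\<bar> \<le> \<bar>x\<bar> \<and> exp x = 1 + x + exp t / 2 * x\<^sup>2" for x :: real
  using Maclaurin_exp_le[of x 2] by (simp add: numeral_2_eq_2)

lemma exp_minus_one_bound: "\<bar>exp x - 1\<bar> \<le> exp \<bar>x\<bar> * \<bar>x\<bar>" for x :: real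
proof -
  obtain t where "\<bar>t\<bar> \<le> \<bar>x\<bar>" "exp x = 1 + exp t * x" using exp_lagrange1 by blast
  then show ?thesis by (simp add: abs_mult mult_right_mono)
qed

lemma exp_taylor2_bound: "\<bar>exp x - 1 - x\<bar> \<le> exp \<bar>x\<bar> * x\<^sup>2" for x :: real
proof -
  obtain t where t: "\<bar>t\<bar> \<le> \<bar>x\<bar>" "exp x = 1 + x + exp t / 2 * x\<^sup>2" using exp_lagrange2 by blast
  have "exp t \<le> exp \<bar>x\<bar>" using t by simp
  then have "exp t / 2 \<le> exp \<bar>x\<bar>" using exp_ge_zero[of t] by linarith
  then have "exp t / 2 * x\<^sup>2 \<le> exp \<bar>x\<bar> * x\<^sup>2" by (rule mult_right_mono) simp
  moreover have "\<bar>exp x - 1 - x\<bar> = exp t / 2 * x\<^sup>2" using t(2) by simp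
  ultimately show ?thesis by simp
qed

lemma sqrt_scaled_tendsto_0:
  assumes "y \<longlonglongrightarrow> (l::real)" shows "(\<lambda>n. y n / sqrt (real n)) \<longlonglongrightarrow> 0"
proof -
  have "(\<lambda>n. y n * (1 / sqrt (real n))) \<longlonglongrightarrow> l * 0"
    by (intro tendsto_mult assms) (real_asymp)
  then show ?thesis by simp
qed

text \<open>Lagrange form of the remainder: the intermediate points tend to 0 together with
  \<open>y n / sqrt n\<close>.\<close>

lemma exp_scaled_limit1:
  assumes y: "y \<longlonglongrightarrow> (l::real)"
  shows "(\<lambda>n. sqrt (real n) * (exp (y n / sqrt (real n)) - 1)) \<longlonglongrightarrow> l"
proof -
  have "\<forall>n. \<exists>t. \<bar>t\<bar> \<le> \<bar>y n / sqrt (real n)\<bar> \<and> exp (y n / sqrt (real n)) = 1 + exp t * (y n / sqrt (real n))"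
    using exp_lagrange1 by blast
  then obtain t where t: "\<And>n. \<bar>t n\<bar> \<le> \<bar>y n / sqrt (real n)\<bar>"
    and e: "\<And>n. exp (y n / sqrt (real n)) = 1 + exp (t n) * (y n / sqrt (real n))"
    by metis
  have "t \<longlonglongrightarrow> 0"
    using Lim_null_comparison[of t "\<lambda>n. \<bar>y n / sqrt (real n)\<bar>" sequentially] t
      tendsto_rabs_zero[OF sqrt_scaled_tendsto_0[OF y]] by simp
  then have "(\<lambda>n. exp (t n) * y n) \<longlonglongrightarrow> exp 0 * l" by (intro tendsto_intros y)
  moreover have "\<forall>\<^sub>F n in sequentially. exp (t n) * y n = sqrt (real n) * (exp (y n / sqrt (real n)) - 1)"
    using eventually_gt_at_top[of 0] by eventually_elim (simp add: e)
  ultimately show ?thesis by (auto intro: Lim_transform_eventually)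
qed

lemma exp_scaled_limit2:
  assumes y: "y \<longlonglongrightarrow> (l::real)"
  shows "(\<lambda>n. real n * (exp (y n / sqrt (real n)) - 1 - y n / sqrt (real n))) \<longlonglongrightarrow> l\<^sup>2 / 2"
proof -
  have "\<forall>n. \<exists>t. \<bar>t\<bar> \<le> \<bar>y n / sqrt (real n)\<bar> \<and>
      exp (y n / sqrt (real n)) = 1 + y n / sqrt (real n) + exp t / 2 * (y n / sqrt (real n))\<^sup>2"
    using exp_lagrange2 by blast
  then obtain t where t: "\<And>n. \<bar>t n\<bar> \<le> \<bar>y n / sqrt (real n)\<bar>"
    and e: "\<And>n. exp (y n / sqrt (real n)) = 1 + y n / sqrt (real n) + exp (t n) / 2 * (y n / sqrt (real n))\<^sup>2"
    by metis
  have "t \<longlonglongrightarrow> 0"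
    using Lim_null_comparison[of t "\<lambda>n. \<bar>y n / sqrt (real n)\<bar>" sequentially] t
      tendsto_rabs_zero[OF sqrt_scaled_tendsto_0[OF y]] by simp
  then have "(\<lambda>n. exp (t n) / 2 * (y n)\<^sup>2) \<longlonglongrightarrow> exp 0 / 2 * l\<^sup>2" by (intro tendsto_intros y) auto
  moreover have "\<forall>\<^sub>F n in sequentially. exp (t n) / 2 * (y n)\<^sup>2 =
      real n * (exp (y n / sqrt (real n)) - 1 - y n / sqrt (real n))"
    using eventually_gt_at_top[of 0] by eventually_elim (simp add: e power_divide)
  ultimately show ?thesis by (auto intro: Lim_transform_eventually)
qed

section \<open>Expansions of complex exponentials and powers of characteristic functions\<close>

lemma iexp_bound1: "cmod (iexp x - 1) \<le> \<bar>x\<bar>"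
  using iexp_approx1[of x 0] by simp

lemma iexp_bound2: "cmod (iexp x - 1 - \<i> * x) \<le> x\<^sup>2 / 2"
  using iexp_approx1[of x 1] by (simp add: power2_eq_square algebra_simps)

lemma iexp_bound3: "cmod (iexp x - 1 - \<i> * x + x\<^sup>2 / 2) \<le> \<bar>x\<bar> ^ 3 / 6"
  using iexp_approx1[of x 2]
  by (simp add: numeral_2_eq_2 numeral_3_eq_3 power_mult_distrib fact_reduce algebra_simps)

lemma sqrt_mult_tendsto_0:
  assumes x: "(\<lambda>n. sqrt (real n) * x n) \<longlonglongrightarrow> \<xi>" shows "x \<longlonglongrightarrow> 0"
proof -
  have "(\<lambda>n. sqrt (real n) * x n / sqrt (real n)) \<longlonglongrightarrow> 0" by (rule sqrt_scaled_tendsto_0[OF x])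
  then show ?thesis
    by (rule Lim_transform_eventually) (use eventually_gt_at_top[of 0] in eventually_elim, auto)
qed

lemma iexp_scaled_limit1:
  assumes x: "(\<lambda>n. sqrt (real n) * x n) \<longlonglongrightarrow> \<xi>"
  shows "(\<lambda>n. sqrt (real n) * (iexp (x n) - 1)) \<longlonglongrightarrow> \<i> * \<xi>"
proof -
  note x0 = sqrt_mult_tendsto_0[OF x]
  have "(\<lambda>n. sqrt (real n) * (iexp (x n) - 1) - complex_of_real (sqrt (real n) * x n) * \<i>) \<longlonglongrightarrow> 0"
  proof (rule Lim_null_comparison)
    show "(\<lambda>n. \<bar>sqrt (real n) * x n\<bar> * \<bar>x n\<bar> / 2) \<longlonglongrightarrow> 0"
      using tendsto_mult[OF tendsto_rabs[OF x] tendsto_rabs_zero[OF x0]] by (auto intro: tendsto_divide_zero)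
    show "\<forall>\<^sub>F n in sequentially. cmod (sqrt (real n) * (iexp (x n) - 1) - complex_of_real (sqrt (real n) * x n) * \<i>)
        \<le> \<bar>sqrt (real n) * x n\<bar> * \<bar>x n\<bar> / 2"
    proof (rule always_eventually, rule allI)
      fix n
      have "sqrt (real n) * (iexp (x n) - 1) - complex_of_real (sqrt (real n) * x n) * \<i> =
          sqrt (real n) * (iexp (x n) - 1 - \<i> * x n)" by (simp add: algebra_simps)
      then have "cmod (sqrt (real n) * (iexp (x n) - 1) - complex_of_real (sqrt (real n) * x n) * \<i>) =
          sqrt (real n) * cmod (iexp (x n) - 1 - \<i> * x n)" by (simp add: norm_mult)
      also have "\<dots> \<le> sqrt (real n) * ((x n)\<^sup>2 / 2)" by (intro mult_left_mono iexp_bound2) auto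
      finally show "cmod (sqrt (real n) * (iexp (x n) - 1) - complex_of_real (sqrt (real n) * x n) * \<i>)
        \<le> \<bar>sqrt (real n) * x n\<bar> * \<bar>x n\<bar> / 2" by (simp add: abs_mult power2_eq_square mult.assoc abs_mult_self_eq)
    qed
  qed
  from tendsto_add[OF this tendsto_mult[OF tendsto_of_real[OF x] tendsto_const[of \<i>]]]
  show ?thesis by (simp add: mult.commute)
qed

lemma iexp_scaled_limit2:
  assumes x: "(\<lambda>n. sqrt (real n) * x n) \<longlonglongrightarrow> \<xi>"
  shows "(\<lambda>n. real n * (iexp (x n) - 1 - \<i> * x n)) \<longlonglongrightarrow> - \<xi>\<^sup>2 / 2"
proof -
  note x0 = sqrt_mult_tendsto_0[OF x]
  have "(\<lambda>n. real n * (iexp (x n) - 1 - \<i> * x n) + complex_of_real ((sqrt (real n) * x n)\<^sup>2 / 2)) \<longlonglongrightarrow> 0"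
  proof (rule Lim_null_comparison)
    show "(\<lambda>n. (sqrt (real n) * x n)\<^sup>2 * \<bar>x n\<bar> / 6) \<longlonglongrightarrow> 0"
      using tendsto_mult[OF tendsto_power[OF x] tendsto_rabs_zero[OF x0]] by (auto intro: tendsto_divide_zero)
    show "\<forall>\<^sub>F n in sequentially. cmod (real n * (iexp (x n) - 1 - \<i> * x n) + complex_of_real ((sqrt (real n) * x n)\<^sup>2 / 2))
        \<le> (sqrt (real n) * x n)\<^sup>2 * \<bar>x n\<bar> / 6"
    proof (rule always_eventually, rule allI)
      fix n
      have "real n * (iexp (x n) - 1 - \<i> * x n) + complex_of_real ((sqrt (real n) * x n)\<^sup>2 / 2) =
          real n * (iexp (x n) - 1 - \<i> * x n + (x n)\<^sup>2 / 2)" by (simp add: algebra_simps power_mult_distrib)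
      then have "cmod (real n * (iexp (x n) - 1 - \<i> * x n) + complex_of_real ((sqrt (real n) * x n)\<^sup>2 / 2)) =
          real n * cmod (iexp (x n) - 1 - \<i> * x n + (x n)\<^sup>2 / 2)" by (simp add: norm_mult)
      also have "\<dots> \<le> real n * (\<bar>x n\<bar> ^ 3 / 6)" using iexp_bound3[of "x n"] by (intro mult_left_mono) auto
      also have "\<dots> = (sqrt (real n) * x n)\<^sup>2 * \<bar>x n\<bar> / 6" by (simp add: power_mult_distrib power3_eq_cube power2_eq_square)
      finally show "cmod (real n * (iexp (x n) - 1 - \<i> * x n) + complex_of_real ((sqrt (real n) * x n)\<^sup>2 / 2))
        \<le> (sqrt (real n) * x n)\<^sup>2 * \<bar>x n\<bar> / 6" .
    qed
  qed
  from tendsto_diff[OF this tendsto_of_real[OF tendsto_divide[OF tendsto_power[OF x, of 2] tendsto_const[of 2]]]]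
  show ?thesis by simp
qed

text \<open>Compares \<open>a n ^ N n\<close> with \<open>exp (a n - 1) ^ N n\<close>. Both bases
  lie in the closed unit disc, so the powers differ by at most \<open>N n\<close> times the
  difference of the bases, which is quadratic in \<open>a n - 1\<close>; no complex logarithm is
  involved.\<close>

lemma power_limit_exp:
  fixes a :: "nat \<Rightarrow> complex"
  assumes a1: "\<And>n. cmod (a n) \<le> 1" and lim: "(\<lambda>n. real n * (a n - 1)) \<longlonglongrightarrow> w"
    and N: "(\<lambda>n. real (N n) / real n) \<longlonglongrightarrow> p"
  shows "(\<lambda>n. a n ^ N n) \<longlonglongrightarrow> exp (p * w)"
proof -
  define z where "z n = a n - 1" for n
  have zlim: "(\<lambda>n. real n * z n) \<longlonglongrightarrow> w" using lim by (simp add: z_def)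
  have "(\<lambda>n. complex_of_real (1 / real n) * (real n * z n)) \<longlonglongrightarrow> complex_of_real 0 * w"
    by (intro tendsto_mult zlim tendsto_of_real lim_1_over_n)
  then have "(\<lambda>n. complex_of_real (1 / real n) * (real n * z n)) \<longlonglongrightarrow> 0" by simp
  then have z0: "z \<longlonglongrightarrow> 0"
    by (rule Lim_transform_eventually) (use eventually_gt_at_top[of 0] in eventually_elim, auto)
  have Nz: "(\<lambda>n. of_nat (N n) * z n) \<longlonglongrightarrow> p * w"
  proof (rule Lim_transform_eventually)
    show "(\<lambda>n. complex_of_real (real (N n) / real n) * (real n * z n)) \<longlonglongrightarrow> p * w"
      by (intro tendsto_mult tendsto_of_real N zlim)
    show "\<forall>\<^sub>F n in sequentially. complex_of_real (real (N n) / real n) * (real n * z n) = of_nat (N n) * z n"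
      using eventually_gt_at_top[of 0] by eventually_elim simp
  qed
  have "(\<lambda>n. a n ^ N n - exp (z n) ^ N n) \<longlonglongrightarrow> 0"
  proof (rule Lim_null_comparison)
    show "(\<lambda>n. cmod (of_nat (N n) * z n) * cmod (z n) * exp 2) \<longlonglongrightarrow> 0"
      using tendsto_mult[OF tendsto_mult[OF tendsto_norm[OF Nz] tendsto_norm_zero[OF z0]] tendsto_const[of "exp 2"]] by simp
    show "\<forall>\<^sub>F n in sequentially. cmod (a n ^ N n - exp (z n) ^ N n) \<le> cmod (of_nat (N n) * z n) * cmod (z n) * exp 2"
    proof (rule always_eventually, rule allI)
      fix n
      \<comment> \<open>The modulus bound on \<open>a n\<close> makes the real part of
        \<open>z n\<close> nonpositive, which puts \<open>exp (z n)\<close> in the unit disc as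
        well.\<close>
      have re: "Re (z n) \<le> 0" "\<bar>Re (z n)\<bar> \<le> 2"
        using complex_Re_le_cmod[of "a n"] abs_Re_le_cmod[of "a n"] a1[of n] by (auto simp: z_def)
      have "cmod (a n ^ N n - exp (z n) ^ N n) \<le> N n * cmod (a n - exp (z n))"
        using re by (intro norm_power_diff a1) simp
      also have "\<dots> \<le> N n * (exp 2 * (cmod (z n))\<^sup>2)"
      proof (rule mult_left_mono)
        have "cmod (a n - exp (z n)) = cmod (exp (z n) - (\<Sum>k\<le>1. z n ^ k / fact k))"
          by (subst norm_minus_commute) (simp add: z_def algebra_simps)
        also have "\<dots> \<le> exp \<bar>Re (z n)\<bar> * cmod (z n) ^ Suc 1 / fact 1" by (rule Taylor_exp)
        also have "\<dots> \<le> exp 2 * (cmod (z n))\<^sup>2" using re by (simp add: power2_eq_square mult_right_mono)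
        finally show "cmod (a n - exp (z n)) \<le> exp 2 * (cmod (z n))\<^sup>2" .
      qed simp
      finally show "cmod (a n ^ N n - exp (z n) ^ N n) \<le> cmod (of_nat (N n) * z n) * cmod (z n) * exp 2"
        by (simp add: norm_mult power2_eq_square mult_ac)
    qed
  qed
  moreover have "(\<lambda>n. exp (z n) ^ N n) \<longlonglongrightarrow> exp (p * w)"
    using tendsto_exp[OF Nz] by (simp add: exp_of_nat_mult)
  ultimately have "(\<lambda>n. (a n ^ N n - exp (z n) ^ N n) + exp (z n) ^ N n) \<longlonglongrightarrow> 0 + exp (p * w)"
    by (rule tendsto_add)
  then show ?thesis by simp
qed

text \<open>A centred square-integrable limit \<open>v\<close> together with centred approximations
  under one square-integrable envelope: the input that dominated convergence needs for second-order
  expansions at the scale \<open>1 / sqrt n\<close>.\<close>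

definition L2_array :: "'a measure \<Rightarrow> (nat \<Rightarrow> 'a \<Rightarrow> real) \<Rightarrow> ('a \<Rightarrow> real) \<Rightarrow> bool" where
  "L2_array M vn v \<longleftrightarrow> (\<forall>n. vn n \<in> borel_measurable M) \<and> v \<in> L2_zero M \<and> (\<forall>n. (\<integral>x. vn n x \<partial>M) = 0) \<and>
    (\<forall>x\<in>space M. (\<lambda>n. vn n x) \<longlonglongrightarrow> v x) \<and> (\<exists>w\<in>L2_space M. \<forall>n. \<forall>x\<in>space M. \<bar>vn n x\<bar> \<le> w x)"

text \<open>Keeps \<open>v\<^sub>n / sqrt n\<close> bounded, so that the tilts below exist without exponential moments of \<open>v\<close>.\<close>

definition root_bounded :: "'a measure \<Rightarrow> (nat \<Rightarrow> 'a \<Rightarrow> real) \<Rightarrow> bool" where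
  "root_bounded M vn \<longleftrightarrow> (\<exists>C. \<forall>n. \<forall>x\<in>space M. \<bar>vn n x\<bar> \<le> C * sqrt (real n))"

text \<open>At \<open>n = 0\<close> the quotient \<open>v x / 0\<close> is \<open>0\<close>, and the tilt is the constant density.\<close>

definition tilt :: "'a measure \<Rightarrow> nat \<Rightarrow> ('a \<Rightarrow> real) \<Rightarrow> 'a \<Rightarrow> real" where
  "tilt M n v x = exp (v x / sqrt (real n)) / (\<integral>x. exp (v x / sqrt (real n)) \<partial>M)"

lemma L2_arrayD:
  assumes "L2_array M vn v"
  shows "vn n \<in> borel_measurable M" "v \<in> L2_zero M" "v \<in> L2_space M" "v \<in> borel_measurable M"
    "(\<integral>x. vn n x \<partial>M) = 0" "x \<in> space M \<Longrightarrow> (\<lambda>n. vn n x) \<longlonglongrightarrow> v x"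
  using assms by (auto simp: L2_array_def L2_zero_def L2_space_def)

lemma L2_array_bound:
  assumes "L2_array M vn v"
  obtains w where "w \<in> L2_space M" "w \<in> borel_measurable M" "\<And>n x. x \<in> space M \<Longrightarrow> \<bar>vn n x\<bar> \<le> w x"
    "\<And>x. x \<in> space M \<Longrightarrow> \<bar>v x\<bar> \<le> w x" "\<And>x. x \<in> space M \<Longrightarrow> 0 \<le> w x"
proof -
  obtain w where w: "w \<in> L2_space M" "\<And>n x. x \<in> space M \<Longrightarrow> \<bar>vn n x\<bar> \<le> w x"
    using assms by (auto simp: L2_array_def)
  have "\<bar>v x\<bar> \<le> w x" if "x \<in> space M" for x
    by (rule tendsto_upperbound[OF tendsto_rabs[OF L2_arrayD(6)[OF assms that]]]) (use w(2)[OF that] in auto)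
  moreover have "0 \<le> w x" if "x \<in> space M" for x using w(2)[OF that, of 0] by simp
  ultimately show thesis using that[of w] w L2_spaceD(1)[OF w(1)] by blast
qed

lemma root_boundedD:
  assumes "root_bounded M vn"
  obtains C where "0 \<le> C" "\<And>n x. x \<in> space M \<Longrightarrow> \<bar>vn n x / sqrt (real n)\<bar> \<le> C"
proof -
  obtain C where C: "\<And>n x. x \<in> space M \<Longrightarrow> \<bar>vn n x\<bar> \<le> C * sqrt (real n)"
    using assms by (auto simp: root_bounded_def)
  have bound: "\<bar>vn n x / sqrt (real n)\<bar> \<le> \<bar>C\<bar>" if "x \<in> space M" for n x
  proof (cases "n = 0")
    case False
    have "\<bar>vn n x\<bar> \<le> C * sqrt (real n)" using C[OF that] .
    also have "\<dots> \<le> \<bar>C\<bar> * sqrt (real n)" by (intro mult_right_mono) auto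
    finally have "\<bar>vn n x\<bar> \<le> \<bar>C\<bar> * sqrt (real n)" .
    then show ?thesis using False by (simp add: field_simps)
  qed simp
  show thesis by (rule that[OF abs_ge_zero bound])
qed

lemma root_bounded_add:
  assumes "root_bounded M u" "root_bounded M v" shows "root_bounded M (\<lambda>n x. u n x + v n x)"
proof -
  obtain C D where "\<forall>n. \<forall>x\<in>space M. \<bar>u n x\<bar> \<le> C * sqrt (real n)" "\<forall>n. \<forall>x\<in>space M. \<bar>v n x\<bar> \<le> D * sqrt (real n)"
    using assms unfolding root_bounded_def by blast
  then have "\<bar>u n x + v n x\<bar> \<le> (C + D) * sqrt (real n)" if "x \<in> space M" for n x
    using that by (smt (verit) distrib_right)
  then show ?thesis unfolding root_bounded_def by blast
qed

lemma root_bounded_cmult: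
  assumes "root_bounded M u" shows "root_bounded M (\<lambda>n x. c * u n x)"
proof -
  obtain C where C: "\<And>n x. x \<in> space M \<Longrightarrow> \<bar>u n x\<bar> \<le> C * sqrt (real n)"
    using assms by (auto simp: root_bounded_def)
  have "\<bar>c * u n x\<bar> \<le> (\<bar>c\<bar> * C) * sqrt (real n)" if "x \<in> space M" for n x
    using mult_left_mono[OF C[OF that, of n] abs_ge_zero[of c]] by (simp add: abs_mult mult.assoc)
  then show ?thesis unfolding root_bounded_def by blast
qed

section \<open>Tilts along arrays: normalisers, roots and characteristic functions\<close>

context prob_space
begin

lemma L2_arrayI:
  assumes "\<And>n. vn n \<in> borel_measurable M" "v \<in> L2_zero M" "\<And>n. (\<integral>x. vn n x \<partial>M) = 0"
    "\<And>x. x \<in> space M \<Longrightarrow> (\<lambda>n. vn n x) \<longlonglongrightarrow> v x"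
    "w \<in> L2_space M" "\<And>n x. x \<in> space M \<Longrightarrow> \<bar>vn n x\<bar> \<le> w x"
  shows "L2_array M vn v"
  using assms unfolding L2_array_def by blast

lemma L2_array_L2:
  assumes "L2_array M vn v" shows "vn n \<in> L2_space M"
proof -
  obtain w where w: "w \<in> L2_space M" "\<And>n x. x \<in> space M \<Longrightarrow> \<bar>vn n x\<bar> \<le> w x"
    by (rule L2_array_bound[OF assms]) blast
  show ?thesis
    by (rule L2_space_bound[OF w(1) L2_arrayD(1)[OF assms]]) (use w(2)[of _ n] in force)
qed

lemma L2_array_add:
  assumes u: "L2_array M un u" and v: "L2_array M vn v"
  shows "L2_array M (\<lambda>n x. un n x + vn n x) (\<lambda>x. u x + v x)"
proof -
  obtain wu where wu: "wu \<in> L2_space M" "\<And>n x. x \<in> space M \<Longrightarrow> \<bar>un n x\<bar> \<le> wu x"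
    by (rule L2_array_bound[OF u]) blast
  obtain wv where wv: "wv \<in> L2_space M" "\<And>n x. x \<in> space M \<Longrightarrow> \<bar>vn n x\<bar> \<le> wv x"
    by (rule L2_array_bound[OF v]) blast
  show ?thesis
  proof (rule L2_arrayI)
    show "(\<lambda>x. wu x + wv x) \<in> L2_space M" by (intro L2_space_add wu wv)
    show "\<bar>un n x + vn n x\<bar> \<le> wu x + wv x" if "x \<in> space M" for n x
      using wu(2)[OF that, of n] wv(2)[OF that, of n] by linarith
    show "(\<integral>x. un n x + vn n x \<partial>M) = 0" for n
      using L2_integrable[OF L2_array_L2[OF u]] L2_integrable[OF L2_array_L2[OF v]] L2_arrayD(5)[OF u] L2_arrayD(5)[OF v] by simp
  qed (use L2_arrayD[OF u] L2_arrayD[OF v] in \<open>auto intro!: L2_zero_add tendsto_add\<close>)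
qed

lemma L2_array_cmult:
  assumes v: "L2_array M vn v"
  shows "L2_array M (\<lambda>n x. c * vn n x) (\<lambda>x. c * v x)"
proof -
  obtain wv where wv: "wv \<in> L2_space M" "\<And>n x. x \<in> space M \<Longrightarrow> \<bar>vn n x\<bar> \<le> wv x"
    by (rule L2_array_bound[OF v]) blast
  show ?thesis
  proof (rule L2_arrayI)
    show "(\<lambda>x. \<bar>c\<bar> * wv x) \<in> L2_space M" by (intro L2_space_cmult wv)
    show "\<bar>c * vn n x\<bar> \<le> \<bar>c\<bar> * wv x" if "x \<in> space M" for n x
      using wv(2)[OF that, of n] by (simp add: abs_mult mult_left_mono)
    show "(\<integral>x. c * vn n x \<partial>M) = 0" for n
      using L2_integrable[OF L2_array_L2[OF v]] L2_arrayD(5)[OF v] by simp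
  qed (use L2_arrayD[OF v] in \<open>auto intro!: L2_zero_cmult tendsto_mult\<close>)
qed

lemma L2_array_const:
  assumes "v \<in> L2_zero M" shows "L2_array M (\<lambda>_. v) v"
  by (rule L2_arrayI[where w="\<lambda>x. \<bar>v x\<bar>"]) (use assms in \<open>auto simp: L2_zero_def L2_space_def\<close>)

text \<open>Truncation at level \<open>sqrt n\<close> followed by recentring. The truncated means
  tend to 0 by dominated convergence and are themselves at most \<open>sqrt n\<close> in modulus, so
  the recentred function stays within \<open>2 * sqrt n\<close>.\<close>

lemma ex_root_bounded_array:
  assumes v: "v \<in> L2_zero M"
  shows "\<exists>vn. L2_array M vn v \<and> root_bounded M vn"
proof -
  define T where "T n x = max (- sqrt (real n)) (min (sqrt (real n)) (v x))" for n x
  have [measurable]: "v \<in> borel_measurable M" using v by (simp add: L2_zero_def L2_space_def)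
  have [measurable]: "T n \<in> borel_measurable M" for n unfolding T_def by measurable
  have Tv: "\<bar>T n x\<bar> \<le> \<bar>v x\<bar>" for n x unfolding T_def by (auto simp: max_def min_def)
  have Tn: "\<bar>T n x\<bar> \<le> sqrt (real n)" for n x unfolding T_def by (auto simp: max_def min_def)
  have iv: "integrable M v" using L2_integrable[OF L2_zeroD(1)[OF v]] .
  have iT: "integrable M (T n)" for n
    by (rule Bochner_Integration.integrable_bound[OF iv]) (use Tv in auto)
  have lim: "(\<lambda>n. T n x) \<longlonglongrightarrow> v x" for x
  proof (rule tendsto_eventually)
    have "filterlim (\<lambda>n. sqrt (real n)) at_top sequentially" by real_asymp
    then have "\<forall>\<^sub>F n in sequentially. sqrt (real n) \<ge> \<bar>v x\<bar>" by (simp add: filterlim_at_top)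
    then show "\<forall>\<^sub>F n in sequentially. T n x = v x"
      by eventually_elim (auto simp: T_def max_def min_def)
  qed
  define c where "c n = (\<integral>x. T n x \<partial>M)" for n
  have c: "c \<longlonglongrightarrow> 0"
  proof -
    have "c \<longlonglongrightarrow> (\<integral>x. v x \<partial>M)" unfolding c_def
      by (rule integral_dominated_convergence[where w="\<lambda>x. \<bar>v x\<bar>"]) (use iv lim Tv in auto)
    then show ?thesis using L2_zeroD(2)[OF v] by simp
  qed
  have cn: "\<bar>c n\<bar> \<le> sqrt (real n)" for n
  proof -
    have "\<bar>c n\<bar> \<le> (\<integral>x. \<bar>T n x\<bar> \<partial>M)" unfolding c_def by (rule integral_abs_bound)
    also have "\<dots> \<le> (\<integral>x. sqrt (real n) \<partial>M)" by (intro integral_mono) (use iT Tn in auto)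
    finally show ?thesis by (simp add: prob_space)
  qed
  have cv: "\<bar>c n\<bar> \<le> (\<integral>x. \<bar>v x\<bar> \<partial>M)" for n
  proof -
    have "\<bar>c n\<bar> \<le> (\<integral>x. \<bar>T n x\<bar> \<partial>M)" unfolding c_def by (rule integral_abs_bound)
    also have "\<dots> \<le> (\<integral>x. \<bar>v x\<bar> \<partial>M)" by (intro integral_mono) (use iT iv Tv in auto)
    finally show ?thesis .
  qed
  define vn where "vn n x = T n x - c n" for n x
  have "L2_array M vn v"
  proof (rule L2_arrayI)
    show "vn n \<in> borel_measurable M" for n unfolding vn_def by measurable
    show "(\<integral>x. vn n x \<partial>M) = 0" for n unfolding vn_def using iT[of n] by (simp add: c_def prob_space)
    show "(\<lambda>n. vn n x) \<longlonglongrightarrow> v x" for x unfolding vn_def using tendsto_diff[OF lim[of x] c] by simp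
    have "(\<lambda>x. \<bar>v x\<bar>) \<in> L2_space M" using v by (auto simp: L2_zero_def L2_space_def)
    then show "(\<lambda>x. \<bar>v x\<bar> + (\<integral>x. \<bar>v x\<bar> \<partial>M)) \<in> L2_space M" by (intro L2_space_add L2_space_const)
    show "\<bar>vn n x\<bar> \<le> \<bar>v x\<bar> + (\<integral>x. \<bar>v x\<bar> \<partial>M)" for n x unfolding vn_def using cv[of n] Tv[of n x] by linarith
  qed (use v in auto)
  moreover have "root_bounded M vn"
    unfolding root_bounded_def
  proof (intro exI[of _ 2] allI ballI)
    show "\<bar>vn n x\<bar> \<le> 2 * sqrt (real n)" for n x unfolding vn_def using cn[of n] Tn[of n x] by linarith
  qed
  ultimately show ?thesis by blast
qed

text \<open>As \<open>vn n\<close> has mean 0, the linear term of the exponential drops out and the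
  quadratic one gives half the variance of \<open>v\<close>. The bound on
  \<open>vn n / sqrt n\<close> keeps the normaliser away from 0 uniformly in n.\<close>

lemma tilt_normalizer:
  assumes v: "L2_array M vn v" and b: "root_bounded M vn"
  shows "integrable M (\<lambda>x. exp (vn n x / sqrt (real n)))"
    and "\<exists>c>0. \<forall>n. c \<le> (\<integral>x. exp (vn n x / sqrt (real n)) \<partial>M)"
    and "(\<lambda>n. real n * ((\<integral>x. exp (vn n x / sqrt (real n)) \<partial>M) - 1)) \<longlonglongrightarrow> (\<integral>x. (v x)\<^sup>2 \<partial>M) / 2"
proof -
  note [measurable] = L2_arrayD(1,4)[OF v]
  obtain C where C: "0 \<le> C" "\<And>n x. x \<in> space M \<Longrightarrow> \<bar>vn n x / sqrt (real n)\<bar> \<le> C" by (rule root_boundedD[OF b]) blast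
  obtain w where w: "w \<in> L2_space M" "w \<in> borel_measurable M" "\<And>n x. x \<in> space M \<Longrightarrow> \<bar>vn n x\<bar> \<le> w x"
    by (rule L2_array_bound[OF v]) blast
  have i: "integrable M (\<lambda>x. exp (vn n x / sqrt (real n)))" for n
    by (rule integrable_const_bound[where B="exp C"]) (auto intro!: AE_I2 order_trans[OF abs_ge_self C(2)])
  then show "integrable M (\<lambda>x. exp (vn n x / sqrt (real n)))" .
  have "exp (- C) \<le> (\<integral>x. exp (vn n x / sqrt (real n)) \<partial>M)" for n
  proof -
    have "(\<integral>x. exp (- C) \<partial>M) \<le> (\<integral>x. exp (vn n x / sqrt (real n)) \<partial>M)"
      by (intro integral_mono i) (use C(2)[of _ n, THEN abs_le_D2] in \<open>auto simp: minus_le_iff\<close>)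
    then show ?thesis by (simp add: prob_space)
  qed
  then show "\<exists>c>0. \<forall>n. c \<le> (\<integral>x. exp (vn n x / sqrt (real n)) \<partial>M)"
    by (intro exI[of _ "exp (- C)"]) auto
  \<comment> \<open>Subtracting the linear term does not change the integral, but it makes the
    integrand dominated by a multiple of the squared envelope.\<close>
  have lim: "(\<lambda>n. \<integral>x. real n * (exp (vn n x / sqrt (real n)) - 1 - vn n x / sqrt (real n)) \<partial>M) \<longlonglongrightarrow> (\<integral>x. (v x)\<^sup>2 / 2 \<partial>M)"
  proof (rule integral_dominated_convergence[where w="\<lambda>x. exp C * (w x)\<^sup>2"])
    show "integrable M (\<lambda>x. exp C * (w x)\<^sup>2)" using L2_spaceD(2)[OF w(1)] by simp
    show "AE x in M. (\<lambda>n. real n * (exp (vn n x / sqrt (real n)) - 1 - vn n x / sqrt (real n))) \<longlonglongrightarrow> (v x)\<^sup>2 / 2"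
      using exp_scaled_limit2[OF L2_arrayD(6)[OF v]] by auto
    show "AE x in M. norm (real n * (exp (vn n x / sqrt (real n)) - 1 - vn n x / sqrt (real n))) \<le> exp C * (w x)\<^sup>2" for n
    proof (rule AE_I2)
      fix x assume x: "x \<in> space M"
      have "norm (real n * (exp (vn n x / sqrt (real n)) - 1 - vn n x / sqrt (real n))) =
          real n * \<bar>exp (vn n x / sqrt (real n)) - 1 - vn n x / sqrt (real n)\<bar>" by (simp add: abs_mult)
      also have "\<dots> \<le> real n * (exp \<bar>vn n x / sqrt (real n)\<bar> * (vn n x / sqrt (real n))\<^sup>2)"
        by (intro mult_left_mono exp_taylor2_bound) auto
      also have "\<dots> \<le> real n * (exp C * (vn n x / sqrt (real n))\<^sup>2)"
        using C(2)[OF x, of n] by (intro mult_left_mono mult_right_mono) auto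
      also have "\<dots> = exp C * (real n * (vn n x / sqrt (real n))\<^sup>2)" by simp
      also have "\<dots> \<le> exp C * (w x)\<^sup>2"
      proof (intro mult_left_mono)
        have "real n * (vn n x / sqrt (real n))\<^sup>2 \<le> (vn n x)\<^sup>2"
          by (cases "n = 0") (auto simp: power_divide)
        also have "\<dots> \<le> (w x)\<^sup>2" using w(3)[OF x, of n] by (simp add: abs_le_square_iff[symmetric])
        finally show "real n * (vn n x / sqrt (real n))\<^sup>2 \<le> (w x)\<^sup>2" .
      qed auto
      finally show "norm (real n * (exp (vn n x / sqrt (real n)) - 1 - vn n x / sqrt (real n))) \<le> exp C * (w x)\<^sup>2" .
    qed
  qed measurable
  have eq: "(\<integral>x. real n * (exp (vn n x / sqrt (real n)) - 1 - vn n x / sqrt (real n)) \<partial>M) =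
      real n * ((\<integral>x. exp (vn n x / sqrt (real n)) \<partial>M) - 1)" for n
    using i[of n] L2_integrable[OF L2_array_L2[OF v, of n]] L2_arrayD(5)[OF v, of n] by (simp add: prob_space)
  show "(\<lambda>n. real n * ((\<integral>x. exp (vn n x / sqrt (real n)) \<partial>M) - 1)) \<longlonglongrightarrow> (\<integral>x. (v x)\<^sup>2 \<partial>M) / 2"
    using lim unfolding eq by simp
qed

lemma tilt_density:
  assumes v: "L2_array M vn v" and b: "root_bounded M vn"
  shows "tilt M n (vn n) \<in> borel_measurable M" "0 < tilt M n (vn n) x"
    "integrable M (tilt M n (vn n))" "(\<integral>x. tilt M n (vn n) x \<partial>M) = 1"
proof -
  note [measurable] = L2_arrayD(1,4)[OF v]
  show "tilt M n (vn n) \<in> borel_measurable M" unfolding tilt_def[abs_def] by measurable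
  have Z: "(\<integral>x. exp (vn n x / sqrt (real n)) \<partial>M) > 0" using tilt_normalizer(2)[OF v b] less_le_trans by blast
  then show "0 < tilt M n (vn n) x" by (simp add: tilt_def)
  show "integrable M (tilt M n (vn n))" unfolding tilt_def[abs_def] using tilt_normalizer(1)[OF v b] by simp
  show "(\<integral>x. tilt M n (vn n) x \<partial>M) = 1" unfolding tilt_def using Z by simp
qed

text \<open>As \<open>n * (Z n - 1)\<close> converges, \<open>Z n - 1\<close> is of smaller order
  than \<open>1 / sqrt n\<close>, and \<open>|1 - sqrt (Z n)| <= |1 - Z n|\<close> carries this over
  to the root. The normaliser is thus invisible in the first-order expansion of root
  densities.\<close>

lemma tilt_normalizer_limits:
  assumes v: "L2_array M vn v" and b: "root_bounded M vn"
  defines "Z \<equiv> \<lambda>n. \<integral>x. exp (vn n x / sqrt (real n)) \<partial>M"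
  shows "Z \<longlonglongrightarrow> 1" and "(\<lambda>n. sqrt (real n) * (1 - sqrt (Z n))) \<longlonglongrightarrow> 0"
proof -
  have Z: "(\<lambda>n. sqrt (real n) * (sqrt (real n) * (Z n - 1))) \<longlonglongrightarrow> (\<integral>x. (v x)\<^sup>2 \<partial>M) / 2"
    using tilt_normalizer(3)[OF v b] by (simp add: Z_def mult.assoc[symmetric])
  have Z1: "(\<lambda>n. sqrt (real n) * (Z n - 1)) \<longlonglongrightarrow> 0" by (rule sqrt_mult_tendsto_0[OF Z])
  have "(\<lambda>n. Z n - 1) \<longlonglongrightarrow> 0" by (rule sqrt_mult_tendsto_0[OF Z1])
  then show "Z \<longlonglongrightarrow> 1" by (simp add: LIM_zero_iff)
  obtain c where c: "c > 0" "\<And>n. c \<le> Z n" using tilt_normalizer(2)[OF v b] by (auto simp: Z_def)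
  show "(\<lambda>n. sqrt (real n) * (1 - sqrt (Z n))) \<longlonglongrightarrow> 0"
  proof (rule Lim_null_comparison)
    show "(\<lambda>n. \<bar>sqrt (real n) * (Z n - 1)\<bar>) \<longlonglongrightarrow> 0" by (rule tendsto_rabs_zero[OF Z1])
    show "\<forall>\<^sub>F n in sequentially. norm (sqrt (real n) * (1 - sqrt (Z n))) \<le> \<bar>sqrt (real n) * (Z n - 1)\<bar>"
    proof (rule always_eventually, rule allI)
      fix n
      have Zn: "Z n \<ge> 0" using c(1) c(2)[of n] by linarith
      have "\<bar>1 - sqrt (Z n)\<bar> * 1 \<le> \<bar>1 - sqrt (Z n)\<bar> * \<bar>1 + sqrt (Z n)\<bar>" using Zn by (intro mult_left_mono) auto
      also have "\<dots> = \<bar>Z n - 1\<bar>"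
      proof -
        have "(1 - sqrt (Z n)) * (1 + sqrt (Z n)) = - (Z n - 1)" using Zn by (simp add: algebra_simps)
        then show ?thesis by (metis abs_minus_cancel abs_mult)
      qed
      finally show "norm (sqrt (real n) * (1 - sqrt (Z n))) \<le> \<bar>sqrt (real n) * (Z n - 1)\<bar>"
        by (simp add: abs_mult mult_left_mono)
    qed
  qed
qed

text \<open>Along \<open>1 / sqrt n\<close> the tilt behaves like a root-differentiable curve with
  tangent \<open>v\<close>, so that it can be compared with the curves of the model at the level of
  roots. The root of an exponential is the exponential of half the exponent, and dominated
  convergence does the rest.\<close>

lemma tilt_root_derivative:
  assumes v: "L2_array M vn v" and b: "root_bounded M vn"
  shows "(\<lambda>x. sqrt (tilt M n (vn n) x)) \<in> L2_space M"
    and "(\<lambda>n. L2_norm M (\<lambda>x. sqrt (real n) * (sqrt (tilt M n (vn n) x) - 1) - v x / 2)) \<longlonglongrightarrow> 0"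
proof -
  note [measurable] = L2_arrayD(1,4)[OF v] tilt_density(1)[OF v b]
  have pos: "0 < tilt M n (vn n) x" for n x by (rule tilt_density(2)[OF v b])
  show "(\<lambda>x. sqrt (tilt M n (vn n) x)) \<in> L2_space M"
    using tilt_density(3)[OF v b, of n] pos[of n] by (auto simp: L2_space_def less_imp_le)
  define Z where "Z n = (\<integral>x. exp (vn n x / sqrt (real n)) \<partial>M)" for n
  note Zlim = tilt_normalizer_limits[OF v b, folded Z_def]
  obtain c where c: "c > 0" "\<And>n. c \<le> Z n" using tilt_normalizer(2)[OF v b] by (auto simp: Z_def)
  have Zpos: "Z n > 0" for n using c(1) c(2)[of n] by linarith
  obtain C where C: "0 \<le> C" "\<And>n x. x \<in> space M \<Longrightarrow> \<bar>vn n x / sqrt (real n)\<bar> \<le> C" by (rule root_boundedD[OF b]) blast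
  obtain w where w: "w \<in> L2_space M" "w \<in> borel_measurable M" "\<And>n x. x \<in> space M \<Longrightarrow> \<bar>vn n x\<bar> \<le> w x"
    "\<And>x. x \<in> space M \<Longrightarrow> \<bar>v x\<bar> \<le> w x" "\<And>x. x \<in> space M \<Longrightarrow> 0 \<le> w x"
    by (rule L2_array_bound[OF v]) blast
  have "Bseq (\<lambda>n. sqrt (real n) * (1 - sqrt (Z n)))" using Zlim(2) convergent_def convergent_imp_Bseq by blast
  then obtain B where B: "\<And>n. \<bar>sqrt (real n) * (1 - sqrt (Z n))\<bar> \<le> B" unfolding Bseq_def by auto
  \<comment> \<open>Separates the normaliser as an additive defect \<open>1 - sqrt (Z n)\<close>,
    which tends to 0 even after scaling by \<open>sqrt n\<close>.\<close>
  have rep: "sqrt (real n) * (sqrt (tilt M n (vn n) x) - 1) =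
      (sqrt (real n) * (exp ((vn n x / 2) / sqrt (real n)) - 1) + sqrt (real n) * (1 - sqrt (Z n))) / sqrt (Z n)" for n x
  proof -
    have "sqrt (exp (vn n x / sqrt (real n))) = exp ((vn n x / 2) / sqrt (real n))"
      by (rule real_sqrt_unique) (simp_all add: exp_double[symmetric] power2_eq_square mult_exp_exp)
    then have "sqrt (tilt M n (vn n) x) = exp ((vn n x / 2) / sqrt (real n)) / sqrt (Z n)"
      by (simp add: tilt_def Z_def real_sqrt_divide)
    then show ?thesis using Zpos[of n] by (simp add: field_simps)
  qed
  define s where "s n x = sqrt (real n) * (sqrt (tilt M n (vn n) x) - 1) - v x / 2" for n x
  have [measurable]: "s n \<in> borel_measurable M" for n unfolding s_def[abs_def] by measurable
  \<comment> \<open>Envelope of \<open>s n\<close>: \<open>exp C * w\<close> bounds the scaled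
    increment of the exponential, \<open>B\<close> the scaled defect of the normaliser,
    \<open>sqrt c\<close> is a lower bound of the denominator, and the last \<open>w\<close> covers
    \<open>v / 2\<close>.\<close>
  define W where "W x = (exp C * w x + B) / sqrt c + w x" for x
  have W2: "W \<in> L2_space M"
  proof -
    have "W = (\<lambda>x. exp C / sqrt c * w x + B / sqrt c + 1 * w x)" by (auto simp: W_def add_divide_distrib)
    then show ?thesis by (simp only:) (intro L2_space_add L2_space_cmult L2_space_const w(1))
  qed
  have bound: "\<bar>s n x\<bar> \<le> W x" if x: "x \<in> space M" for n x
  proof -
    have "\<bar>sqrt (real n) * (exp ((vn n x / 2) / sqrt (real n)) - 1)\<bar> \<le> exp C * w x"
    proof -
      have "\<bar>sqrt (real n) * (exp ((vn n x / 2) / sqrt (real n)) - 1)\<bar> = sqrt (real n) * \<bar>exp ((vn n x / 2) / sqrt (real n)) - 1\<bar>"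
        by (simp add: abs_mult)
      also have "\<dots> \<le> sqrt (real n) * (exp \<bar>(vn n x / 2) / sqrt (real n)\<bar> * \<bar>(vn n x / 2) / sqrt (real n)\<bar>)"
        by (intro mult_left_mono exp_minus_one_bound) auto
      also have "\<dots> \<le> sqrt (real n) * (exp C * \<bar>(vn n x / 2) / sqrt (real n)\<bar>)"
      proof (intro mult_left_mono mult_right_mono)
        have "\<bar>(vn n x / 2) / sqrt (real n)\<bar> \<le> \<bar>vn n x / sqrt (real n)\<bar>"
          by (cases "n = 0") (simp_all add: field_simps)
        then show "exp \<bar>(vn n x / 2) / sqrt (real n)\<bar> \<le> exp C" using C(2)[OF x, of n] by simp
      qed auto
      also have "\<dots> = exp C * (sqrt (real n) * \<bar>(vn n x / 2) / sqrt (real n)\<bar>)" by simp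
      also have "\<dots> \<le> exp C * w x"
      proof (intro mult_left_mono)
        have "sqrt (real n) * \<bar>(vn n x / 2) / sqrt (real n)\<bar> \<le> \<bar>vn n x\<bar>"
          by (cases "n = 0") (auto simp: abs_mult)
        then show "sqrt (real n) * \<bar>(vn n x / 2) / sqrt (real n)\<bar> \<le> w x" using w(3)[OF x, of n] by linarith
      qed auto
      finally show ?thesis .
    qed
    then have "\<bar>sqrt (real n) * (exp ((vn n x / 2) / sqrt (real n)) - 1) + sqrt (real n) * (1 - sqrt (Z n))\<bar> \<le> exp C * w x + B"
      using B[of n] by linarith
    moreover have "sqrt c \<le> sqrt (Z n)" "sqrt c > 0" using c by auto
    ultimately have "\<bar>sqrt (real n) * (sqrt (tilt M n (vn n) x) - 1)\<bar> \<le> (exp C * w x + B) / sqrt c"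
      unfolding rep using Zpos[of n] by (auto simp: abs_divide intro!: frac_le)
    moreover have "\<bar>v x / 2\<bar> \<le> w x" using w(4,5)[OF x] by simp
    ultimately show ?thesis unfolding s_def W_def by linarith
  qed
  have "(\<lambda>n. \<integral>x. (s n x)\<^sup>2 \<partial>M) \<longlonglongrightarrow> (\<integral>x. 0 \<partial>M)"
  proof (rule integral_dominated_convergence[where w="\<lambda>x. (W x)\<^sup>2"])
    show "integrable M (\<lambda>x. (W x)\<^sup>2)" by (rule L2_spaceD(2)[OF W2])
    show "AE x in M. norm ((s n x)\<^sup>2) \<le> (W x)\<^sup>2" for n
      using bound[of _ n] by (auto intro!: AE_I2 simp: abs_le_square_iff[symmetric] intro: order_trans[OF _ abs_ge_self])
    show "AE x in M. (\<lambda>n. (s n x)\<^sup>2) \<longlonglongrightarrow> 0"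
    proof (rule AE_I2)
      fix x assume x: "x \<in> space M"
      have "(\<lambda>n. sqrt (real n) * (exp ((vn n x / 2) / sqrt (real n)) - 1)) \<longlonglongrightarrow> v x / 2"
        by (intro exp_scaled_limit1 tendsto_divide L2_arrayD(6)[OF v x] tendsto_const) auto
      then have "(\<lambda>n. (sqrt (real n) * (exp ((vn n x / 2) / sqrt (real n)) - 1) + sqrt (real n) * (1 - sqrt (Z n))) / sqrt (Z n))
          \<longlonglongrightarrow> (v x / 2 + 0) / sqrt 1"
        by (intro tendsto_intros Zlim) auto
      then have "(\<lambda>n. s n x) \<longlonglongrightarrow> 0" unfolding s_def rep by (auto intro: tendsto_eq_intros)
      then show "(\<lambda>n. (s n x)\<^sup>2) \<longlonglongrightarrow> 0" using tendsto_power[of "\<lambda>n. s n x" 0 _ 2] by simp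
    qed
  qed measurable
  then have "(\<lambda>n. sqrt (\<integral>x. (s n x)\<^sup>2 \<partial>M)) \<longlonglongrightarrow> sqrt 0" by (intro tendsto_real_sqrt) simp
  then show "(\<lambda>n. L2_norm M (\<lambda>x. sqrt (real n) * (sqrt (tilt M n (vn n) x) - 1) - v x / 2)) \<longlonglongrightarrow> 0"
    by (simp add: L2_norm_def s_def)
qed

text \<open>Under the tilt, \<open>n\<close> times the characteristic function of one summand minus
  1 converges: its quadratic term gives the variance part, and the product of the linear terms of
  both exponentials gives the covariance of \<open>k\<close> and \<open>v\<close>. This covariance
  is the shift of the mean under a local alternative, obtained here by direct expansion.\<close>

lemma tilt_char_limit:
  fixes u r p :: real
  assumes k: "L2_array M kn k" and v: "L2_array M vn v" and b: "root_bounded M vn"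
    and c: "(\<lambda>n. sqrt (real n) * c n) \<longlonglongrightarrow> r" and N: "(\<lambda>n. real (N n) / real n) \<longlonglongrightarrow> p"
  shows "integrable M (\<lambda>x. iexp (u * (c n * kn n x)) * complex_of_real (tilt M n (vn n) x))"
    and "(\<lambda>n. (\<integral>x. iexp (u * (c n * kn n x)) * complex_of_real (tilt M n (vn n) x) \<partial>M) ^ N n) \<longlonglongrightarrow>
      exp (complex_of_real p * (complex_of_real (- (u\<^sup>2 * r\<^sup>2 * (\<integral>x. (k x)\<^sup>2 \<partial>M)) / 2) + \<i> * complex_of_real (u * r * (\<integral>x. k x * v x \<partial>M))))"
proof -
  note [measurable] = L2_arrayD(1,4)[OF v] L2_arrayD(1,4)[OF k] tilt_density(1)[OF v b]
  have i: "integrable M (\<lambda>x. iexp (u * (c n * kn n x)) * complex_of_real (tilt M n (vn n) x))" for n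
    by (rule Bochner_Integration.integrable_bound[OF tilt_density(3)[OF v b, of n]])
      (auto simp: norm_mult)
  then show "integrable M (\<lambda>x. iexp (u * (c n * kn n x)) * complex_of_real (tilt M n (vn n) x))" .
  define a where "a n = (\<integral>x. iexp (u * (c n * kn n x)) * complex_of_real (tilt M n (vn n) x) \<partial>M)" for n
  define Z where "Z n = (\<integral>x. exp (vn n x / sqrt (real n)) \<partial>M)" for n
  note Zlim = tilt_normalizer_limits(1)[OF v b, folded Z_def]
  obtain c0 where c0: "c0 > 0" "\<And>n. c0 \<le> Z n" using tilt_normalizer(2)[OF v b] by (auto simp: Z_def)
  have Zpos: "Z n > 0" for n using c0(1) c0(2)[of n] by linarith
  obtain C where C: "0 \<le> C" "\<And>n x. x \<in> space M \<Longrightarrow> \<bar>vn n x / sqrt (real n)\<bar> \<le> C" by (rule root_boundedD[OF b]) blast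
  obtain w where w: "w \<in> L2_space M" "w \<in> borel_measurable M" "\<And>n x. x \<in> space M \<Longrightarrow> \<bar>vn n x\<bar> \<le> w x"
    "\<And>x. x \<in> space M \<Longrightarrow> 0 \<le> w x"
    by (rule L2_array_bound[OF v]) blast
  obtain wk where wk: "wk \<in> L2_space M" "wk \<in> borel_measurable M" "\<And>n x. x \<in> space M \<Longrightarrow> \<bar>kn n x\<bar> \<le> wk x"
    "\<And>x. x \<in> space M \<Longrightarrow> 0 \<le> wk x"
    by (rule L2_array_bound[OF k]) blast
  have "Bseq (\<lambda>n. sqrt (real n) * c n)" using c convergent_def convergent_imp_Bseq by blast
  then obtain D where D: "D > 0" "\<And>n. \<bar>sqrt (real n) * c n\<bar> \<le> D" unfolding Bseq_def by auto
  define y where "y n x = u * (c n * kn n x)" for n x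
  define e where "e n x = exp (vn n x / sqrt (real n))" for n x
  have [measurable]: "y n \<in> borel_measurable M" "e n \<in> borel_measurable M" for n
    unfolding y_def[abs_def] e_def[abs_def] by measurable
  have ie: "integrable M (e n)" for n unfolding e_def by (rule tilt_normalizer(1)[OF v b])
  have a1: "cmod (a n) \<le> 1" for n
  proof -
    have "cmod (a n) \<le> (\<integral>x. cmod (iexp (u * (c n * kn n x)) * complex_of_real (tilt M n (vn n) x)) \<partial>M)"
      unfolding a_def by (rule integral_norm_bound)
    also have "\<dots> = (\<integral>x. tilt M n (vn n) x \<partial>M)"
      using tilt_density(2)[OF v b] by (intro Bochner_Integration.integral_cong) (auto simp: norm_mult less_imp_le)
    finally show ?thesis by (simp add: tilt_density(4)[OF v b])
  qed
  \<comment> \<open>Equals \<open>n\<close> times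
    \<open>iexp (y n x) * e n x - e n x - \<i> * y n x\<close>, split so that every factor of every
    summand has a limit and an envelope.\<close>
  define J where "J n x = real n * (iexp (y n x) - 1 - \<i> * y n x) +
      sqrt (real n) * (iexp (y n x) - 1) * complex_of_real (sqrt (real n) * (e n x - 1))" for n x
  have [measurable]: "J n \<in> borel_measurable M" for n unfolding J_def[abs_def] by measurable
  have sqy: "\<bar>sqrt (real n) * y n x\<bar> \<le> \<bar>u\<bar> * (D * wk x)" if x: "x \<in> space M" for n x
  proof -
    have "\<bar>sqrt (real n) * y n x\<bar> = \<bar>u\<bar> * (\<bar>sqrt (real n) * c n\<bar> * \<bar>kn n x\<bar>)" by (simp add: y_def abs_mult)
    also have "\<dots> \<le> \<bar>u\<bar> * (D * wk x)" using D wk(3)[OF x, of n] by (intro mult_left_mono mult_mono) auto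
    finally show ?thesis .
  qed
  have Jlim: "(\<lambda>n. \<integral>x. J n x \<partial>M) \<longlonglongrightarrow> (\<integral>x. - complex_of_real ((u * (r * k x))\<^sup>2) / 2 + \<i> * complex_of_real (u * (r * k x)) * complex_of_real (v x) \<partial>M)"
  proof (rule integral_dominated_convergence[where w="\<lambda>x. (\<bar>u\<bar> * (D * wk x))\<^sup>2 / 2 + (\<bar>u\<bar> * (D * wk x)) * (exp C * w x)"])
    have "(\<lambda>x. \<bar>u\<bar> * (D * wk x)) \<in> L2_space M" "(\<lambda>x. exp C * w x) \<in> L2_space M"
      by (intro L2_space_cmult wk(1) w(1))+
    then show "integrable M (\<lambda>x. (\<bar>u\<bar> * (D * wk x))\<^sup>2 / 2 + (\<bar>u\<bar> * (D * wk x)) * (exp C * w x))"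
      by (intro Bochner_Integration.integrable_add integrable_divide L2_spaceD(2) L2_integrable_mult)
    show "AE x in M. cmod (J n x) \<le> (\<bar>u\<bar> * (D * wk x))\<^sup>2 / 2 + (\<bar>u\<bar> * (D * wk x)) * (exp C * w x)" for n
    proof (rule AE_I2)
      fix x assume x: "x \<in> space M"
      have "cmod (real n * (iexp (y n x) - 1 - \<i> * y n x)) \<le> real n * ((y n x)\<^sup>2 / 2)"
        unfolding norm_mult norm_of_real using iexp_bound2[of "y n x"] by (intro mult_mono) auto
      also have "\<dots> = (sqrt (real n) * y n x)\<^sup>2 / 2" by (simp add: power_mult_distrib)
      also have "\<dots> \<le> (\<bar>u\<bar> * (D * wk x))\<^sup>2 / 2"
        using sqy[OF x, of n] by (intro divide_right_mono) (auto simp: abs_le_square_iff[symmetric] intro: order_trans[OF _ abs_ge_self])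
      finally have 1: "cmod (real n * (iexp (y n x) - 1 - \<i> * y n x)) \<le> (\<bar>u\<bar> * (D * wk x))\<^sup>2 / 2" .
      have "cmod (sqrt (real n) * (iexp (y n x) - 1)) \<le> \<bar>sqrt (real n) * y n x\<bar>"
        unfolding norm_mult norm_of_real abs_mult using iexp_bound1[of "y n x"] by (intro mult_mono) auto
      also note sqy[OF x]
      finally have 2: "cmod (sqrt (real n) * (iexp (y n x) - 1)) \<le> \<bar>u\<bar> * (D * wk x)" .
      have "\<bar>sqrt (real n) * (e n x - 1)\<bar> \<le> sqrt (real n) * (exp \<bar>vn n x / sqrt (real n)\<bar> * \<bar>vn n x / sqrt (real n)\<bar>)"
        unfolding abs_mult e_def by (intro mult_mono exp_minus_one_bound) auto
      also have "\<dots> \<le> sqrt (real n) * (exp C * \<bar>vn n x / sqrt (real n)\<bar>)"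
        using C(2)[OF x, of n] by (intro mult_left_mono mult_right_mono) auto
      also have "\<dots> = exp C * (sqrt (real n) * \<bar>vn n x / sqrt (real n)\<bar>)" by simp
      also have "\<dots> \<le> exp C * w x"
      proof (intro mult_left_mono)
        have "sqrt (real n) * \<bar>vn n x / sqrt (real n)\<bar> \<le> \<bar>vn n x\<bar>" by (cases "n = 0") auto
        then show "sqrt (real n) * \<bar>vn n x / sqrt (real n)\<bar> \<le> w x" using w(3)[OF x, of n] by linarith
      qed auto
      finally have 3: "cmod (complex_of_real (sqrt (real n) * (e n x - 1))) \<le> exp C * w x" unfolding norm_of_real .
      have "cmod (J n x) \<le> cmod (real n * (iexp (y n x) - 1 - \<i> * y n x)) +
          cmod (sqrt (real n) * (iexp (y n x) - 1)) * cmod (complex_of_real (sqrt (real n) * (e n x - 1)))"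
        unfolding J_def by (rule order_trans[OF norm_triangle_ineq]) (simp add: norm_mult)
      also have "\<dots> \<le> (\<bar>u\<bar> * (D * wk x))\<^sup>2 / 2 + (\<bar>u\<bar> * (D * wk x)) * (exp C * w x)"
        using wk(4)[OF x] D(1) by (intro add_mono 1 mult_mono 2 3) auto
      finally show "cmod (J n x) \<le> (\<bar>u\<bar> * (D * wk x))\<^sup>2 / 2 + (\<bar>u\<bar> * (D * wk x)) * (exp C * w x)" .
    qed
    show "AE x in M. (\<lambda>n. J n x) \<longlonglongrightarrow> - complex_of_real ((u * (r * k x))\<^sup>2) / 2 + \<i> * complex_of_real (u * (r * k x)) * complex_of_real (v x)"
    proof (rule AE_I2)
      fix x assume x: "x \<in> space M"
      have "(\<lambda>n. u * ((sqrt (real n) * c n) * kn n x)) \<longlonglongrightarrow> u * (r * k x)"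
        by (intro tendsto_mult tendsto_const c L2_arrayD(6)[OF k x])
      then have yl: "(\<lambda>n. sqrt (real n) * y n x) \<longlonglongrightarrow> u * (r * k x)" by (simp add: y_def mult_ac)
      have el: "(\<lambda>n. sqrt (real n) * (e n x - 1)) \<longlonglongrightarrow> v x"
        unfolding e_def by (rule exp_scaled_limit1[OF L2_arrayD(6)[OF v x]])
      show "(\<lambda>n. J n x) \<longlonglongrightarrow> - complex_of_real ((u * (r * k x))\<^sup>2) / 2 + \<i> * complex_of_real (u * (r * k x)) * complex_of_real (v x)"
        unfolding J_def using iexp_scaled_limit2[OF yl]
        by (intro tendsto_add tendsto_mult iexp_scaled_limit1[OF yl] tendsto_of_real[OF el]) (simp add: of_real_power)
    qed
  qed measurable
  have Z_e: "(\<integral>x. e n x \<partial>M) = Z n" for n by (simp add: Z_def e_def)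
  \<comment> \<open>The subtracted linear term has mean 0 and \<open>e n\<close> has mean
    \<open>Z n\<close>, so integration recovers \<open>n * (a n - 1)\<close> up to the
    normaliser.\<close>
  have Jint: "(\<integral>x. J n x \<partial>M) = Z n * (real n * (a n - 1))" for n
  proof -
    have iky: "integrable M (y n)"
      unfolding y_def using L2_integrable[OF L2_array_L2[OF k, of n]] by simp
    have iie: "integrable M (\<lambda>x. iexp (y n x) * complex_of_real (e n x))"
      by (rule Bochner_Integration.integrable_bound[OF ie[of n]]) (auto simp: norm_mult)
    have J': "J n x = real n * (iexp (y n x) * complex_of_real (e n x) - complex_of_real (e n x) - \<i> * complex_of_real (y n x))" for x
    proof -
      have "complex_of_real (sqrt (real n)) * complex_of_real (sqrt (real n)) = complex_of_real (real n)"
        by (simp flip: of_real_mult)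
      then have "sqrt (real n) * (iexp (y n x) - 1) * complex_of_real (sqrt (real n) * (e n x - 1)) =
          real n * ((iexp (y n x) - 1) * complex_of_real (e n x - 1))"
        by (simp add: mult_ac)
      then show ?thesis unfolding J_def by (simp add: algebra_simps)
    qed
    have "(\<integral>x. y n x \<partial>M) = 0"
      unfolding y_def using L2_integrable[OF L2_array_L2[OF k, of n]] L2_arrayD(5)[OF k, of n] by simp
    then have "(\<integral>x. J n x \<partial>M) = real n * ((\<integral>x. iexp (y n x) * complex_of_real (e n x) \<partial>M) - complex_of_real (Z n))"
      unfolding J' Z_def e_def[symmetric] using iie iky ie[of n] by (simp add: integral_complex_of_real)
    also have "(\<integral>x. iexp (y n x) * complex_of_real (e n x) \<partial>M) = complex_of_real (Z n) * a n"
    proof -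
      have "a n = (\<integral>x. iexp (y n x) * complex_of_real (e n x) / complex_of_real (Z n) \<partial>M)"
        unfolding a_def tilt_def y_def[symmetric] e_def[symmetric] Z_e by (simp only: of_real_divide times_divide_eq_right)
      then show ?thesis using Zpos[of n] by simp
    qed
    finally show ?thesis by (simp add: algebra_simps)
  qed
  define L where "L = complex_of_real (- (u\<^sup>2 * r\<^sup>2 * (\<integral>x. (k x)\<^sup>2 \<partial>M)) / 2) + \<i> * complex_of_real (u * r * (\<integral>x. k x * v x \<partial>M))"
  have intL: "(\<integral>x. - complex_of_real ((u * (r * k x))\<^sup>2) / 2 + \<i> * complex_of_real (u * (r * k x)) * complex_of_real (v x) \<partial>M) = L"
  proof -
    have "(\<integral>x. - complex_of_real ((u * (r * k x))\<^sup>2) / 2 + \<i> * complex_of_real (u * (r * k x)) * complex_of_real (v x) \<partial>M) =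
        (\<integral>x. complex_of_real (- (u\<^sup>2 * r\<^sup>2 / 2) * (k x)\<^sup>2) + (\<i> * u * r) * complex_of_real (k x * v x) \<partial>M)"
      by (intro Bochner_Integration.integral_cong) (auto simp: power_mult_distrib)
    also have "\<dots> = complex_of_real (\<integral>x. - (u\<^sup>2 * r\<^sup>2 / 2) * (k x)\<^sup>2 \<partial>M) + (\<i> * u * r) * complex_of_real (\<integral>x. k x * v x \<partial>M)"
      using L2_spaceD(2)[OF L2_arrayD(3)[OF k]] L2_integrable_mult[OF L2_arrayD(3)[OF k] L2_arrayD(3)[OF v]]
      by (subst Bochner_Integration.integral_add) (auto simp: integral_complex_of_real simp del: of_real_mult of_real_minus)
    also have "\<dots> = L" by (simp add: L_def mult.assoc)
    finally show ?thesis .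
  qed
  have "(\<lambda>n. (\<integral>x. J n x \<partial>M) / complex_of_real (Z n)) \<longlonglongrightarrow> L / complex_of_real 1"
    by (intro tendsto_divide Jlim[unfolded intL] tendsto_of_real Zlim) auto
  then have "(\<lambda>n. real n * (a n - 1)) \<longlonglongrightarrow> L"
    unfolding Jint using Zpos by (simp add: less_imp_neq[THEN not_sym])
  from power_limit_exp[OF a1 this N] show "(\<lambda>n. (\<integral>x. iexp (u * (c n * kn n x)) * complex_of_real (tilt M n (vn n) x) \<partial>M) ^ N n) \<longlonglongrightarrow>
      exp (complex_of_real p * (complex_of_real (- (u\<^sup>2 * r\<^sup>2 * (\<integral>x. (k x)\<^sup>2 \<partial>M)) / 2) + \<i> * complex_of_real (u * r * (\<integral>x. k x * v x \<partial>M))))"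
    unfolding a_def L_def .
qed

end

section \<open>Total variation and Hellinger distance of samples\<close>

lemma sample_integral_prod:
  fixes f :: "'a \<Rightarrow> 'c::{real_normed_field, banach, second_countable_topology}"
  assumes P: "prob_space P" and Q: "prob_space Q" and f: "integrable P f" and h: "integrable Q h"
  shows "integrable (sample_measure m1 m2 P Q) (\<lambda>z. (\<Prod>i=1..m1. f (fst z i)) * (\<Prod>j=1..m2. h (snd z j)))"
    and "(\<integral>z. (\<Prod>i=1..m1. f (fst z i)) * (\<Prod>j=1..m2. h (snd z j)) \<partial>sample_measure m1 m2 P Q) =
      (\<integral>x. f x \<partial>P) ^ m1 * (\<integral>y. h y \<partial>Q) ^ m2"
proof -
  interpret P: prob_space P by fact
  interpret Q: prob_space Q by fact
  interpret pP: product_prob_space "\<lambda>_::nat. P" by unfold_locales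
  interpret pQ: product_prob_space "\<lambda>_::nat. Q" by unfold_locales
  interpret A: prob_space "Pi\<^sub>M {1..m1} (\<lambda>_. P)" by (intro prob_space_PiM P)
  interpret B: prob_space "Pi\<^sub>M {1..m2} (\<lambda>_. Q)" by (intro prob_space_PiM Q)
  interpret AB: pair_prob_space "Pi\<^sub>M {1..m1} (\<lambda>_. P)" "Pi\<^sub>M {1..m2} (\<lambda>_. Q)" ..
  note i1 = pP.product_integrable_prod[of "{1..m1}" "\<lambda>_. f"] and i2 = pQ.product_integrable_prod[of "{1..m2}" "\<lambda>_. h"]
  show "integrable (sample_measure m1 m2 P Q) (\<lambda>z. (\<Prod>i=1..m1. f (fst z i)) * (\<Prod>j=1..m2. h (snd z j)))"
    unfolding sample_measure_def by (rule AB.pair_integral_mult[OF i1 i2]) (use f h in auto)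
  have "(\<integral>z. (\<Prod>i=1..m1. f (fst z i)) * (\<Prod>j=1..m2. h (snd z j)) \<partial>sample_measure m1 m2 P Q) =
     (\<integral>x. (\<Prod>i=1..m1. f (x i)) \<partial>Pi\<^sub>M {1..m1} (\<lambda>_. P)) * (\<integral>y. (\<Prod>j=1..m2. h (y j)) \<partial>Pi\<^sub>M {1..m2} (\<lambda>_. Q))"
    unfolding sample_measure_def by (rule AB.pair_integral_mult[OF i1 i2]) (use f h in auto)
  then show "(\<integral>z. (\<Prod>i=1..m1. f (fst z i)) * (\<Prod>j=1..m2. h (snd z j)) \<partial>sample_measure m1 m2 P Q) =
      (\<integral>x. f x \<partial>P) ^ m1 * (\<integral>y. h y \<partial>Q) ^ m2"
    using pP.product_integral_prod[of "{1..m1}" "\<lambda>_. f"] pQ.product_integral_prod[of "{1..m2}" "\<lambda>_. h"] f h by simp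
qed

lemma prob_space_sample_measure:
  assumes "prob_space P" "prob_space Q" shows "prob_space (sample_measure m1 m2 P Q)"
proof -
  interpret A: prob_space "Pi\<^sub>M {1..m1} (\<lambda>_. P)" by (intro prob_space_PiM assms)
  interpret B: prob_space "Pi\<^sub>M {1..m2} (\<lambda>_. Q)" by (intro prob_space_PiM assms)
  interpret AB: pair_prob_space "Pi\<^sub>M {1..m1} (\<lambda>_. P)" "Pi\<^sub>M {1..m2} (\<lambda>_. Q)" ..
  show ?thesis unfolding sample_measure_def by unfold_locales
qed

lemma sets_sample_measure_cong:
  "sets P = sets P' \<Longrightarrow> sets Q = sets Q' \<Longrightarrow> sets (sample_measure m1 m2 P Q) = sets (sample_measure m1 m2 P' Q')"
  unfolding sample_measure_def by (intro sets_pair_measure_cong sets_PiM_cong refl) auto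

lemma measurable_sample_fst [measurable]:
  "i \<in> {1..m1} \<Longrightarrow> (\<lambda>z. fst z i) \<in> measurable (sample_measure m1 m2 P Q) P"
  unfolding sample_measure_def by measurable

lemma measurable_sample_snd [measurable]:
  "j \<in> {1..m2} \<Longrightarrow> (\<lambda>z. snd z j) \<in> measurable (sample_measure m1 m2 P Q) Q"
  unfolding sample_measure_def by measurable

text \<open>With \<open>X\<close> and \<open>Y\<close> the root densities of the two samples,
  expectations of a test differ by at most the integral of \<open>|X - Y| (X + Y)\<close>, which
  Cauchy-Schwarz bounds by the distance of the roots. The integral of \<open>X Y\<close> factorises
  over the observations into powers of the affinities.\<close>

lemma sample_test_bound:
  assumes P: "prob_space P" and P0: "prob_space P0" and sP: "sets P = sets P0"
    and Q: "prob_space Q" and Q0: "prob_space Q0" and sQ: "sets Q = sets Q0"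
    and l: "is_density_quotient P P0 l" and m: "is_density_quotient Q Q0 m"
    and p: "\<And>x. 0 \<le> p x" "integrable P0 p" "(\<integral>x. p x \<partial>P0) = 1"
    and q: "\<And>y. 0 \<le> q y" "integrable Q0 q" "(\<integral>y. q y \<partial>Q0) = 1"
    and \<phi>: "\<phi> \<in> borel_measurable (sample_measure m1 m2 P0 Q0)"
    and \<phi>01: "\<And>z. z \<in> space (sample_measure m1 m2 P0 Q0) \<Longrightarrow> 0 \<le> \<phi> z \<and> \<phi> z \<le> 1"
  defines "\<alpha> \<equiv> \<integral>x. sqrt (enn2real (l x)) * sqrt (p x) \<partial>P0"
    and "\<beta> \<equiv> \<integral>y. sqrt (enn2real (m y)) * sqrt (q y) \<partial>Q0"
  shows "\<bar>(\<integral>z. \<phi> z \<partial>sample_measure m1 m2 P Q) -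
      (\<integral>z. \<phi> z * ((\<Prod>i=1..m1. p (fst z i)) * (\<Prod>j=1..m2. q (snd z j))) \<partial>sample_measure m1 m2 P0 Q0)\<bar>
    \<le> 2 * sqrt (2 * (1 - \<alpha> ^ m1 * \<beta> ^ m2))"
proof -
  interpret P0: prob_space P0 by fact
  interpret Q0: prob_space Q0 by fact
  define S where "S = sample_measure m1 m2 P0 Q0"
  define S1 where "S1 = sample_measure m1 m2 P Q"
  interpret S: prob_space S unfolding S_def by (rule prob_space_sample_measure[OF P0 Q0])
  interpret S1: prob_space S1 unfolding S1_def by (rule prob_space_sample_measure[OF P Q])
  have sS[measurable_cong]: "sets S1 = sets S" unfolding S_def S1_def by (rule sets_sample_measure_cong[OF sP sQ])
  note spS = sets_eq_imp_space_eq[OF sS]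
  note [measurable] = \<phi>[folded S_def]
  define a where "a x = sqrt (enn2real (l x))" for x
  define b where "b x = sqrt (enn2real (m x))" for x
  have a2: "a \<in> L2_space P0" and an: "(\<integral>x. (a x)\<^sup>2 \<partial>P0) \<le> 1"
    using density_quotient_root[OF P sP l] by (simp_all add: a_def[abs_def])
  have b2: "b \<in> L2_space Q0" and bn: "(\<integral>x. (b x)\<^sup>2 \<partial>Q0) \<le> 1"
    using density_quotient_root[OF Q sQ m] by (simp_all add: b_def[abs_def])
  have [measurable]: "l \<in> borel_measurable P0" "m \<in> borel_measurable Q0" "p \<in> borel_measurable P0" "q \<in> borel_measurable Q0"
    using l m p(2) q(2) by (auto simp: is_density_quotient_def)
  have p2: "(\<lambda>x. sqrt (p x)) \<in> L2_space P0" using p by (auto simp: L2_space_def)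
  have q2: "(\<lambda>x. sqrt (q x)) \<in> L2_space Q0" using q by (auto simp: L2_space_def)
  define X where "X z = (\<Prod>i=1..m1. a (fst z i)) * (\<Prod>j=1..m2. b (snd z j))" for z
  define Y where "Y z = (\<Prod>i=1..m1. sqrt (p (fst z i))) * (\<Prod>j=1..m2. sqrt (q (snd z j)))" for z
  have X0: "0 \<le> X z" for z unfolding X_def a_def b_def by (intro mult_nonneg_nonneg prod_nonneg) auto
  have Y0: "0 \<le> Y z" for z unfolding Y_def using p q by (intro mult_nonneg_nonneg prod_nonneg) auto
  have Xsq: "(X z)\<^sup>2 = (\<Prod>i=1..m1. (a (fst z i))\<^sup>2) * (\<Prod>j=1..m2. (b (snd z j))\<^sup>2)" for z
    by (simp add: X_def power_mult_distrib prod_power_distrib)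
  have Ysq: "(Y z)\<^sup>2 = (\<Prod>i=1..m1. p (fst z i)) * (\<Prod>j=1..m2. q (snd z j))" for z
    using p q by (simp add: Y_def power_mult_distrib prod_power_distrib)
  have XY: "X z * Y z = (\<Prod>i=1..m1. a (fst z i) * sqrt (p (fst z i))) * (\<Prod>j=1..m2. b (snd z j) * sqrt (q (snd z j)))" for z
    by (simp add: X_def Y_def prod.distrib)
  have a_m: "a \<in> borel_measurable P0" and b_m: "b \<in> borel_measurable Q0"
    unfolding a_def[abs_def] b_def[abs_def] by measurable
  note [measurable] = a_m b_m
  have Xm[measurable]: "X \<in> borel_measurable S" unfolding X_def[abs_def] S_def by measurable
  have Ym[measurable]: "Y \<in> borel_measurable S" unfolding Y_def[abs_def] S_def by measurable
  have iX: "integrable S (\<lambda>z. (X z)\<^sup>2)" and IX: "(\<integral>z. (X z)\<^sup>2 \<partial>S) = (\<integral>x. (a x)\<^sup>2 \<partial>P0) ^ m1 * (\<integral>x. (b x)\<^sup>2 \<partial>Q0) ^ m2"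
    unfolding Xsq S_def by (intro sample_integral_prod P0 Q0 L2_spaceD(2)[OF a2] L2_spaceD(2)[OF b2])+
  have iY: "integrable S (\<lambda>z. (Y z)\<^sup>2)" and IY: "(\<integral>z. (Y z)\<^sup>2 \<partial>S) = 1"
    unfolding Ysq S_def using sample_integral_prod[OF P0 Q0 p(2) q(2), of m1 m2] p q by simp_all
  have IXY: "(\<integral>z. X z * Y z \<partial>S) = \<alpha> ^ m1 * \<beta> ^ m2"
    unfolding XY S_def \<alpha>_def \<beta>_def a_def[symmetric] b_def[symmetric]
    by (intro sample_integral_prod P0 Q0 L2_integrable_mult a2 b2 p2 q2)
  have X2: "X \<in> L2_space S" and Y2: "Y \<in> L2_space S" using iX iY by (auto simp: L2_space_def)
  have IX1: "(\<integral>z. (X z)\<^sup>2 \<partial>S) \<le> 1"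
    unfolding IX using an bn by (intro mult_le_one power_le_one) auto
  \<comment> \<open>The square of \<open>X\<close> is the density of the regular part of the sample
    only, hence an inequality.\<close>
  have lower: "(\<integral>z. f z * (X z)\<^sup>2 \<partial>S) \<le> (\<integral>z. f z \<partial>S1)"
    if f[measurable]: "f \<in> borel_measurable S" and f01: "\<And>z. z \<in> space S \<Longrightarrow> 0 \<le> f z \<and> f z \<le> 1" for f
  proof -
    have if1: "integrable S1 f"
      by (rule S1.integrable_const_bound[where B=1]) (use f01 spS in \<open>auto intro!: AE_I2\<close>)
    have ifX: "integrable S (\<lambda>z. f z * (X z)\<^sup>2)"
      by (rule Bochner_Integration.integrable_bound[OF iX]) (use f01 in \<open>auto intro!: AE_I2 mult_left_le_one_le\<close>)
    have "ennreal (\<integral>z. f z * (X z)\<^sup>2 \<partial>S) = (\<integral>\<^sup>+z. ennreal (f z * (X z)\<^sup>2) \<partial>S)"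
      using f01 by (intro nn_integral_eq_integral[symmetric] ifX) (auto intro!: AE_I2)
    also have "\<dots> \<le> (\<integral>\<^sup>+z. (\<Prod>i=1..m1. l (fst z i)) * (\<Prod>j=1..m2. m (snd z j)) * ennreal (f z) \<partial>S)"
    proof (intro nn_integral_mono)
      fix z assume z: "z \<in> space S"
      have pm: "(\<Prod>i\<in>A. f i) \<le> (\<Prod>i\<in>A. g i)" if "\<And>i. f i \<le> g i" for A and f g :: "nat \<Rightarrow> ennreal"
        by (induction A rule: infinite_finite_induct) (auto intro: mult_mono that)
      \<comment> \<open>\<open>enn2real\<close> sends infinity to 0, so this holds for infinite
        quotients as well.\<close>
      have e: "ennreal (enn2real y) \<le> y" for y :: ennreal by (cases y rule: ennreal_cases) auto
      have "ennreal (f z * (X z)\<^sup>2) = ennreal ((X z)\<^sup>2) * ennreal (f z)"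
        using f01[OF z] by (simp add: ennreal_mult mult.commute)
      also have "ennreal ((X z)\<^sup>2) = (\<Prod>i=1..m1. ennreal (enn2real (l (fst z i)))) * (\<Prod>j=1..m2. ennreal (enn2real (m (snd z j))))"
        unfolding Xsq a_def b_def by (simp add: ennreal_mult prod_ennreal prod_nonneg)
      also have "\<dots> \<le> (\<Prod>i=1..m1. l (fst z i)) * (\<Prod>j=1..m2. m (snd z j))"
        using e by (intro mult_mono pm) auto
      finally show "ennreal (f z * (X z)\<^sup>2) \<le> (\<Prod>i=1..m1. l (fst z i)) * (\<Prod>j=1..m2. m (snd z j)) * ennreal (f z)"
        by (simp add: mult_right_mono)
    qed
    also have "\<dots> \<le> (\<integral>\<^sup>+z. ennreal (f z) \<partial>S1)"
      unfolding S_def S1_def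
      by (rule nn_integral_sample_density_le[OF P P0 sP Q Q0 sQ l m]) (use f in \<open>auto simp: S_def\<close>)
    also have "\<dots> = ennreal (\<integral>z. f z \<partial>S1)"
      using f01 spS by (intro nn_integral_eq_integral if1) (auto intro!: AE_I2)
    finally have "ennreal (\<integral>z. f z * (X z)\<^sup>2 \<partial>S) \<le> ennreal (\<integral>z. f z \<partial>S1)" .
    moreover have "0 \<le> (\<integral>z. f z \<partial>S1)" using f01 spS by (intro integral_nonneg_AE) (auto intro!: AE_I2)
    ultimately show ?thesis by (simp add: ennreal_le_iff)
  qed
  define \<Delta> where "\<Delta> = (\<integral>z. \<bar>X z - Y z\<bar> * (X z + Y z) \<partial>S)"
  have d2: "(\<lambda>z. \<bar>X z - Y z\<bar>) \<in> L2_space S" using L2_space_diff[OF X2 Y2] by (auto simp: L2_space_def)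
  have s2: "(\<lambda>z. X z + Y z) \<in> L2_space S" by (rule L2_space_add[OF X2 Y2])
  note i\<Delta> = L2_integrable_mult[OF d2 s2]
  have "\<Delta> \<le> L2_norm S (\<lambda>z. \<bar>X z - Y z\<bar>) * L2_norm S (\<lambda>z. X z + Y z)"
    using L2_Cauchy_Schwarz[OF d2 s2] by (simp add: \<Delta>_def)
  also have "\<dots> \<le> sqrt (2 * (1 - \<alpha> ^ m1 * \<beta> ^ m2)) * 2"
  proof (intro mult_mono)
    have "(\<integral>z. (X z - Y z)\<^sup>2 \<partial>S) = (\<integral>z. (X z)\<^sup>2 + ((Y z)\<^sup>2 - 2 * (X z * Y z)) \<partial>S)"
      by (intro Bochner_Integration.integral_cong) (auto simp: power2_diff algebra_simps)
    also have "\<dots> = (\<integral>z. (X z)\<^sup>2 \<partial>S) + (1 - 2 * (\<alpha> ^ m1 * \<beta> ^ m2))"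
      using iX iY L2_integrable_mult[OF X2 Y2] by (simp add: IY IXY)
    also have "\<dots> \<le> 2 * (1 - \<alpha> ^ m1 * \<beta> ^ m2)" using IX1 by simp
    finally show "L2_norm S (\<lambda>z. \<bar>X z - Y z\<bar>) \<le> sqrt (2 * (1 - \<alpha> ^ m1 * \<beta> ^ m2))"
      by (simp add: L2_norm_def)
    have "L2_norm S X \<le> 1" using IX1 by (simp add: L2_norm_def)
    moreover have "L2_norm S Y = 1" by (simp add: L2_norm_def IY)
    ultimately show "L2_norm S (\<lambda>z. X z + Y z) \<le> 2" using L2_norm_triangle[OF X2 Y2] by simp
    have "0 \<le> (\<integral>z. (X z - Y z)\<^sup>2 \<partial>S)" by simp
    with \<open>(\<integral>z. (X z)\<^sup>2 \<partial>S) + (1 - 2 * (\<alpha> ^ m1 * \<beta> ^ m2)) \<le> 2 * (1 - \<alpha> ^ m1 * \<beta> ^ m2)\<close>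
      \<open>(\<integral>z. (X z)\<^sup>2 + ((Y z)\<^sup>2 - 2 * (X z * Y z)) \<partial>S) = (\<integral>z. (X z)\<^sup>2 \<partial>S) + (1 - 2 * (\<alpha> ^ m1 * \<beta> ^ m2))\<close>
      \<open>(\<integral>z. (X z - Y z)\<^sup>2 \<partial>S) = (\<integral>z. (X z)\<^sup>2 + ((Y z)\<^sup>2 - 2 * (X z * Y z)) \<partial>S)\<close>
    show "0 \<le> sqrt (2 * (1 - \<alpha> ^ m1 * \<beta> ^ m2))" by simp
  qed simp
  finally have \<Delta>: "\<Delta> \<le> 2 * sqrt (2 * (1 - \<alpha> ^ m1 * \<beta> ^ m2))" by simp
  have close: "(\<integral>z. f z * (Y z)\<^sup>2 \<partial>S) - \<Delta> \<le> (\<integral>z. f z * (X z)\<^sup>2 \<partial>S)"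
    if f[measurable]: "f \<in> borel_measurable S" and f01: "\<And>z. z \<in> space S \<Longrightarrow> 0 \<le> f z \<and> f z \<le> 1" for f
  proof -
    have ifX: "integrable S (\<lambda>z. f z * (X z)\<^sup>2)"
      by (rule Bochner_Integration.integrable_bound[OF iX]) (use f01 in \<open>auto intro!: AE_I2 mult_left_le_one_le\<close>)
    have ifY: "integrable S (\<lambda>z. f z * (Y z)\<^sup>2)"
      by (rule Bochner_Integration.integrable_bound[OF iY]) (use f01 in \<open>auto intro!: AE_I2 mult_left_le_one_le\<close>)
    have "(\<integral>z. f z * (Y z)\<^sup>2 - f z * (X z)\<^sup>2 \<partial>S) \<le> \<Delta>"
      unfolding \<Delta>_def
    proof (intro integral_mono i\<Delta> Bochner_Integration.integrable_diff ifX ifY)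
      fix z assume z: "z \<in> space S"
      have "(Y z)\<^sup>2 - (X z)\<^sup>2 = (Y z - X z) * (X z + Y z)" by (simp add: power2_eq_square algebra_simps)
      also have "\<dots> \<le> \<bar>X z - Y z\<bar> * (X z + Y z)" using X0[of z] Y0[of z] by (intro mult_right_mono) auto
      finally have *: "(Y z)\<^sup>2 - (X z)\<^sup>2 \<le> \<bar>X z - Y z\<bar> * (X z + Y z)" .
      have "f z * (Y z)\<^sup>2 - f z * (X z)\<^sup>2 = f z * ((Y z)\<^sup>2 - (X z)\<^sup>2)" by (simp add: algebra_simps)
      also have "\<dots> \<le> f z * (\<bar>X z - Y z\<bar> * (X z + Y z))" using f01[OF z] by (intro mult_left_mono *) auto
      also have "\<dots> \<le> 1 * (\<bar>X z - Y z\<bar> * (X z + Y z))" using f01[OF z] X0[of z] Y0[of z] by (intro mult_right_mono) auto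
      finally show "f z * (Y z)\<^sup>2 - f z * (X z)\<^sup>2 \<le> \<bar>X z - Y z\<bar> * (X z + Y z)" by simp
    qed
    then show ?thesis using ifX ifY by simp
  qed
  have \<phi>01': "\<And>z. z \<in> space S \<Longrightarrow> 0 \<le> \<phi> z \<and> \<phi> z \<le> 1" using \<phi>01 by (simp add: S_def)
  \<comment> \<open>The lower bounds for \<phi> and for \<open>1 - \<phi>\<close> together bound the
    absolute difference; this accounts for the singular part, which only adds mass to the
    sample.\<close>
  have \<phi>c: "\<And>z. z \<in> space S \<Longrightarrow> 0 \<le> 1 - \<phi> z \<and> 1 - \<phi> z \<le> 1" using \<phi>01' by auto
  have i\<phi>: "integrable S1 \<phi>"
    by (rule S1.integrable_const_bound[where B=1]) (use \<phi>01' spS in \<open>auto intro!: AE_I2\<close>)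
  have i\<phi>Y: "integrable S (\<lambda>z. \<phi> z * (Y z)\<^sup>2)"
    by (rule Bochner_Integration.integrable_bound[OF iY]) (use \<phi>01' in \<open>auto intro!: AE_I2 mult_left_le_one_le\<close>)
  have "(\<integral>z. \<phi> z * (Y z)\<^sup>2 \<partial>S) - \<Delta> \<le> (\<integral>z. \<phi> z \<partial>S1)"
    using close[OF _ \<phi>01'] lower[OF _ \<phi>01'] by force
  moreover have "(\<integral>z. (1 - \<phi> z) * (Y z)\<^sup>2 \<partial>S) - \<Delta> \<le> (\<integral>z. 1 - \<phi> z \<partial>S1)"
  proof -
    have "(\<lambda>z. 1 - \<phi> z) \<in> borel_measurable S" by measurable
    from close[OF this \<phi>c] lower[OF this \<phi>c] show ?thesis by linarith
  qed
  moreover have "(\<integral>z. 1 - \<phi> z \<partial>S1) = 1 - (\<integral>z. \<phi> z \<partial>S1)" using i\<phi> by (simp add: S1.prob_space)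
  moreover have "(\<integral>z. (1 - \<phi> z) * (Y z)\<^sup>2 \<partial>S) = 1 - (\<integral>z. \<phi> z * (Y z)\<^sup>2 \<partial>S)"
    using iY i\<phi>Y by (simp add: left_diff_distrib IY)
  ultimately have "\<bar>(\<integral>z. \<phi> z \<partial>S1) - (\<integral>z. \<phi> z * (Y z)\<^sup>2 \<partial>S)\<bar> \<le> \<Delta>" by linarith
  also note \<Delta>
  finally show ?thesis unfolding Ysq S_def S1_def .
qed

text \<open>Rewrites the bound through the joint quotient, because the remainder estimates of a
  curve concern the pair and not its factors. For one pair the deficit of the affinity is half of
  the singular mass plus half of the squared distance of roots, and Bernoulli's inequality passes to
  \<open>m1 + m2\<close> pairs.\<close>

lemma sample_test_bound_Hellinger:
  assumes P: "prob_space P" and P0: "prob_space P0" and sP: "sets P = sets P0"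
    and Q: "prob_space Q" and Q0: "prob_space Q0" and sQ: "sets Q = sets Q0"
    and L: "is_density_quotient (P \<Otimes>\<^sub>M Q) (P0 \<Otimes>\<^sub>M Q0) L"
    and p: "\<And>x. 0 \<le> p x" "integrable P0 p" "(\<integral>x. p x \<partial>P0) = 1"
    and q: "\<And>y. 0 \<le> q y" "integrable Q0 q" "(\<integral>y. q y \<partial>Q0) = 1"
    and \<phi>: "\<phi> \<in> borel_measurable (sample_measure m1 m2 P0 Q0)"
      "\<And>z. z \<in> space (sample_measure m1 m2 P0 Q0) \<Longrightarrow> 0 \<le> \<phi> z \<and> \<phi> z \<le> 1"
  shows "\<bar>(\<integral>z. \<phi> z \<partial>sample_measure m1 m2 P Q) -
      (\<integral>z. \<phi> z * ((\<Prod>i=1..m1. p (fst z i)) * (\<Prod>j=1..m2. q (snd z j))) \<partial>sample_measure m1 m2 P0 Q0)\<bar>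
    \<le> 2 * sqrt (real (m1 + m2) * (measure (P \<Otimes>\<^sub>M Q) {z \<in> space (P \<Otimes>\<^sub>M Q). L z = \<infinity>} +
        (L2_norm (P0 \<Otimes>\<^sub>M Q0) (\<lambda>z. sqrt (enn2real (L z)) - sqrt (p (fst z) * q (snd z))))\<^sup>2))"
proof -
  interpret P: prob_space P by fact
  interpret Q: prob_space Q by fact
  interpret P0: prob_space P0 by fact
  interpret Q0: prob_space Q0 by fact
  interpret PQ0: pair_prob_space P0 Q0 ..
  interpret PQ: pair_prob_space P Q ..
  obtain l where l: "is_density_quotient P P0 l"
    using ex_density_quotient[OF P.finite_measure P0.finite_measure sP] by blast
  obtain m where m: "is_density_quotient Q Q0 m"
    using ex_density_quotient[OF Q.finite_measure Q0.finite_measure sQ] by blast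
  define a where "a x = sqrt (enn2real (l x))" for x
  define b where "b x = sqrt (enn2real (m x))" for x
  define s where "s = measure (P \<Otimes>\<^sub>M Q) {z \<in> space (P \<Otimes>\<^sub>M Q). L z = \<infinity>}"
  define h where "h = L2_norm (P0 \<Otimes>\<^sub>M Q0) (\<lambda>z. sqrt (enn2real (L z)) - sqrt (p (fst z) * q (snd z)))"
  define \<alpha> where "\<alpha> = (\<integral>x. a x * sqrt (p x) \<partial>P0)"
  define \<beta> where "\<beta> = (\<integral>x. b x * sqrt (q x) \<partial>Q0)"
  have a2: "a \<in> L2_space P0" and an: "(\<integral>x. (a x)\<^sup>2 \<partial>P0) \<le> 1"
    using density_quotient_root[OF P sP l] by (simp_all add: a_def[abs_def])
  have b2: "b \<in> L2_space Q0" and bn: "(\<integral>x. (b x)\<^sup>2 \<partial>Q0) \<le> 1"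
    using density_quotient_root[OF Q sQ m] by (simp_all add: b_def[abs_def])
  have p2: "(\<lambda>x. sqrt (p x)) \<in> L2_space P0" and pn: "L2_norm P0 (\<lambda>x. sqrt (p x)) = 1"
    using p by (auto simp: L2_space_def L2_norm_def)
  have q2: "(\<lambda>x. sqrt (q x)) \<in> L2_space Q0" and qn: "L2_norm Q0 (\<lambda>x. sqrt (q x)) = 1"
    using q by (auto simp: L2_space_def L2_norm_def)
  have \<alpha>01: "0 \<le> \<alpha>" "\<alpha> \<le> 1"
  proof -
    show "0 \<le> \<alpha>" unfolding \<alpha>_def a_def using p by (intro integral_nonneg_AE) auto
    have "\<alpha> \<le> L2_norm P0 a * 1" using L2_Cauchy_Schwarz[OF a2 p2] by (simp add: \<alpha>_def pn)
    also have "\<dots> \<le> 1" using an by (simp add: L2_norm_def)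
    finally show "\<alpha> \<le> 1" .
  qed
  have \<beta>01: "0 \<le> \<beta>" "\<beta> \<le> 1"
  proof -
    show "0 \<le> \<beta>" unfolding \<beta>_def b_def using q by (intro integral_nonneg_AE) auto
    have "\<beta> \<le> L2_norm Q0 b * 1" using L2_Cauchy_Schwarz[OF b2 q2] by (simp add: \<beta>_def qn)
    also have "\<dots> \<le> 1" using bn by (simp add: L2_norm_def)
    finally show "\<beta> \<le> 1" .
  qed
  \<comment> \<open>The regular part has mass \<open>1 - s\<close> and the tilted density mass 1, so
    expanding the square gives \<open>h^2 = (1 - s) + 1 - 2 \<alpha> \<beta>\<close>.\<close>
  have main: "2 * (1 - \<alpha> * \<beta>) = s + h\<^sup>2"
  proof -
    let ?M = "P0 \<Otimes>\<^sub>M Q0"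
    define f where "f z = sqrt (enn2real (L z))" for z
    define g where "g z = sqrt (p (fst z)) * sqrt (q (snd z))" for z
    have sPQ: "sets (P \<Otimes>\<^sub>M Q) = sets ?M" by (intro sets_pair_measure_cong sP sQ)
    have f2: "f \<in> L2_space ?M" and If: "(\<integral>z. (f z)\<^sup>2 \<partial>?M) = 1 - s"
      using density_quotient_root[OF PQ.prob_space_axioms sPQ L] unfolding f_def[abs_def] s_def by auto
    have g2: "g \<in> L2_space ?M" and Ig: "L2_norm ?M g = 1"
      using PQ0.L2_pair_mult[OF p2 q2] unfolding g_def[abs_def] by (auto simp: pn qn)
    have "AE z in ?M. f z * g z = (a (fst z) * sqrt (p (fst z))) * (b (snd z) * sqrt (q (snd z)))"
      using density_quotient_pair_AE[OF P P0 Q Q0 sP sQ l m L]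
      by eventually_elim (simp add: f_def g_def a_def b_def enn2real_mult real_sqrt_mult)
    then have "(\<integral>z. f z * g z \<partial>?M) = (\<integral>z. (a (fst z) * sqrt (p (fst z))) * (b (snd z) * sqrt (q (snd z))) \<partial>?M)"
    proof (intro integral_cong_AE)
      have "(\<lambda>x. a x * sqrt (p x)) \<in> borel_measurable P0" "(\<lambda>x. b x * sqrt (q x)) \<in> borel_measurable Q0"
        using L2_integrable_mult[OF a2 p2] L2_integrable_mult[OF b2 q2] by auto
      then show "(\<lambda>z. (a (fst z) * sqrt (p (fst z))) * (b (snd z) * sqrt (q (snd z)))) \<in> borel_measurable ?M"
        using PQ0.pair_integral_mult(1)[OF L2_integrable_mult[OF a2 p2] L2_integrable_mult[OF b2 q2]] by auto
    qed (use L2_integrable_mult[OF f2 g2] in auto)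
    also have "\<dots> = \<alpha> * \<beta>"
      unfolding \<alpha>_def \<beta>_def by (rule PQ0.pair_integral_mult(2)[OF L2_integrable_mult[OF a2 p2] L2_integrable_mult[OF b2 q2]])
    finally have Ifg: "(\<integral>z. f z * g z \<partial>?M) = \<alpha> * \<beta>" .
    have "h\<^sup>2 = (\<integral>z. (f z - g z)\<^sup>2 \<partial>?M)"
      unfolding h_def L2_norm_power2 f_def g_def by (simp add: real_sqrt_mult)
    also have "\<dots> = (\<integral>z. (f z)\<^sup>2 + ((g z)\<^sup>2 - 2 * (f z * g z)) \<partial>?M)"
      by (intro Bochner_Integration.integral_cong) (auto simp: power2_diff algebra_simps)
    also have "\<dots> = (1 - s) + (1 - 2 * (\<alpha> * \<beta>))"
      using L2_spaceD(2)[OF f2] L2_spaceD(2)[OF g2] L2_integrable_mult[OF f2 g2] Ig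
      by (simp add: If Ifg L2_norm_power2[of ?M g, symmetric])
    finally show ?thesis by simp
  qed
  have ab01: "0 \<le> \<alpha> * \<beta>" "\<alpha> * \<beta> \<le> 1" using \<alpha>01 \<beta>01 by (auto intro: mult_le_one)
  \<comment> \<open>Both marginal affinities dominate the joint affinity \<open>\<alpha> \<beta>\<close>, which absorbs unequal sample sizes.\<close>
  have "1 - real (m1 + m2) * (1 - \<alpha> * \<beta>) \<le> (\<alpha> * \<beta>) ^ (m1 + m2)"
    using Bernoulli_inequality[of "\<alpha> * \<beta> - 1" "m1 + m2"] ab01 by (simp add: algebra_simps)
  also have "\<dots> = (\<alpha> * \<beta>) ^ m1 * (\<alpha> * \<beta>) ^ m2" by (rule power_add)
  also have "\<dots> \<le> \<alpha> ^ m1 * \<beta> ^ m2"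
  proof (rule mult_mono)
    show "(\<alpha> * \<beta>) ^ m1 \<le> \<alpha> ^ m1" using \<alpha>01 \<beta>01 by (intro power_mono mult_left_le) auto
    show "(\<alpha> * \<beta>) ^ m2 \<le> \<beta> ^ m2" using \<alpha>01 \<beta>01 by (intro power_mono mult_left_le_one_le) auto
  qed (use \<alpha>01 ab01 in auto)
  finally have "1 - \<alpha> ^ m1 * \<beta> ^ m2 \<le> real (m1 + m2) * (1 - \<alpha> * \<beta>)" by simp
  then have "2 * (1 - \<alpha> ^ m1 * \<beta> ^ m2) \<le> real (m1 + m2) * (s + h\<^sup>2)" 
    unfolding main[symmetric] mult.left_commute[of _ 2] by (rule mult_left_mono) simp
  then have "2 * sqrt (2 * (1 - \<alpha> ^ m1 * \<beta> ^ m2)) \<le> 2 * sqrt (real (m1 + m2) * (s + h\<^sup>2))" by simp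
  with sample_test_bound[OF P P0 sP Q Q0 sQ l m p q \<phi>]
  show ?thesis unfolding \<alpha>_def \<beta>_def a_def b_def s_def h_def by linarith
qed

section \<open>Power of the two-sided Gauss test\<close>

abbreviation std_normal_cdf :: "real \<Rightarrow> real" where
  "std_normal_cdf \<equiv> cdf std_normal_distribution"

text \<open>Fundamental theorem of calculus on a bounded interval; the base point
  \<open>x - 1\<close> serves to keep \<open>x\<close> in the interior.\<close>

lemma std_normal_cdf_deriv: "(std_normal_cdf has_real_derivative std_normal_density x) (at x)"
proof -
  interpret N: real_distribution std_normal_distribution by (rule real_dist_normal_dist)
  define a where "a = x - 1"
  have eq: "std_normal_cdf y = std_normal_cdf a + integral {a..y} std_normal_density" if "y \<in> {a<..<x+1}" for y
  proof -
    have int: "set_integrable lborel {a..y} std_normal_density"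
      unfolding set_integrable_def using integrable_mult_indicator[OF _ integrable_normal_density[of 1 0]] by simp
    have "std_normal_cdf y - std_normal_cdf a = measure std_normal_distribution {a<..y}"
      using that by (intro N.cdf_diff_eq) auto
    also have "\<dots> = measure std_normal_distribution {a..y}"
    proof -
      have "emeasure std_normal_distribution {a<..y} = emeasure std_normal_distribution {a..y}"
        by (simp add: emeasure_density, intro nn_integral_cong_AE)
          (use AE_lborel_singleton[of a] in \<open>eventually_elim, auto simp: indicator_def\<close>)
      then show ?thesis by (simp add: measure_def)
    qed
    also have "\<dots> = (LBINT t:{a..y}. std_normal_density t)"
    proof -
      have "emeasure std_normal_distribution {a..y} = (\<integral>\<^sup>+t. ennreal (indicator {a..y} t * std_normal_density t) \<partial>lborel)"
        by (simp add: emeasure_density) (intro nn_integral_cong, auto simp: indicator_def)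
      also have "\<dots> = ennreal (LBINT t:{a..y}. std_normal_density t)"
        using int unfolding set_lebesgue_integral_def set_integrable_def
        by (subst nn_integral_eq_integral) auto
      finally show ?thesis
        unfolding measure_def by (simp add: set_lebesgue_integral_def)
    qed
    also have "\<dots> = integral {a..y} std_normal_density"
      by (rule set_borel_integral_eq_integral(2)[OF int])
    finally show ?thesis by simp
  qed
  have "((\<lambda>y. integral {a..y} std_normal_density) has_real_derivative std_normal_density x) (at x within {a..x+1})"
    by (rule integral_has_real_derivative)
      (auto simp: a_def normal_density_def intro!: continuous_intros)
  then have "((\<lambda>y. integral {a..y} std_normal_density) has_real_derivative std_normal_density x) (at x)"
    by (subst (asm) at_within_interior) (auto simp: a_def)
  then have "((\<lambda>y. std_normal_cdf a + integral {a..y} std_normal_density) has_real_derivative std_normal_density x) (at x)"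
    by (auto intro!: derivative_eq_intros)
  then show ?thesis
    by (rule has_field_derivative_transform_within_open[of _ _ _ "{a<..<x+1}"]) (auto simp: eq, auto simp: a_def)
qed

lemma isCont_std_normal_cdf: "isCont std_normal_cdf x"
  using std_normal_cdf_deriv DERIV_isCont by blast

text \<open>The density is even, so the sum of the values at \<open>y\<close> and \<open>- y\<close>
  has derivative 0; the constant is read off at infinity.\<close>

lemma std_normal_cdf_minus: "std_normal_cdf (- x) = 1 - std_normal_cdf x"
proof -
  interpret N: real_distribution std_normal_distribution by (rule real_dist_normal_dist)
  define h where "h y = std_normal_cdf y + std_normal_cdf (- y)" for y
  have "(h has_real_derivative 0) (at y)" for y
  proof -
    have "((\<lambda>y. std_normal_cdf (- y)) has_real_derivative std_normal_density (- y) * (- 1)) (at y)"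
      by (rule DERIV_chain'[OF _ std_normal_cdf_deriv]) (auto intro!: derivative_eq_intros)
    from DERIV_add[OF std_normal_cdf_deriv[of y] this] show ?thesis
      unfolding h_def by (simp add: normal_density_def)
  qed
  then have const: "h y = h x" for y using DERIV_isconst_all[of h y x] by blast
  have "(h \<longlongrightarrow> 1 + 0) at_top"
    unfolding h_def
    by (intro tendsto_add N.cdf_lim_at_top_prob filterlim_compose[OF N.cdf_lim_at_bot] filterlim_uminus_at_bot_at_top)
  then have "((\<lambda>y::real. h x) \<longlongrightarrow> 1 + 0) at_top"
    by (rule Lim_transform_eventually) (intro always_eventually allI const)
  then have "h x = 1" by (simp add: tendsto_const_iff)
  then show ?thesis by (simp add: h_def)
qed

text \<open>The quantile is whatever preimage \<open>inv\<close> selects; the claim amounts to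
  \<open>p\<close> being attained, which follows from the two tails and the intermediate value
  theorem.\<close>

lemma std_normal_quantile:
  assumes "0 < p" "p < 1" shows "std_normal_cdf (std_normal_quantile p) = p"
proof -
  interpret N: real_distribution std_normal_distribution by (rule real_dist_normal_dist)
  have "\<forall>\<^sub>F x in at_top. std_normal_cdf x > p" by (rule order_tendstoD(1)[OF N.cdf_lim_at_top_prob assms(2)])
  then obtain b where b: "std_normal_cdf b > p" using eventually_happens trivial_limit_at_top_linorder by blast
  have "\<forall>\<^sub>F x in at_bot. std_normal_cdf x < p" by (rule order_tendstoD(2)[OF N.cdf_lim_at_bot assms(1)])
  then obtain a where a: "std_normal_cdf a < p" using eventually_happens trivial_limit_at_bot_linorder by blast
  have "a \<le> b" using a b N.cdf_nondecreasing[of b a] by linarith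
  with a b obtain x where "std_normal_cdf x = p"
    using IVT[of std_normal_cdf a p b] isCont_std_normal_cdf by fastforce
  then have "p \<in> range std_normal_cdf" by auto
  then show ?thesis unfolding std_normal_quantile_def by (rule f_inv_into_f)
qed

lemma std_normal_quantile_pos:
  assumes "1/2 < p" "p < 1" shows "0 < std_normal_quantile p"
proof (rule ccontr)
  interpret N: real_distribution std_normal_distribution by (rule real_dist_normal_dist)
  assume "\<not> 0 < std_normal_quantile p"
  then have "std_normal_cdf (std_normal_quantile p) \<le> std_normal_cdf 0" by (intro N.cdf_nondecreasing) auto
  then show False using std_normal_cdf_minus[of 0] std_normal_quantile[of p] assms by simp
qed

text \<open>Limiting power of a two-sided test whose statistic is asymptotically normal with mean
  \<mu> and standard deviation \<tau>.\<close>

definition two_sided_power :: "real \<Rightarrow> real \<Rightarrow> real \<Rightarrow> real" where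
  "two_sided_power c \<tau> \<mu> = measure std_normal_distribution {x. c < \<bar>\<mu> + \<tau> * x\<bar>}"

lemma std_normal_singleton: "measure std_normal_distribution {x} = 0"
proof -
  interpret N: real_distribution std_normal_distribution by (rule real_dist_normal_dist)
  show ?thesis using isCont_std_normal_cdf N.isCont_cdf by blast
qed

lemma two_sided_power_eq:
  assumes "0 \<le> c" "0 < \<tau>"
  shows "two_sided_power c \<tau> \<mu> = 1 - std_normal_cdf ((c - \<mu>) / \<tau>) + std_normal_cdf ((- c - \<mu>) / \<tau>)"
proof -
  interpret N: real_distribution std_normal_distribution by (rule real_dist_normal_dist)
  let ?a = "(- c - \<mu>) / \<tau>" and ?b = "(c - \<mu>) / \<tau>"
  have ab: "?a \<le> ?b" using assms by (intro divide_right_mono) auto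
  have "{x. c < \<bar>\<mu> + \<tau> * x\<bar>} = {..<?a} \<union> {?b<..}"
    using assms by (auto simp: field_simps abs_if split: if_splits)
  then have "two_sided_power c \<tau> \<mu> = N.prob {..<?a} + N.prob {?b<..}"
    unfolding two_sided_power_def using ab by (simp only:) (rule N.finite_measure_Union, auto)
  also have "N.prob {..<?a} = N.prob {..?a}"
  proof -
    have "N.prob ({..<?a} \<union> {?a}) = N.prob {..<?a} + N.prob {?a}" by (rule N.finite_measure_Union) auto
    moreover have "{..<?a} \<union> {?a} = {..?a}" by auto
    ultimately show ?thesis by (simp only: std_normal_singleton add_0_right)
  qed
  also have "N.prob {?b<..} = 1 - N.prob {..?b}"
    using N.prob_compl[of "{..?b}"] by (simp add: Compl_eq_Diff_UNIV[symmetric] not_le set_eq_iff Compl_atMost)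
  finally show ?thesis by (simp add: cdf_def2 cdf_def)
qed

lemma two_sided_power_deriv:
  assumes "0 \<le> c" "0 < \<tau>"
  shows "(two_sided_power c \<tau> has_real_derivative
    (std_normal_density ((c - \<mu>) / \<tau>) - std_normal_density ((c + \<mu>) / \<tau>)) / \<tau>) (at \<mu>)"
proof -
  have "((\<lambda>\<mu>. 1 - std_normal_cdf ((c - \<mu>) / \<tau>) + std_normal_cdf ((- c - \<mu>) / \<tau>)) has_real_derivative
     0 - std_normal_density ((c - \<mu>) / \<tau>) * (- 1 / \<tau>) + std_normal_density ((- c - \<mu>) / \<tau>) * (- 1 / \<tau>)) (at \<mu>)"
    by (intro DERIV_add DERIV_diff DERIV_const DERIV_chain'[OF _ std_normal_cdf_deriv])
      (use assms in \<open>auto intro!: derivative_eq_intros simp: field_simps\<close>)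
  moreover have "std_normal_density ((- c - \<mu>) / \<tau>) = std_normal_density ((c + \<mu>) / \<tau>)"
    by (simp add: normal_density_def power_divide power2_eq_square algebra_simps)
  ultimately show ?thesis
    unfolding two_sided_power_eq[OF assms, abs_def] by (simp add: diff_divide_distrib)
qed

text \<open>The normal density is even and decreases away from 0. For nonnegative \<mu> the point
  \<open>(c - \<mu>) / \<tau>\<close> is nearer to 0 than \<open>(c + \<mu>) / \<tau>\<close>, for
  nonpositive \<mu> it is farther; so the power decreases up to 0 and increases afterwards.\<close>

lemma two_sided_power_ge:
  assumes "0 \<le> c" "0 < \<tau>"
  shows "two_sided_power c \<tau> 0 \<le> two_sided_power c \<tau> \<mu>"
proof -
  have dens: "std_normal_density x \<ge> std_normal_density y" if "\<bar>x\<bar> \<le> \<bar>y\<bar>" for x y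
    using that unfolding std_normal_density_def abs_le_square_iff by (intro mult_left_mono) auto
  show ?thesis
  proof (cases "\<mu> \<ge> 0")
    case True
    have "\<exists>y. (two_sided_power c \<tau> has_real_derivative y) (at x) \<and> 0 \<le> y" if "0 \<le> x" "x \<le> \<mu>" for x
    proof -
      have "\<bar>(c - x) / \<tau>\<bar> \<le> \<bar>(c + x) / \<tau>\<bar>" using assms that by (simp add: abs_divide divide_right_mono)
      then have "0 \<le> (std_normal_density ((c - x) / \<tau>) - std_normal_density ((c + x) / \<tau>)) / \<tau>"
        using dens assms by (intro divide_nonneg_pos) auto
      with two_sided_power_deriv[OF assms] show ?thesis by blast
    qed
    then show ?thesis using DERIV_nonneg_imp_nondecreasing[OF True] by blast
  next
    case False
    have "\<exists>y. (two_sided_power c \<tau> has_real_derivative y) (at x) \<and> y \<le> 0" if "\<mu> \<le> x" "x \<le> 0" for x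
    proof -
      have "\<bar>(c + x) / \<tau>\<bar> \<le> \<bar>(c - x) / \<tau>\<bar>" using assms that by (simp add: abs_divide divide_right_mono)
      then have "(std_normal_density ((c - x) / \<tau>) - std_normal_density ((c + x) / \<tau>)) / \<tau> \<le> 0"
        using dens assms by (intro divide_nonpos_pos) auto
      with two_sided_power_deriv[OF assms] show ?thesis by blast
    qed
    then show ?thesis using DERIV_nonpos_imp_nonincreasing[of \<mu> 0 "two_sided_power c \<tau>"] False by force
  qed
qed

lemma two_sided_power_level:
  assumes "0 < \<alpha>" "\<alpha> < 1" "0 < \<tau>"
  shows "two_sided_power (std_normal_quantile (1 - \<alpha> / 2) * \<tau>) \<tau> 0 = \<alpha>"
proof -
  let ?z = "std_normal_quantile (1 - \<alpha> / 2)"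
  have z: "0 < ?z" using assms by (intro std_normal_quantile_pos) auto
  have "two_sided_power (?z * \<tau>) \<tau> 0 = 1 - std_normal_cdf ?z + std_normal_cdf (- ?z)"
    using z assms by (subst two_sided_power_eq) auto
  also have "\<dots> = \<alpha>" unfolding std_normal_cdf_minus using assms by (subst (1 2) std_normal_quantile) auto
  finally show ?thesis .
qed

text \<open>At 0 the derivative vanishes by symmetry. The denominator \<open>sinh\<close> in place
  of \<epsilon> anticipates the multiplier by which this difference will be weighted.\<close>

lemma two_sided_power_flat:
  assumes "0 < c" "0 < \<tau>" "s \<noteq> 0"
  shows "((\<lambda>\<epsilon>. (two_sided_power c \<tau> (\<epsilon> * m) - two_sided_power c \<tau> 0) / sinh (\<epsilon> * s)) \<longlongrightarrow> 0) (at_right 0)"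
proof -
  have "(two_sided_power c \<tau> has_real_derivative 0) (at (0 * m))"
    using two_sided_power_deriv[of c \<tau> 0] assms by simp
  then have "((\<lambda>\<epsilon>. two_sided_power c \<tau> (\<epsilon> * m)) has_real_derivative 0 * m) (at 0)"
    by (rule DERIV_chain'[rotated]) (auto intro!: derivative_eq_intros)
  then have 1: "((\<lambda>\<epsilon>. (two_sided_power c \<tau> (\<epsilon> * m) - two_sided_power c \<tau> 0) / \<epsilon>) \<longlongrightarrow> 0) (at 0)"
    unfolding has_field_derivative_iff by simp
  have "((\<lambda>\<epsilon>. sinh (\<epsilon> * s)) has_real_derivative s) (at 0)"
    by (auto intro!: derivative_eq_intros)
  then have "((\<lambda>\<epsilon>. sinh (\<epsilon> * s) / \<epsilon>) \<longlongrightarrow> s) (at 0)"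
    unfolding has_field_derivative_iff by simp
  from tendsto_divide[OF 1 this assms(3)]
  have "((\<lambda>\<epsilon>. ((two_sided_power c \<tau> (\<epsilon> * m) - two_sided_power c \<tau> 0) / \<epsilon>) / (sinh (\<epsilon> * s) / \<epsilon>)) \<longlongrightarrow> 0) (at_right 0)"
    by (auto intro: tendsto_mono[OF at_le])
  then show ?thesis
    by (rule Lim_transform_eventually) (auto simp: eventually_at_filter)
qed

section \<open>Tilted two-sample problems\<close>

text \<open>Density of the tilted sample with respect to the null sample; the tilted law is
  dominated by construction.\<close>

definition sample_tilt :: "'a measure \<Rightarrow> 'b measure \<Rightarrow> (nat \<Rightarrow> nat) \<Rightarrow> (nat \<Rightarrow> nat) \<Rightarrow>
    (nat \<Rightarrow> 'a \<Rightarrow> real) \<Rightarrow> (nat \<Rightarrow> 'b \<Rightarrow> real) \<Rightarrow> nat \<Rightarrow> (nat \<Rightarrow> 'a) \<times> (nat \<Rightarrow> 'b) \<Rightarrow> real" where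
  "sample_tilt P0 Q0 n1 n2 v1n v2n n z =
    (\<Prod>i=1..n1 n. tilt P0 n (v1n n) (fst z i)) * (\<Prod>j=1..n2 n. tilt Q0 n (v2n n) (snd z j))"

definition pair_array :: "'a measure \<Rightarrow> 'b measure \<Rightarrow> (nat \<Rightarrow> 'a \<Rightarrow> real) \<Rightarrow> (nat \<Rightarrow> 'b \<Rightarrow> real) \<Rightarrow>
    ('a \<Rightarrow> real) \<Rightarrow> ('b \<Rightarrow> real) \<Rightarrow> bool" where
  "pair_array P0 Q0 v1n v2n v1 v2 \<longleftrightarrow>
    L2_array P0 v1n v1 \<and> root_bounded P0 v1n \<and> L2_array Q0 v2n v2 \<and> root_bounded Q0 v2n"

locale two_sample = pair_prob_space P0 Q0 for P0 :: "'a measure" and Q0 :: "'b measure" +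
  fixes n1 n2 :: "nat \<Rightarrow> nat" and d :: real
  assumes sample_sizes: "n1 n + n2 n = n" and d01: "0 < d" "d < 1"
    and fraction: "(\<lambda>n. real (n2 n) / real n) \<longlonglongrightarrow> d"
begin

abbreviation S :: "nat \<Rightarrow> ((nat \<Rightarrow> 'a) \<times> (nat \<Rightarrow> 'b)) measure" where
  "S n \<equiv> sample_measure (n1 n) (n2 n) P0 Q0"

abbreviation D where "D \<equiv> sample_tilt P0 Q0 n1 n2"

abbreviation arr where "arr \<equiv> pair_array P0 Q0"

lemma fraction1: "(\<lambda>n. real (n1 n) / real n) \<longlonglongrightarrow> 1 - d"
proof (rule Lim_transform_eventually)
  show "(\<lambda>n. 1 - real (n2 n) / real n) \<longlonglongrightarrow> 1 - d" by (intro tendsto_intros fraction)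
  show "\<forall>\<^sub>F n in sequentially. 1 - real (n2 n) / real n = real (n1 n) / real n"
    using eventually_gt_at_top[of 0]
  proof eventually_elim
    case (elim n)
    have "real (n1 n) + real (n2 n) = real n" using sample_sizes[of n] by (metis of_nat_add)
    then show ?case using elim by (simp add: field_simps)
  qed
qed

lemma arrD:
  assumes "arr v1n v2n v1 v2"
  shows "L2_array P0 v1n v1" "root_bounded P0 v1n" "L2_array Q0 v2n v2" "root_bounded Q0 v2n"
  using assms by (auto simp: pair_array_def)

lemma arr_add:
  assumes "arr u1n u2n u1 u2" "arr v1n v2n v1 v2"
  shows "arr (\<lambda>n x. u1n n x + c * v1n n x) (\<lambda>n y. u2n n y + c * v2n n y) (\<lambda>x. u1 x + c * v1 x) (\<lambda>y. u2 y + c * v2 y)"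
  using assms unfolding pair_array_def
  by (intro conjI M1.L2_array_add M1.L2_array_cmult M2.L2_array_add M2.L2_array_cmult root_bounded_add root_bounded_cmult) auto

lemma ex_arr:
  assumes "v1 \<in> L2_zero P0" "v2 \<in> L2_zero Q0" obtains v1n v2n where "arr v1n v2n v1 v2"
  using M1.ex_root_bounded_array[OF assms(1)] M2.ex_root_bounded_array[OF assms(2)] that
  unfolding pair_array_def by blast

lemma sample_tilt_nonneg:
  assumes "arr v1n v2n v1 v2" shows "0 < D v1n v2n n z"
  unfolding sample_tilt_def
  by (intro mult_pos_pos prod_pos ballI M1.tilt_density(2)[OF arrD(1,2)[OF assms]] M2.tilt_density(2)[OF arrD(3,4)[OF assms]])

lemma sample_tilt_integrable:
  assumes v: "arr v1n v2n v1 v2" shows "integrable (S n) (D v1n v2n n)" "(\<integral>z. D v1n v2n n z \<partial>S n) = 1"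
  unfolding sample_tilt_def[abs_def]
  using sample_integral_prod[OF M1.prob_space_axioms M2.prob_space_axioms M1.tilt_density(3)[OF arrD(1,2)[OF v]] M2.tilt_density(3)[OF arrD(3,4)[OF v]]]
    M1.tilt_density(4)[OF arrD(1,2)[OF v]] M2.tilt_density(4)[OF arrD(3,4)[OF v]]
  by simp_all

text \<open>Curves live on the product space, so their comparison with tilts takes place there; the
  exponential of a direct sum, normaliser included, factorises.\<close>

lemma arr_direct_sum:
  assumes v: "arr v1n v2n v1 v2"
  shows "L2_array (P0 \<Otimes>\<^sub>M Q0) (\<lambda>n. v1n n \<oplus>\<^sub>f v2n n) (v1 \<oplus>\<^sub>f v2)"
    and "root_bounded (P0 \<Otimes>\<^sub>M Q0) (\<lambda>n. v1n n \<oplus>\<^sub>f v2n n)"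
    and "tilt (P0 \<Otimes>\<^sub>M Q0) n (v1n n \<oplus>\<^sub>f v2n n) z = tilt P0 n (v1n n) (fst z) * tilt Q0 n (v2n n) (snd z)"
proof -
  note a = arrD[OF v]
  obtain w1 where w1: "w1 \<in> L2_space P0" "\<And>n x. x \<in> space P0 \<Longrightarrow> \<bar>v1n n x\<bar> \<le> w1 x"
    by (rule L2_array_bound[OF a(1)]) blast
  obtain w2 where w2: "w2 \<in> L2_space Q0" "\<And>n x. x \<in> space Q0 \<Longrightarrow> \<bar>v2n n x\<bar> \<le> w2 x"
    by (rule L2_array_bound[OF a(3)]) blast
  note [measurable] = L2_arrayD(1)[OF a(1)] L2_arrayD(1)[OF a(3)]
  show "L2_array (P0 \<Otimes>\<^sub>M Q0) (\<lambda>n. v1n n \<oplus>\<^sub>f v2n n) (v1 \<oplus>\<^sub>f v2)"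
  proof (rule L2_arrayI)
    show "(v1n n \<oplus>\<^sub>f v2n n) \<in> borel_measurable (P0 \<Otimes>\<^sub>M Q0)" for n
      unfolding direct_sum_def[abs_def] by measurable
    have i: "integrable P0 (v1n n)" "integrable Q0 (v2n n)" for n
      using M1.L2_integrable[OF M1.L2_array_L2[OF a(1)]] M2.L2_integrable[OF M2.L2_array_L2[OF a(3)]] by auto
    show "(\<integral>z. (v1n n \<oplus>\<^sub>f v2n n) z \<partial>(P0 \<Otimes>\<^sub>M Q0)) = 0" for n
      unfolding direct_sum_def using pair_integral_fst[OF i(1)] pair_integral_snd[OF i(2)] L2_arrayD(5)[OF a(1)] L2_arrayD(5)[OF a(3)] by simp
    have j: "integrable P0 v1" "integrable Q0 v2"
      using M1.L2_integrable[OF L2_arrayD(3)[OF a(1)]] M2.L2_integrable[OF L2_arrayD(3)[OF a(3)]] by auto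
    have "(\<integral>z. (v1 \<oplus>\<^sub>f v2) z \<partial>(P0 \<Otimes>\<^sub>M Q0)) = 0"
      unfolding direct_sum_def using pair_integral_fst[OF j(1)] pair_integral_snd[OF j(2)] L2_zeroD(2)[OF L2_arrayD(2)[OF a(1)]] L2_zeroD(2)[OF L2_arrayD(2)[OF a(3)]] by simp
    then show "(v1 \<oplus>\<^sub>f v2) \<in> L2_zero (P0 \<Otimes>\<^sub>M Q0)"
      using direct_sum_L2[OF L2_arrayD(3)[OF a(1)] L2_arrayD(3)[OF a(3)]] by (simp add: L2_zero_def)
    show "(\<lambda>n. (v1n n \<oplus>\<^sub>f v2n n) z) \<longlonglongrightarrow> (v1 \<oplus>\<^sub>f v2) z" if "z \<in> space (P0 \<Otimes>\<^sub>M Q0)" for z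
      unfolding direct_sum_def using that by (intro tendsto_add L2_arrayD(6)[OF a(1)] L2_arrayD(6)[OF a(3)]) (auto simp: space_pair_measure)
    show "w1 \<oplus>\<^sub>f w2 \<in> L2_space (P0 \<Otimes>\<^sub>M Q0)" by (rule direct_sum_L2[OF w1(1) w2(1)])
    show "\<bar>(v1n n \<oplus>\<^sub>f v2n n) z\<bar> \<le> (w1 \<oplus>\<^sub>f w2) z" if "z \<in> space (P0 \<Otimes>\<^sub>M Q0)" for n z
    proof -
      have "fst z \<in> space P0" "snd z \<in> space Q0" using that by (auto simp: space_pair_measure)
      from w1(2)[OF this(1), of n] w2(2)[OF this(2), of n] show ?thesis unfolding direct_sum_def by linarith
    qed
  qed
  obtain C1 C2 where "\<forall>n. \<forall>x\<in>space P0. \<bar>v1n n x\<bar> \<le> C1 * sqrt (real n)" "\<forall>n. \<forall>y\<in>space Q0. \<bar>v2n n y\<bar> \<le> C2 * sqrt (real n)"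
    using a(2,4) unfolding root_bounded_def by blast
  then have "\<bar>(v1n n \<oplus>\<^sub>f v2n n) z\<bar> \<le> (C1 + C2) * sqrt (real n)" if "z \<in> space (P0 \<Otimes>\<^sub>M Q0)" for n z
    unfolding direct_sum_def distrib_right using that
    by (intro order_trans[OF abs_triangle_ineq] add_mono) (auto simp: space_pair_measure)
  then show "root_bounded (P0 \<Otimes>\<^sub>M Q0) (\<lambda>n. v1n n \<oplus>\<^sub>f v2n n)" unfolding root_bounded_def by blast
  have e: "exp ((v1n n \<oplus>\<^sub>f v2n n) z / sqrt (real n)) = exp (v1n n (fst z) / sqrt (real n)) * exp (v2n n (snd z) / sqrt (real n))" for z
    by (simp add: direct_sum_def add_divide_distrib exp_add)
  show "tilt (P0 \<Otimes>\<^sub>M Q0) n (v1n n \<oplus>\<^sub>f v2n n) z = tilt P0 n (v1n n) (fst z) * tilt Q0 n (v2n n) (snd z)"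
    unfolding tilt_def e
    using pair_integral_mult(2)[OF M1.tilt_normalizer(1)[OF a(1,2)] M2.tilt_normalizer(1)[OF a(3,4)]] by simp
qed

text \<open>Roots expand with half the tangent, so \<open>sqrt n\<close> times the distance of the
  roots is asymptotically at most half the L2-distance of \<open>a g\<close> and
  \<open>v1 \<oplus>\<^sub>f v2\<close>; the factor 2 in the test bound restores the full
  distance.\<close>

lemma curve_test_limit:
  assumes F: "prob_family A1 F" and G: "prob_family A2 G" and P0F: "P0 \<in> F" and Q0G: "Q0 \<in> G"
    and curve: "L2_differentiable_curve (prod_family F G) e R g" and R0: "R 0 = P0 \<Otimes>\<^sub>M Q0"
    and t: "t \<longlonglongrightarrow> 0" "0 < a" "(\<lambda>n. t n * sqrt (real n)) \<longlonglongrightarrow> a" "\<And>n. \<bar>t n\<bar> < e"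
    and PQ: "\<And>n. R (t n) = P n \<Otimes>\<^sub>M Q n" "\<And>n. P n \<in> F" "\<And>n. Q n \<in> G"
    and v: "arr v1n v2n v1 v2"
    and \<phi>: "test_sequence A1 A2 n1 n2 \<phi>"
  shows "\<exists>\<rho>. \<rho> \<longlonglongrightarrow> L2_norm (P0 \<Otimes>\<^sub>M Q0) (\<lambda>z. a * g z - (v1 \<oplus>\<^sub>f v2) z) \<and>
    (\<forall>n. \<bar>test_mean n1 n2 \<phi> P Q n - (\<integral>z. \<phi> n z * D v1n v2n n z \<partial>S n)\<bar> \<le> \<rho> n)"
proof -
  let ?M = "P0 \<Otimes>\<^sub>M Q0"
  have psF: "prob_space P" and sF: "sets P = sets A1" if "P \<in> F" for P
    using F that by (auto simp: prob_family_def)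
  have psG: "prob_space Q" and sG: "sets Q = sets A2" if "Q \<in> G" for Q
    using G that by (auto simp: prob_family_def)
  have sP: "sets (P n) = sets P0" and sQ: "sets (Q n) = sets Q0" for n
    using sF[OF PQ(2)] sF[OF P0F] sG[OF PQ(3)] sG[OF Q0G] by auto
  obtain L where g: "g \<in> L2_space ?M"
    and L: "\<And>t. \<bar>t\<bar> < e \<Longrightarrow> is_density_quotient (R t) ?M (L t)"
    and L1: "(\<lambda>t. L2_norm ?M (\<lambda>x. 2 * (sqrt (enn2real (L t x)) - 1) - t * g x)) \<in> o[at 0](\<lambda>t. \<bar>t\<bar>)"
    and L2: "(\<lambda>t. measure (R t) {x \<in> space (R t). L t x = \<infinity>}) \<in> o[at 0](\<lambda>t. t\<^sup>2)"
    using curve unfolding L2_differentiable_curve_def R0 by auto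
  have "\<forall>\<^sub>F n in sequentially. t n * sqrt (real n) > 0" by (rule order_tendstoD(1)[OF t(3,2)])
  \<comment> \<open>The little-o conditions are punctured limits at 0, so \<open>t n = 0\<close> has
    to be excluded eventually.\<close>
  then have tpos: "\<forall>\<^sub>F n in sequentially. t n > 0"
    by eventually_elim (metis mult_le_0_iff not_le real_sqrt_ge_zero of_nat_0_le_iff)
  have t_at: "filterlim t (at 0) sequentially"
    using t(1) tpos by (auto simp: filterlim_at elim: eventually_mono)
  define r where "r n = L2_norm ?M (\<lambda>x. 2 * (sqrt (enn2real (L (t n) x)) - 1) - t n * g x)" for n
  define s where "s n = measure (R (t n)) {x \<in> space (R (t n)). L (t n) x = \<infinity>}" for n
  have r: "(\<lambda>n. sqrt (real n) * r n) \<longlonglongrightarrow> 0"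
  proof (rule Lim_transform_eventually)
    have "(\<lambda>n. r n / \<bar>t n\<bar>) \<longlonglongrightarrow> 0"
      unfolding r_def by (rule filterlim_compose[OF smalloD_tendsto[OF L1] t_at])
    from tendsto_mult[OF tendsto_rabs[OF t(3)] this]
    show "(\<lambda>n. \<bar>t n * sqrt (real n)\<bar> * (r n / \<bar>t n\<bar>)) \<longlonglongrightarrow> 0" by simp
    show "\<forall>\<^sub>F n in sequentially. \<bar>t n * sqrt (real n)\<bar> * (r n / \<bar>t n\<bar>) = sqrt (real n) * r n"
      using tpos by eventually_elim (simp add: abs_mult)
  qed
  have s: "(\<lambda>n. real n * s n) \<longlonglongrightarrow> 0"
  proof (rule Lim_transform_eventually)
    have "(\<lambda>n. s n / (t n)\<^sup>2) \<longlonglongrightarrow> 0"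
      unfolding s_def by (rule filterlim_compose[OF smalloD_tendsto[OF L2] t_at])
    from tendsto_mult[OF tendsto_power[OF t(3), of 2] this]
    show "(\<lambda>n. (t n * sqrt (real n))\<^sup>2 * (s n / (t n)\<^sup>2)) \<longlonglongrightarrow> 0" by simp
    show "\<forall>\<^sub>F n in sequentially. (t n * sqrt (real n))\<^sup>2 * (s n / (t n)\<^sup>2) = real n * s n"
      using tpos by eventually_elim (simp add: power_mult_distrib)
  qed
  note dv = arr_direct_sum[OF v]
  define w where "w = v1 \<oplus>\<^sub>f v2"
  define q where "q n = tilt ?M n (v1n n \<oplus>\<^sub>f v2n n)" for n
  define h where "h n = L2_norm ?M (\<lambda>z. sqrt (real n) * (sqrt (q n z) - 1) - w z / 2)" for n
  have h: "h \<longlonglongrightarrow> 0" unfolding h_def q_def w_def by (rule tilt_root_derivative(2)[OF dv(1,2)])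
  have q2: "(\<lambda>z. sqrt (q n z)) \<in> L2_space ?M" for n unfolding q_def by (rule tilt_root_derivative(1)[OF dv(1,2)])
  have w2: "w \<in> L2_space ?M" unfolding w_def by (rule L2_arrayD(3)[OF dv(1)])
  \<comment> \<open>Four errors: remainder of the curve, deviation of \<open>t n * sqrt n\<close>
    from \<open>a\<close>, distance of the tangents, remainder of the tilt. They are the norms of
    \<open>f1\<close> to \<open>f4\<close> below.\<close>
  define \<rho>' where "\<rho>' n = sqrt (real n) * r n / 2 + \<bar>t n * sqrt (real n) - a\<bar> / 2 * L2_norm ?M g +
      L2_norm ?M (\<lambda>z. a * g z - w z) / 2 + h n" for n
  define \<rho> where "\<rho> n = 2 * sqrt (real n * s n + (\<rho>' n)\<^sup>2)" for n
  have "\<rho>' \<longlonglongrightarrow> 0 / 2 + \<bar>a - a\<bar> / 2 * L2_norm ?M g + L2_norm ?M (\<lambda>z. a * g z - w z) / 2 + 0"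
    unfolding \<rho>'_def by (intro tendsto_intros r t(3) h) auto
  then have "\<rho> \<longlonglongrightarrow> 2 * sqrt (0 + (0 / 2 + \<bar>a - a\<bar> / 2 * L2_norm ?M g + L2_norm ?M (\<lambda>z. a * g z - w z) / 2 + 0)\<^sup>2)"
    unfolding \<rho>_def by (intro tendsto_intros s)
  then have "\<rho> \<longlonglongrightarrow> L2_norm ?M (\<lambda>z. a * g z - w z)" by simp
  moreover have "\<bar>test_mean n1 n2 \<phi> P Q n - (\<integral>z. \<phi> n z * D v1n v2n n z \<partial>S n)\<bar> \<le> \<rho> n" for n
  proof -
    have PPn: "prob_space (P n)" and PQn: "prob_space (Q n)" using psF[OF PQ(2)] psG[OF PQ(3)] by auto
    have dq: "is_density_quotient (P n \<Otimes>\<^sub>M Q n) ?M (L (t n))" using L[OF t(4)] PQ(1) by simp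
    have sS: "sets (sample_measure (n1 n) (n2 n) A1 A2) = sets (S n)"
      using sF[OF P0F] sG[OF Q0G] by (intro sets_sample_measure_cong) auto
    have \<phi>m: "\<phi> n \<in> borel_measurable (S n)"
    proof -
      have "\<phi> n \<in> borel_measurable (sample_measure (n1 n) (n2 n) A1 A2)"
        using \<phi> unfolding test_sequence_def by blast
      then show ?thesis by (simp only: measurable_cong_sets[OF sS refl])
    qed
    have \<phi>01: "0 \<le> \<phi> n z \<and> \<phi> n z \<le> 1" if "z \<in> space (S n)" for z
    proof -
      have "z \<in> space (sample_measure (n1 n) (n2 n) A1 A2)"
        using that by (simp only: sets_eq_imp_space_eq[OF sS])
      then show ?thesis using \<phi> unfolding test_sequence_def by blast
    qed
    define l where "l z = sqrt (enn2real (L (t n) z))" for z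
    have "sets (P n \<Otimes>\<^sub>M Q n) = sets ?M" by (intro sets_pair_measure_cong sP sQ)
    moreover have "prob_space (P n \<Otimes>\<^sub>M Q n)"
    proof -
      interpret a: prob_space "P n" by fact
      interpret b: prob_space "Q n" by fact
      interpret c: pair_prob_space "P n" "Q n" ..
      show ?thesis by unfold_locales
    qed
    ultimately have l2: "l \<in> L2_space ?M" unfolding l_def[abs_def] using density_quotient_root(1)[OF _ _ dq] by blast
    have pm: "0 \<le> tilt P0 n (v1n n) x" "0 \<le> tilt Q0 n (v2n n) y" for x y
      using M1.tilt_density(2)[OF arrD(1,2)[OF v]] M2.tilt_density(2)[OF arrD(3,4)[OF v]] by (auto simp: less_imp_le)
    have "\<bar>test_mean n1 n2 \<phi> P Q n - (\<integral>z. \<phi> n z * D v1n v2n n z \<partial>S n)\<bar> \<le>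
      2 * sqrt (real (n1 n + n2 n) * (measure (P n \<Otimes>\<^sub>M Q n) {z \<in> space (P n \<Otimes>\<^sub>M Q n). L (t n) z = \<infinity>} +
        (L2_norm ?M (\<lambda>z. sqrt (enn2real (L (t n) z)) - sqrt (tilt P0 n (v1n n) (fst z) * tilt Q0 n (v2n n) (snd z))))\<^sup>2))"
      unfolding test_mean_def sample_tilt_def
      by (rule sample_test_bound_Hellinger[OF PPn M1.prob_space_axioms sP PQn M2.prob_space_axioms sQ dq
            pm(1) M1.tilt_density(3,4)[OF arrD(1,2)[OF v]] pm(2) M2.tilt_density(3,4)[OF arrD(3,4)[OF v]] \<phi>m \<phi>01])
    also have "\<dots> = 2 * sqrt (real n * (s n + (L2_norm ?M (\<lambda>z. l z - sqrt (q n z)))\<^sup>2))"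
      unfolding sample_sizes s_def PQ(1) l_def q_def dv(3) by simp
    also have "\<dots> = 2 * sqrt (real n * s n + (sqrt (real n) * L2_norm ?M (\<lambda>z. l z - sqrt (q n z)))\<^sup>2)"
      by (simp add: distrib_left power_mult_distrib)
    also have "\<dots> \<le> \<rho> n"
    proof -
      define f1 where "f1 z = sqrt (real n) / 2 * (2 * (l z - 1) - t n * g z)" for z
      define f2 where "f2 z = (t n * sqrt (real n) - a) / 2 * g z" for z
      define f3 where "f3 z = 1 / 2 * (a * g z - w z)" for z
      define f4 where "f4 z = (- 1) * (sqrt (real n) * (sqrt (q n z) - 1) - 1 / 2 * w z)" for z
      have m1: "f1 \<in> L2_space ?M" unfolding f1_def by (intro L2_space_cmult L2_space_diff l2 g L2_space_const)
      have m2: "f2 \<in> L2_space ?M" unfolding f2_def by (intro L2_space_cmult g)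
      have m3: "f3 \<in> L2_space ?M" unfolding f3_def by (intro L2_space_cmult L2_space_diff g w2)
      have m4: "f4 \<in> L2_space ?M" unfolding f4_def by (intro L2_space_cmult L2_space_diff q2 w2 L2_space_const)
      have "sqrt (real n) * L2_norm ?M (\<lambda>z. l z - sqrt (q n z)) = L2_norm ?M (\<lambda>z. sqrt (real n) * (l z - sqrt (q n z)))"
        by (simp add: L2_norm_cmult)
      also have "\<dots> = L2_norm ?M (\<lambda>z. f1 z + (f2 z + (f3 z + f4 z)))"
        by (rule arg_cong[where f="L2_norm ?M"]) (auto simp: f1_def f2_def f3_def f4_def field_simps)
      also have "\<dots> \<le> L2_norm ?M f1 + L2_norm ?M (\<lambda>z. f2 z + (f3 z + f4 z))"
        by (intro L2_norm_triangle L2_space_add m1 m2 m3 m4)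
      also have "L2_norm ?M (\<lambda>z. f2 z + (f3 z + f4 z)) \<le> L2_norm ?M f2 + L2_norm ?M (\<lambda>z. f3 z + f4 z)"
        by (intro L2_norm_triangle L2_space_add m2 m3 m4)
      also have "L2_norm ?M (\<lambda>z. f3 z + f4 z) \<le> L2_norm ?M f3 + L2_norm ?M f4"
        by (intro L2_norm_triangle m3 m4)
      also have "L2_norm ?M f1 = sqrt (real n) * r n / 2"
        unfolding f1_def L2_norm_cmult r_def l_def by simp
      also have "L2_norm ?M f2 = \<bar>t n * sqrt (real n) - a\<bar> / 2 * L2_norm ?M g"
        unfolding f2_def L2_norm_cmult by simp
      also have "L2_norm ?M f3 = L2_norm ?M (\<lambda>z. a * g z - w z) / 2"
        unfolding f3_def L2_norm_cmult by simp
      also have "L2_norm ?M f4 = h n"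
        unfolding f4_def L2_norm_cmult h_def by simp
      finally have "sqrt (real n) * L2_norm ?M (\<lambda>z. l z - sqrt (q n z)) \<le> \<rho>' n" by (simp add: \<rho>'_def)
      then have "(sqrt (real n) * L2_norm ?M (\<lambda>z. l z - sqrt (q n z)))\<^sup>2 \<le> (\<rho>' n)\<^sup>2" by (intro power_mono) auto
      then show ?thesis unfolding \<rho>_def by simp
    qed
    finally show ?thesis .
  qed
  ultimately show ?thesis unfolding w_def by blast
qed

text \<open>Levy continuity under the tilted law, where the limiting mean \<mu> is a covariance
  weighted by the sample fractions. The general coefficients \<open>c1\<close>, \<open>c2\<close>
  and arrays \<open>k1n\<close>, \<open>k2n\<close> cover both the statistic of the proposed test
  and the sufficient statistic of the tilted family.\<close>

lemma tilted_rejection_limit: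
  assumes k1: "L2_array P0 k1n k1" and k2: "L2_array Q0 k2n k2" and v: "arr v1n v2n v1 v2"
    and c1: "(\<lambda>n. sqrt (real n) * c1 n) \<longlonglongrightarrow> r1" and c2: "(\<lambda>n. sqrt (real n) * c2 n) \<longlonglongrightarrow> r2"
    and \<tau>: "0 < \<tau>" "\<tau>\<^sup>2 = (1 - d) * r1\<^sup>2 * (\<integral>x. (k1 x)\<^sup>2 \<partial>P0) + d * r2\<^sup>2 * (\<integral>y. (k2 y)\<^sup>2 \<partial>Q0)"
    and \<mu>: "\<mu> = (1 - d) * r1 * (\<integral>x. k1 x * v1 x \<partial>P0) + d * r2 * (\<integral>y. k2 y * v2 y \<partial>Q0)"
  defines "Y \<equiv> \<lambda>n z. c1 n * (\<Sum>i=1..n1 n. k1n n (fst z i)) + c2 n * (\<Sum>j=1..n2 n. k2n n (snd z j))"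
  shows "(\<lambda>n. \<integral>z. (if c < \<bar>Y n z\<bar> then 1 else 0) * D v1n v2n n z \<partial>S n) \<longlonglongrightarrow> two_sided_power c \<tau> \<mu>"
proof -
  note a = arrD[OF v]
  note [measurable] = L2_arrayD(1)[OF k1] L2_arrayD(1)[OF k2]
  have Ym[measurable]: "Y n \<in> borel_measurable (S n)" for n unfolding Y_def by measurable
  have Dm[measurable]: "D v1n v2n n \<in> borel_measurable (S n)" for n using sample_tilt_integrable(1)[OF v] by blast
  have Dpos: "0 \<le> D v1n v2n n z" for n z using sample_tilt_nonneg[OF v] by (rule less_imp_le)
  define Mn where "Mn n = density (S n) (D v1n v2n n)" for n
  have Mn: "prob_space (Mn n)" for n
  proof (rule prob_spaceI)
    have "emeasure (Mn n) (space (Mn n)) = (\<integral>\<^sup>+z. ennreal (D v1n v2n n z) \<partial>S n)"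
      unfolding Mn_def by (subst emeasure_density) (auto intro!: nn_integral_cong)
    also have "\<dots> = 1" using sample_tilt_integrable[OF v] Dpos by (subst nn_integral_eq_integral) auto
    finally show "emeasure (Mn n) (space (Mn n)) = 1" .
  qed
  \<comment> \<open>Standardised, so that the limit is the standard normal law whatever the
    tilt.\<close>
  define X where "X n z = (Y n z - \<mu>) / \<tau>" for n z
  have Xm[measurable]: "X n \<in> borel_measurable (S n)" for n unfolding X_def by measurable
  have Xm': "X n \<in> borel_measurable (Mn n)" for n unfolding Mn_def by measurable
  define W where "W n = distr (Mn n) borel (X n)" for n
  have rd: "real_distribution (W n)" for n
    unfolding W_def by (rule prob_space.real_distribution_distr[OF Mn Xm'])
  \<comment> \<open>Independence turns the characteristic function into powers of one-observation
    integrals under the tilt.\<close>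
  have "char (W n) u = exp (- \<i> * complex_of_real (u * \<mu> / \<tau>)) *
      ((\<integral>x. iexp (u / \<tau> * (c1 n * k1n n x)) * complex_of_real (tilt P0 n (v1n n) x) \<partial>P0) ^ n1 n *
       (\<integral>y. iexp (u / \<tau> * (c2 n * k2n n y)) * complex_of_real (tilt Q0 n (v2n n) y) \<partial>Q0) ^ n2 n)" for n u
  proof -
    have "char (W n) u = (\<integral>z. iexp (u * X n z) \<partial>Mn n)"
      unfolding W_def char_def by (subst integral_distr[OF Xm']) auto
    also have "\<dots> = (\<integral>z. D v1n v2n n z *\<^sub>R iexp (u * X n z) \<partial>S n)"
      unfolding Mn_def by (rule integral_density) (use Dpos in auto)
    also have "\<dots> = (\<integral>z. exp (- \<i> * complex_of_real (u * \<mu> / \<tau>)) *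
        ((\<Prod>i=1..n1 n. iexp (u / \<tau> * (c1 n * k1n n (fst z i))) * complex_of_real (tilt P0 n (v1n n) (fst z i))) *
         (\<Prod>j=1..n2 n. iexp (u / \<tau> * (c2 n * k2n n (snd z j))) * complex_of_real (tilt Q0 n (v2n n) (snd z j)))) \<partial>S n)"
    proof (intro Bochner_Integration.integral_cong refl)
      fix z
      have "iexp (u * X n z) = exp (- \<i> * complex_of_real (u * \<mu> / \<tau>)) * iexp (u / \<tau> * Y n z)"
        unfolding mult_exp_exp by (rule arg_cong[where f=exp]) (simp add: X_def field_simps diff_divide_distrib)
      also have "iexp (u / \<tau> * Y n z) = iexp (\<Sum>i=1..n1 n. u / \<tau> * (c1 n * k1n n (fst z i))) * iexp (\<Sum>j=1..n2 n. u / \<tau> * (c2 n * k2n n (snd z j)))"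
        unfolding mult_exp_exp by (rule arg_cong[where f=exp]) (simp add: Y_def sum_distrib_left distrib_left)
      also have "iexp (\<Sum>i=1..n1 n. u / \<tau> * (c1 n * k1n n (fst z i))) = (\<Prod>i=1..n1 n. iexp (u / \<tau> * (c1 n * k1n n (fst z i))))"
        by (simp add: exp_sum sum_distrib_left of_real_sum)
      also have "iexp (\<Sum>j=1..n2 n. u / \<tau> * (c2 n * k2n n (snd z j))) = (\<Prod>j=1..n2 n. iexp (u / \<tau> * (c2 n * k2n n (snd z j))))"
        by (simp add: exp_sum sum_distrib_left of_real_sum)
      finally show "D v1n v2n n z *\<^sub>R iexp (u * X n z) = exp (- \<i> * complex_of_real (u * \<mu> / \<tau>)) *
        ((\<Prod>i=1..n1 n. iexp (u / \<tau> * (c1 n * k1n n (fst z i))) * complex_of_real (tilt P0 n (v1n n) (fst z i))) *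
         (\<Prod>j=1..n2 n. iexp (u / \<tau> * (c2 n * k2n n (snd z j))) * complex_of_real (tilt Q0 n (v2n n) (snd z j))))"
        by (simp only: prod.distrib scaleR_conv_of_real sample_tilt_def of_real_mult of_real_prod mult_ac)
    qed
    also have "\<dots> = exp (- \<i> * complex_of_real (u * \<mu> / \<tau>)) * (\<integral>z.
        ((\<Prod>i=1..n1 n. iexp (u / \<tau> * (c1 n * k1n n (fst z i))) * complex_of_real (tilt P0 n (v1n n) (fst z i))) *
         (\<Prod>j=1..n2 n. iexp (u / \<tau> * (c2 n * k2n n (snd z j))) * complex_of_real (tilt Q0 n (v2n n) (snd z j)))) \<partial>S n)"
      by (rule integral_mult_right_zero)
    also have "(\<integral>z. ((\<Prod>i=1..n1 n. iexp (u / \<tau> * (c1 n * k1n n (fst z i))) * complex_of_real (tilt P0 n (v1n n) (fst z i))) *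
         (\<Prod>j=1..n2 n. iexp (u / \<tau> * (c2 n * k2n n (snd z j))) * complex_of_real (tilt Q0 n (v2n n) (snd z j)))) \<partial>S n) =
       (\<integral>x. iexp (u / \<tau> * (c1 n * k1n n x)) * complex_of_real (tilt P0 n (v1n n) x) \<partial>P0) ^ n1 n *
       (\<integral>y. iexp (u / \<tau> * (c2 n * k2n n y)) * complex_of_real (tilt Q0 n (v2n n) y) \<partial>Q0) ^ n2 n"
      by (rule sample_integral_prod(2)[OF M1.prob_space_axioms M2.prob_space_axioms
            M1.tilt_char_limit(1)[OF k1 a(1,2) c1 fraction1] M2.tilt_char_limit(1)[OF k2 a(3,4) c2 fraction]])
    finally show ?thesis .
  qed
  note char_eq = this
  have "(\<lambda>n. char (W n) u) \<longlonglongrightarrow> char std_normal_distribution u" for u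
  proof -
    let ?K1 = "\<integral>x. (k1 x)\<^sup>2 \<partial>P0" and ?K2 = "\<integral>y. (k2 y)\<^sup>2 \<partial>Q0"
    let ?V1 = "\<integral>x. k1 x * v1 x \<partial>P0" and ?V2 = "\<integral>y. k2 y * v2 y \<partial>Q0"
    have "(\<lambda>n. char (W n) u) \<longlonglongrightarrow> exp (- \<i> * complex_of_real (u * \<mu> / \<tau>)) *
      (exp (complex_of_real (1 - d) * (complex_of_real (- ((u / \<tau>)\<^sup>2 * r1\<^sup>2 * ?K1) / 2) + \<i> * complex_of_real (u / \<tau> * r1 * ?V1))) *
       exp (complex_of_real d * (complex_of_real (- ((u / \<tau>)\<^sup>2 * r2\<^sup>2 * ?K2) / 2) + \<i> * complex_of_real (u / \<tau> * r2 * ?V2))))"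
      unfolding char_eq
      by (intro tendsto_mult tendsto_const M1.tilt_char_limit(2)[OF k1 a(1,2) c1 fraction1] M2.tilt_char_limit(2)[OF k2 a(3,4) c2 fraction])
    also have "exp (- \<i> * complex_of_real (u * \<mu> / \<tau>)) *
      (exp (complex_of_real (1 - d) * (complex_of_real (- ((u / \<tau>)\<^sup>2 * r1\<^sup>2 * ?K1) / 2) + \<i> * complex_of_real (u / \<tau> * r1 * ?V1))) *
       exp (complex_of_real d * (complex_of_real (- ((u / \<tau>)\<^sup>2 * r2\<^sup>2 * ?K2) / 2) + \<i> * complex_of_real (u / \<tau> * r2 * ?V2)))) =
       exp (complex_of_real (- (u\<^sup>2) / 2))"
      unfolding mult_exp_exp
    proof (rule arg_cong[where f=exp])
      have re: "(1 - d) * (- ((u / \<tau>)\<^sup>2 * r1\<^sup>2 * ?K1) / 2) + d * (- ((u / \<tau>)\<^sup>2 * r2\<^sup>2 * ?K2) / 2) = - (u\<^sup>2) / 2"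
      proof -
        have "(1 - d) * (- ((u / \<tau>)\<^sup>2 * r1\<^sup>2 * ?K1) / 2) + d * (- ((u / \<tau>)\<^sup>2 * r2\<^sup>2 * ?K2) / 2) = - ((u / \<tau>)\<^sup>2 * \<tau>\<^sup>2) / 2"
          unfolding \<tau>(2) by (simp add: algebra_simps add_divide_distrib diff_divide_distrib)
        also have "\<dots> = - (u\<^sup>2) / 2" using \<tau>(1) by (simp add: power_divide)
        finally show ?thesis .
      qed
      have im: "- (u * \<mu> / \<tau>) + ((1 - d) * (u / \<tau> * r1 * ?V1) + d * (u / \<tau> * r2 * ?V2)) = 0"
        unfolding \<mu> using \<tau>(1) by (simp add: field_simps)
      show "- \<i> * complex_of_real (u * \<mu> / \<tau>) +
        (complex_of_real (1 - d) * (complex_of_real (- ((u / \<tau>)\<^sup>2 * r1\<^sup>2 * ?K1) / 2) + \<i> * complex_of_real (u / \<tau> * r1 * ?V1)) +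
        complex_of_real d * (complex_of_real (- ((u / \<tau>)\<^sup>2 * r2\<^sup>2 * ?K2) / 2) + \<i> * complex_of_real (u / \<tau> * r2 * ?V2))) =
        complex_of_real (- (u\<^sup>2) / 2)"
        using re im by (simp only: complex_eq_iff) (simp del: of_real_mult of_real_divide)
    qed
    finally show ?thesis unfolding char_std_normal_distribution exp_of_real .
  qed
  then have wc: "weak_conv_m W std_normal_distribution"
    by (rule levy_continuity[OF rd real_dist_normal_dist])
  let ?A = "{x. c < \<bar>\<mu> + \<tau> * x\<bar>}"
  have Ab: "?A \<in> sets borel" by measurable
  \<comment> \<open>The boundary of the rejection region consists of at most two points, which the
    normal law does not charge.\<close>
  have fr: "emeasure std_normal_distribution (frontier ?A) = 0"
  proof -
    have "open ?A" by (intro open_Collect_less continuous_intros)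
    moreover have "closure ?A \<subseteq> {x. c \<le> \<bar>\<mu> + \<tau> * x\<bar>}"
      by (rule closure_minimal) (auto intro!: closed_Collect_le continuous_intros)
    ultimately have "frontier ?A \<subseteq> {x. c = \<bar>\<mu> + \<tau> * x\<bar>}" by (auto simp: frontier_def interior_open)
    also have "\<dots> \<subseteq> {(c - \<mu>) / \<tau>, (- c - \<mu>) / \<tau>}" using \<tau>(1) by (auto simp: field_simps abs_if split: if_splits)
    finally have sub: "frontier ?A \<subseteq> {(c - \<mu>) / \<tau>, (- c - \<mu>) / \<tau>}" .
    have "emeasure std_normal_distribution {x} = 0" for x
    proof -
      interpret N: real_distribution std_normal_distribution by (rule real_dist_normal_dist)
      show ?thesis using std_normal_singleton[of x] by (simp add: N.emeasure_eq_measure)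
    qed
    then have n: "{x} \<in> null_sets std_normal_distribution" for x by (intro null_setsI) auto
    have "{(c - \<mu>) / \<tau>, (- c - \<mu>) / \<tau>} \<in> null_sets std_normal_distribution"
      by (rule null_sets.insert_in_sets[OF n n])
    moreover have "frontier ?A \<in> sets std_normal_distribution" by (simp add: borel_closed)
    ultimately show ?thesis using sub null_sets_subset by blast
  qed
  have "(\<lambda>n. measure (W n) ?A) \<longlonglongrightarrow> measure std_normal_distribution ?A"
    by (rule weak_conv_imp_continuity_set_conv[OF rd real_dist_normal_dist wc Ab fr])
  moreover have "measure (W n) ?A = (\<integral>z. (if c < \<bar>Y n z\<bar> then 1 else 0) * D v1n v2n n z \<partial>S n)" for n
  proof -
    interpret Mn: prob_space "Mn n" by (rule Mn)
    have eq: "(\<mu> + \<tau> * X n z) = Y n z" for z using \<tau>(1) by (simp add: X_def)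
    have "measure (W n) ?A = measure (Mn n) {z \<in> space (Mn n). c < \<bar>Y n z\<bar>}"
    proof -
      have "X n -` ?A \<inter> space (Mn n) = {z \<in> space (Mn n). c < \<bar>Y n z\<bar>}" by (auto simp: eq)
      then show ?thesis unfolding W_def measure_distr[OF Xm' Ab] by simp
    qed
    also have "\<dots> = (\<integral>z. indicator {z \<in> space (Mn n). c < \<bar>Y n z\<bar>} z \<partial>Mn n)"
      unfolding Bochner_Integration.integral_indicator by (rule arg_cong[where f="measure (Mn n)"]) auto
    also have "\<dots> = (\<integral>z. (if c < \<bar>Y n z\<bar> then 1 else 0) \<partial>Mn n)"
      by (intro Bochner_Integration.integral_cong) (auto simp: indicator_def)
    also have "\<dots> = (\<integral>z. D v1n v2n n z *\<^sub>R (if c < \<bar>Y n z\<bar> then 1 else 0) \<partial>S n)"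
      unfolding Mn_def by (rule integral_density) (use Dpos in auto)
    finally show ?thesis by (simp add: mult.commute)
  qed
  ultimately show ?thesis by (simp add: two_sided_power_def)
qed

end

section \<open>The two-sided Neyman-Pearson bound\<close>

text \<open>\<open>B\<close> is determined by \<open>h (- c) = h c\<close>, that is
  \<open>sinh (s * c) = B * sinh (\<epsilon> * (s * c))\<close>, and is positive because both
  arguments have the sign of \<open>s\<close>. Convexity then places the values of \<open>h\<close>
  on \<open>[-c, c]\<close> below, and those outside above, the common value at the end
  points.\<close>

lemma two_sided_exp_combination:
  fixes s c \<epsilon> :: real
  assumes c: "0 < c" and s: "s \<noteq> 0" and \<epsilon>: "0 < \<epsilon>"
  defines "B \<equiv> sinh (s * c) / sinh (\<epsilon> * (s * c))"
  defines "h \<equiv> \<lambda>x. exp (s * x) + B * exp (- (\<epsilon> * s) * x)"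
  shows "0 < B" "0 < h c" "\<bar>x\<bar> \<le> c \<Longrightarrow> h x \<le> h c" "c < \<bar>x\<bar> \<Longrightarrow> h c \<le> h x"
proof -
  have sgn: "s * c > 0 \<longleftrightarrow> s > 0" "s * c < 0 \<longleftrightarrow> s < 0" using c by (auto simp: zero_less_mult_iff mult_less_0_iff)
  show B: "0 < B"
    unfolding B_def using s c \<epsilon>
    by (cases "s > 0") (auto simp: zero_less_divide_iff zero_less_mult_iff mult_less_0_iff)
  then show "0 < h c" unfolding h_def by (simp add: add_pos_pos)
  have ne: "sinh (\<epsilon> * (s * c)) \<noteq> 0" using s c \<epsilon> by simp
  have sym: "h (- c) = h c"
  proof -
    have "h c - h (- c) = (exp (s * c) - exp (- (s * c))) - B * (exp (\<epsilon> * (s * c)) - exp (- (\<epsilon> * (s * c))))"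
      unfolding h_def by (simp add: algebra_simps)
    also have "\<dots> = 2 * sinh (s * c) - B * (2 * sinh (\<epsilon> * (s * c)))" by (simp add: sinh_field_def diff_divide_distrib right_diff_distrib)
    also have "\<dots> = 0" unfolding B_def using ne by simp
    finally show ?thesis by simp
  qed
  have conv: "convex_on UNIV h"
  proof (rule f''_ge0_imp_convex)
    show "(h has_real_derivative s * exp (s * x) + B * (- (\<epsilon> * s) * exp (- (\<epsilon> * s) * x))) (at x)" for x
      unfolding h_def by (auto intro!: derivative_eq_intros simp: algebra_simps)
    show "((\<lambda>x. s * exp (s * x) + B * (- (\<epsilon> * s) * exp (- (\<epsilon> * s) * x))) has_real_derivative
        s * (s * exp (s * x)) + B * (- (\<epsilon> * s) * (- (\<epsilon> * s) * exp (- (\<epsilon> * s) * x)))) (at x)" for x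
      by (auto intro!: derivative_eq_intros simp: algebra_simps)
    have "s * (s * exp (s * x)) + B * (- (\<epsilon> * s) * (- (\<epsilon> * s) * exp (- (\<epsilon> * s) * x))) =
        s\<^sup>2 * exp (s * x) + B * ((\<epsilon> * s)\<^sup>2 * exp (- (\<epsilon> * s) * x))" for x
      by (simp add: power2_eq_square)
    then show "0 \<le> s * (s * exp (s * x)) + B * (- (\<epsilon> * s) * (- (\<epsilon> * s) * exp (- (\<epsilon> * s) * x)))" for x
      using B by (simp only:) (intro add_nonneg_nonneg mult_nonneg_nonneg, auto)
  qed auto
  have comb: "h ((1 - t) * x + t * y) \<le> (1 - t) * h x + t * h y" if "0 \<le> t" "t \<le> 1" for t x y
    using convex_onD[OF conv that, of x y] by simp
  show "h x \<le> h c" if "\<bar>x\<bar> \<le> c"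
  proof -
    \<comment> \<open>Weight of \<open>x\<close> as a convex combination of \<open>- c\<close> and
      \<open>c\<close>.\<close>
    define t where "t = (x + c) / (2 * c)"
    have t: "0 \<le> t" "t \<le> 1" "(1 - t) * (- c) + t * c = x" using that c by (auto simp: t_def field_simps)
    have "h x \<le> (1 - t) * h (- c) + t * h c" using comb[OF t(1,2), of "- c" c] t(3) by simp
    then show ?thesis by (simp add: sym algebra_simps)
  qed
  show "h c \<le> h x" if "c < \<bar>x\<bar>"
  proof (cases "x > 0")
    case True
    \<comment> \<open>Here \<open>c\<close> lies between \<open>- c\<close> and \<open>x\<close>;
      convexity bounds \<open>h c\<close> by a mixture of \<open>h (- c) = h c\<close> and
      \<open>h x\<close>, and cancelling the first part leaves the claim.\<close>
    define t where "t = 2 * c / (x + c)"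
    have "t * (x + c) = 2 * c" using c True by (simp add: t_def)
    then have t: "0 < t" "t \<le> 1" "(1 - t) * (- c) + t * x = c"
      using that c True by (auto simp: t_def[symmetric] algebra_simps) (auto simp: t_def)
    have "h c \<le> (1 - t) * h c + t * h x" using comb[of t "- c" x] t sym by simp
    then have "t * h c \<le> t * h x" by (simp add: algebra_simps)
    then show ?thesis using t(1) by simp
  next
    case False
    define t where "t = 2 * c / (c - x)"
    have "t * (c - x) = 2 * c" using c False by (simp add: t_def)
    then have t: "0 < t" "t \<le> 1" "(1 - t) * c + t * x = - c"
      using that c False by (auto simp: t_def[symmetric] algebra_simps) (auto simp: t_def)
    have "h c \<le> (1 - t) * h c + t * h x" using comb[of t c x] t sym by simp
    then have "t * h c \<le> t * h x" by (simp add: algebra_simps)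
    then show ?thesis using t(1) by simp
  qed
qed

text \<open>The normalisers are real but may exceed 1, so the comparison in the unit disc does not
  apply; the logarithm is squeezed by \<open>1 - 1 / z <= ln z <= z - 1\<close> instead.\<close>

lemma power_limit_exp_real:
  assumes Z: "Z \<longlonglongrightarrow> 1" "\<And>n. 0 < Z n" and lim: "(\<lambda>n. real n * (Z n - 1)) \<longlonglongrightarrow> w"
    and N: "(\<lambda>n. real (N n) / real n) \<longlonglongrightarrow> p"
  shows "(\<lambda>n. Z n ^ N n) \<longlonglongrightarrow> exp (p * w)"
proof -
  have ln: "(\<lambda>n. real n * ln (Z n)) \<longlonglongrightarrow> w"
  proof (rule tendsto_sandwich)
    show "(\<lambda>n. real n * (Z n - 1) / Z n) \<longlonglongrightarrow> w"
      using tendsto_divide[OF lim Z(1)] by simp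
    show "\<forall>\<^sub>F n in sequentially. real n * (Z n - 1) / Z n \<le> real n * ln (Z n)"
    proof (rule always_eventually, rule allI)
      fix n
      have "ln (1 / Z n) \<le> 1 / Z n - 1" using Z(2)[of n] by (intro ln_le_minus_one) simp
      then have "(Z n - 1) / Z n \<le> ln (Z n)" using Z(2)[of n] by (simp add: ln_div diff_divide_distrib)
      then show "real n * (Z n - 1) / Z n \<le> real n * ln (Z n)"
        unfolding times_divide_eq_right[symmetric] by (rule mult_left_mono) simp
    qed
    show "\<forall>\<^sub>F n in sequentially. real n * ln (Z n) \<le> real n * (Z n - 1)"
      using Z(2) by (auto intro!: always_eventually mult_left_mono ln_le_minus_one)
  qed (rule lim)
  show ?thesis
  proof (rule Lim_transform_eventually)
    show "(\<lambda>n. exp (real (N n) / real n * (real n * ln (Z n)))) \<longlonglongrightarrow> exp (p * w)"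
      by (intro tendsto_exp tendsto_mult N ln)
    show "\<forall>\<^sub>F n in sequentially. exp (real (N n) / real n * (real n * ln (Z n))) = Z n ^ N n"
      using eventually_gt_at_top[of 0]
    proof eventually_elim
      case (elim n)
      then have "exp (real (N n) / real n * (real n * ln (Z n))) = exp (real (N n) * ln (Z n))" by simp
      also have "\<dots> = Z n ^ N n" using Z(2)[of n] by (simp add: exp_of_nat_mult)
      finally show ?case .
    qed
  qed
qed

section \<open>Neyman-Pearson inequality in a tilted family and its limit\<close>

context two_sample
begin

text \<open>The factor that turns the tilted sample density into a pure exponential of a
  sum.\<close>

definition normalizer :: "(nat \<Rightarrow> 'a \<Rightarrow> real) \<Rightarrow> (nat \<Rightarrow> 'b \<Rightarrow> real) \<Rightarrow> nat \<Rightarrow> real" where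
  "normalizer v1n v2n n = (\<integral>x. exp (v1n n x / sqrt (real n)) \<partial>P0) ^ n1 n * (\<integral>y. exp (v2n n y / sqrt (real n)) \<partial>Q0) ^ n2 n"

lemma normalizer_pos:
  assumes v: "arr v1n v2n v1 v2" shows "0 < normalizer v1n v2n n"
proof -
  obtain c1 where c1: "c1 > 0" "\<And>n. c1 \<le> (\<integral>x. exp (v1n n x / sqrt (real n)) \<partial>P0)"
    using M1.tilt_normalizer(2)[OF arrD(1,2)[OF v]] by blast
  obtain c2 where c2: "c2 > 0" "\<And>n. c2 \<le> (\<integral>x. exp (v2n n x / sqrt (real n)) \<partial>Q0)"
    using M2.tilt_normalizer(2)[OF arrD(3,4)[OF v]] by blast
  have "0 < (\<integral>x. exp (v1n n x / sqrt (real n)) \<partial>P0)" "0 < (\<integral>x. exp (v2n n x / sqrt (real n)) \<partial>Q0)"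
    using c1 c2 by (auto intro: less_le_trans)
  then show ?thesis unfolding normalizer_def by (intro mult_pos_pos zero_less_power) auto
qed

lemma normalizer_limit:
  assumes v: "arr v1n v2n v1 v2"
  shows "normalizer v1n v2n \<longlonglongrightarrow> exp (((1 - d) * (\<integral>x. (v1 x)\<^sup>2 \<partial>P0) + d * (\<integral>y. (v2 y)\<^sup>2 \<partial>Q0)) / 2)"
proof -
  note a = arrD[OF v]
  obtain c1 where c1: "c1 > 0" "\<And>n. c1 \<le> (\<integral>x. exp (v1n n x / sqrt (real n)) \<partial>P0)"
    using M1.tilt_normalizer(2)[OF a(1,2)] by blast
  obtain c2 where c2: "c2 > 0" "\<And>n. c2 \<le> (\<integral>x. exp (v2n n x / sqrt (real n)) \<partial>Q0)"
    using M2.tilt_normalizer(2)[OF a(3,4)] by blast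
  have 1: "(\<lambda>n. (\<integral>x. exp (v1n n x / sqrt (real n)) \<partial>P0) ^ n1 n) \<longlonglongrightarrow> exp ((1 - d) * ((\<integral>x. (v1 x)\<^sup>2 \<partial>P0) / 2))"
    by (rule power_limit_exp_real[OF M1.tilt_normalizer_limits(1)[OF a(1,2)] less_le_trans[OF c1]
          M1.tilt_normalizer(3)[OF a(1,2)] fraction1])
  have 2: "(\<lambda>n. (\<integral>x. exp (v2n n x / sqrt (real n)) \<partial>Q0) ^ n2 n) \<longlonglongrightarrow> exp (d * ((\<integral>x. (v2 x)\<^sup>2 \<partial>Q0) / 2))"
    by (rule power_limit_exp_real[OF M2.tilt_normalizer_limits(1)[OF a(3,4)] less_le_trans[OF c2]
          M2.tilt_normalizer(3)[OF a(3,4)] fraction])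
  have "normalizer v1n v2n \<longlonglongrightarrow> exp ((1 - d) * ((\<integral>x. (v1 x)\<^sup>2 \<partial>P0) / 2)) * exp (d * ((\<integral>x. (v2 x)\<^sup>2 \<partial>Q0) / 2))"
    unfolding normalizer_def[abs_def] by (rule tendsto_mult[OF 1 2])
  then show ?thesis by (simp add: exp_add[symmetric] add_divide_distrib)
qed

lemma sample_tilt_normalizer:
  assumes v: "arr v1n v2n v1 v2"
  shows "D v1n v2n n z * normalizer v1n v2n n =
    exp (((\<Sum>i=1..n1 n. v1n n (fst z i)) + (\<Sum>j=1..n2 n. v2n n (snd z j))) / sqrt (real n))"
proof -
  have "normalizer v1n v2n n \<noteq> 0" using normalizer_pos[OF v, of n] by simp
  then show ?thesis
    unfolding sample_tilt_def normalizer_def tilt_def prod_dividef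
    by (simp add: exp_sum[symmetric] sum_divide_distrib[symmetric] exp_add add_divide_distrib)
qed

text \<open>The difference of the two-sided test and \<phi> nowhere has the sign opposite to
  \<open>exp (s X) + B exp (- \<epsilon> s X) - A\<close>, where \<open>A\<close> is the common
  value of the combination at \<open>X = c\<close> and \<open>X = - c\<close>. The normalisers
  \<zeta> appear as weights, since the densities are exponentials of \<open>r X\<close> only up to
  them.\<close>

lemma two_sided_Neyman_Pearson:
  assumes b: "arr b1n b2n b1 b2" and k: "arr k1n k2n k1 k2"
    and c: "0 < c" and s: "s \<noteq> 0" and \<epsilon>: "0 < \<epsilon>"
    and \<phi>: "\<phi> \<in> borel_measurable (S n)" "\<And>z. z \<in> space (S n) \<Longrightarrow> 0 \<le> \<phi> z \<and> \<phi> z \<le> 1"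
  defines "X \<equiv> \<lambda>z. 1 / sqrt (real n) * (\<Sum>i=1..n1 n. k1n n (fst z i)) + 1 / sqrt (real n) * (\<Sum>j=1..n2 n. k2n n (snd z j))"
  defines "B \<equiv> sinh (s * c) / sinh (\<epsilon> * (s * c))"
  defines "A \<equiv> exp (s * c) + B * exp (- (\<epsilon> * s) * c)"
  defines "Dr \<equiv> \<lambda>r. D (\<lambda>n x. b1n n x + r * k1n n x) (\<lambda>n y. b2n n y + r * k2n n y) n"
    and "\<zeta> \<equiv> \<lambda>r. normalizer (\<lambda>n x. b1n n x + r * k1n n x) (\<lambda>n y. b2n n y + r * k2n n y) n"
  defines "\<Psi> \<equiv> \<lambda>r. \<integral>z. (if c < \<bar>X z\<bar> then 1 else 0) * Dr r z \<partial>S n" and "E \<equiv> \<lambda>r. \<integral>z. \<phi> z * Dr r z \<partial>S n"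
  shows "0 \<le> \<zeta> s * (\<Psi> s - E s) + B * (\<zeta> (- (\<epsilon> * s)) * (\<Psi> (- (\<epsilon> * s)) - E (- (\<epsilon> * s)))) - A * (\<zeta> 0 * (\<Psi> 0 - E 0))"
proof -
  note ar = arr_add[OF b k]
  note [measurable] = L2_arrayD(1)[OF arrD(1)[OF k]] L2_arrayD(1)[OF arrD(3)[OF k]] \<phi>(1)
  have [measurable]: "X \<in> borel_measurable (S n)" unfolding X_def by measurable
  define \<delta> where "\<delta> z = (if c < \<bar>X z\<bar> then 1 else 0) - \<phi> z" for z
  have [measurable]: "\<delta> \<in> borel_measurable (S n)" unfolding \<delta>_def[abs_def] by measurable
  have iD: "integrable (S n) (Dr r)" for r unfolding Dr_def by (rule sample_tilt_integrable(1)[OF ar])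
  note [measurable] = borel_measurable_integrable[OF iD]
  have D0: "0 \<le> Dr r z" for r z unfolding Dr_def using sample_tilt_nonneg[OF ar] by (rule less_imp_le)
  have i\<phi>: "integrable (S n) (\<lambda>z. \<phi> z * Dr r z)" for r
    by (rule Bochner_Integration.integrable_bound[OF iD[of r]]) (use \<phi>(2) D0[of r] in \<open>auto intro!: AE_I2 mult_left_le_one_le simp: abs_mult\<close>)
  have i\<psi>: "integrable (S n) (\<lambda>z. (if c < \<bar>X z\<bar> then 1 else 0) * Dr r z)" for r
    by (rule Bochner_Integration.integrable_bound[OF iD[of r]]) auto
  have I: "(\<integral>z. \<delta> z * Dr r z \<partial>S n) = \<Psi> r - E r" and i\<delta>: "integrable (S n) (\<lambda>z. \<delta> z * Dr r z)" for r
    unfolding \<Psi>_def E_def \<delta>_def left_diff_distrib using i\<phi>[of r] i\<psi>[of r] by simp_all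
  \<comment> \<open>For every sample size the densities form an exact exponential family in
    \<open>r\<close> with statistic \<open>X\<close>; there is no remainder to control.\<close>
  have rel: "\<zeta> r * Dr r z = \<zeta> 0 * Dr 0 z * exp (r * X z)" for r z
  proof -
    have "\<zeta> r * Dr r z = exp (((\<Sum>i=1..n1 n. b1n n (fst z i) + r * k1n n (fst z i)) + (\<Sum>j=1..n2 n. b2n n (snd z j) + r * k2n n (snd z j))) / sqrt (real n))" for r
      unfolding \<zeta>_def Dr_def using sample_tilt_normalizer[OF ar, of r n z] by (simp add: mult.commute)
    note e = this
    show ?thesis unfolding e exp_add[symmetric] mult_exp_exp
      by (rule arg_cong[where f=exp]) (simp add: X_def sum.distrib sum_distrib_left[symmetric] add_divide_distrib algebra_simps)
  qed
  have \<zeta>0: "0 \<le> \<zeta> 0" unfolding \<zeta>_def using normalizer_pos[OF ar] by (rule less_imp_le)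
  have "0 \<le> (\<integral>z. \<zeta> s * (\<delta> z * Dr s z) + B * (\<zeta> (- (\<epsilon> * s)) * (\<delta> z * Dr (- (\<epsilon> * s)) z)) - A * (\<zeta> 0 * (\<delta> z * Dr 0 z)) \<partial>S n)"
  proof (intro integral_nonneg_AE AE_I2)
    fix z assume z: "z \<in> space (S n)"
    note cmb = two_sided_exp_combination[OF c s \<epsilon>, folded B_def]
    have "\<zeta> s * (\<delta> z * Dr s z) + B * (\<zeta> (- (\<epsilon> * s)) * (\<delta> z * Dr (- (\<epsilon> * s)) z)) - A * (\<zeta> 0 * (\<delta> z * Dr 0 z)) =
       \<delta> z * (\<zeta> s * Dr s z) + B * (\<delta> z * (\<zeta> (- (\<epsilon> * s)) * Dr (- (\<epsilon> * s)) z)) - A * (\<zeta> 0 * (\<delta> z * Dr 0 z))"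
      by (simp add: mult_ac)
    also have "\<dots> = (\<zeta> 0 * Dr 0 z) * (\<delta> z * (exp (s * X z) + B * exp (- (\<epsilon> * s) * X z) - A))"
      unfolding rel[of s z] rel[of "- (\<epsilon> * s)" z] by (simp add: algebra_simps)
    also have "\<dots> \<ge> 0"
    proof (rule mult_nonneg_nonneg)
      show "0 \<le> \<zeta> 0 * Dr 0 z" by (rule mult_nonneg_nonneg[OF \<zeta>0 D0])
      show "0 \<le> \<delta> z * (exp (s * X z) + B * exp (- (\<epsilon> * s) * X z) - A)"
      proof (cases "c < \<bar>X z\<bar>")
        case True
        then show ?thesis using cmb(4)[OF True] \<phi>(2)[OF z] unfolding \<delta>_def A_def
          by (intro mult_nonneg_nonneg) auto
      next
        case False
        then show ?thesis using cmb(3)[of "X z"] \<phi>(2)[OF z] unfolding \<delta>_def A_def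
          by (intro mult_nonpos_nonpos) auto
      qed
    qed
    finally show "0 \<le> \<zeta> s * (\<delta> z * Dr s z) + B * (\<zeta> (- (\<epsilon> * s)) * (\<delta> z * Dr (- (\<epsilon> * s)) z)) - A * (\<zeta> 0 * (\<delta> z * Dr 0 z))" .
  qed
  also have "\<dots> = \<zeta> s * (\<Psi> s - E s) + B * (\<zeta> (- (\<epsilon> * s)) * (\<Psi> (- (\<epsilon> * s)) - E (- (\<epsilon> * s)))) - A * (\<zeta> 0 * (\<Psi> 0 - E 0))"
    using i\<delta> by (simp add: I)
  finally show ?thesis .
qed

text \<open>Orthogonality of \<open>b\<close> and \<open>k\<close> makes the limit of the normaliser
  at \<open>r\<close> depend on \<open>r^2\<close> only, and centres the statistic at
  \<open>b\<close>, so that its limiting mean at \<open>r\<close> is \<open>r \<tau>^2\<close>. For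
  fixed \<epsilon> the Neyman-Pearson inequality can then be passed to the limit in n.\<close>

lemma asymptotic_two_sided_bound:
  assumes b: "arr b1n b2n b1 b2" and k: "arr k1n k2n k1 k2"
    and c: "0 < c" and s: "s \<noteq> 0"
    and \<tau>: "0 < \<tau>" "\<tau>\<^sup>2 = (1 - d) * (\<integral>x. (k1 x)\<^sup>2 \<partial>P0) + d * (\<integral>y. (k2 y)\<^sup>2 \<partial>Q0)"
    and orth: "(1 - d) * (\<integral>x. k1 x * b1 x \<partial>P0) + d * (\<integral>y. k2 y * b2 y \<partial>Q0) = 0"
    and \<phi>: "\<And>n. \<phi> n \<in> borel_measurable (S n)" "\<And>n z. z \<in> space (S n) \<Longrightarrow> 0 \<le> \<phi> n z \<and> \<phi> n z \<le> 1"
  defines "E \<equiv> \<lambda>r n. \<integral>z. \<phi> n z * D (\<lambda>n x. b1n n x + r * k1n n x) (\<lambda>n y. b2n n y + r * k2n n y) n z \<partial>S n"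
  assumes level: "\<And>\<eta>. 0 < \<eta> \<Longrightarrow> \<forall>\<^sub>F n in sequentially. E 0 n \<le> two_sided_power c \<tau> 0 + \<eta>"
    and unbiased: "\<And>\<epsilon> \<eta>. 0 < \<epsilon> \<Longrightarrow> 0 < \<eta> \<Longrightarrow> \<forall>\<^sub>F n in sequentially. two_sided_power c \<tau> 0 - \<eta> \<le> E (- (\<epsilon> * s)) n"
    and \<eta>: "0 < \<eta>"
  shows "\<forall>\<^sub>F n in sequentially. E s n \<le> two_sided_power c \<tau> (s * \<tau>\<^sup>2) + \<eta>"
proof -
  note ar = arr_add[OF b k]
  note L2 = L2_arrayD(3)[OF arrD(1)[OF b]] L2_arrayD(3)[OF arrD(1)[OF k]] L2_arrayD(3)[OF arrD(3)[OF b]] L2_arrayD(3)[OF arrD(3)[OF k]]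
  define \<zeta> where "\<zeta> r = normalizer (\<lambda>n x. b1n n x + r * k1n n x) (\<lambda>n y. b2n n y + r * k2n n y)" for r
  define X where "X n z = 1 / sqrt (real n) * (\<Sum>i=1..n1 n. k1n n (fst z i)) + 1 / sqrt (real n) * (\<Sum>j=1..n2 n. k2n n (snd z j))" for n z
  define \<Psi> where "\<Psi> r n = (\<integral>z. (if c < \<bar>X n z\<bar> then 1 else 0) *
      D (\<lambda>n x. b1n n x + r * k1n n x) (\<lambda>n y. b2n n y + r * k2n n y) n z \<partial>S n)" for r n
  define g where "g = two_sided_power c \<tau>"
  define q where "q = (1 - d) * (\<integral>x. (b1 x)\<^sup>2 \<partial>P0) + d * (\<integral>y. (b2 y)\<^sup>2 \<partial>Q0)"
  define l where "l r = exp ((q + r\<^sup>2 * \<tau>\<^sup>2) / 2)" for r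
  have \<zeta>pos: "0 < \<zeta> r n" for r n unfolding \<zeta>_def by (rule normalizer_pos[OF ar])
  have lpos: "0 < l r" for r by (simp add: l_def)
  have \<zeta>lim: "\<zeta> r \<longlonglongrightarrow> l r" for r
  proof -
    have "(\<integral>x. (b1 x + r * k1 x)\<^sup>2 \<partial>P0) = (\<integral>x. (b1 x)\<^sup>2 + (2 * r * (k1 x * b1 x) + r\<^sup>2 * (k1 x)\<^sup>2) \<partial>P0)"
      by (intro Bochner_Integration.integral_cong) (auto simp: power2_eq_square algebra_simps)
    also have "\<dots> = (\<integral>x. (b1 x)\<^sup>2 \<partial>P0) + (2 * r * (\<integral>x. k1 x * b1 x \<partial>P0) + r\<^sup>2 * (\<integral>x. (k1 x)\<^sup>2 \<partial>P0))"
      using L2_spaceD(2)[OF L2(1)] L2_spaceD(2)[OF L2(2)] L2_integrable_mult[OF L2(2,1)] by simp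
    finally have e1: "(\<integral>x. (b1 x + r * k1 x)\<^sup>2 \<partial>P0) = \<dots>" .
    have "(\<integral>x. (b2 x + r * k2 x)\<^sup>2 \<partial>Q0) = (\<integral>x. (b2 x)\<^sup>2 + (2 * r * (k2 x * b2 x) + r\<^sup>2 * (k2 x)\<^sup>2) \<partial>Q0)"
      by (intro Bochner_Integration.integral_cong) (auto simp: power2_eq_square algebra_simps)
    also have "\<dots> = (\<integral>x. (b2 x)\<^sup>2 \<partial>Q0) + (2 * r * (\<integral>x. k2 x * b2 x \<partial>Q0) + r\<^sup>2 * (\<integral>x. (k2 x)\<^sup>2 \<partial>Q0))"
      using L2_spaceD(2)[OF L2(3)] L2_spaceD(2)[OF L2(4)] L2_integrable_mult[OF L2(4,3)] by simp
    finally have e2: "(\<integral>x. (b2 x + r * k2 x)\<^sup>2 \<partial>Q0) = \<dots>" .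
    have "(1 - d) * (\<integral>x. (b1 x + r * k1 x)\<^sup>2 \<partial>P0) + d * (\<integral>x. (b2 x + r * k2 x)\<^sup>2 \<partial>Q0) =
      q + 2 * r * ((1 - d) * (\<integral>x. k1 x * b1 x \<partial>P0) + d * (\<integral>y. k2 y * b2 y \<partial>Q0)) + r\<^sup>2 * \<tau>\<^sup>2"
      unfolding e1 e2 \<tau>(2) q_def by (simp add: algebra_simps)
    then show ?thesis using normalizer_limit[OF ar, of r] unfolding \<zeta>_def l_def orth by simp
  qed
  have root: "(\<lambda>n. sqrt (real n) * (1 / sqrt (real n))) \<longlonglongrightarrow> 1"
    by (rule tendsto_eventually) (use eventually_gt_at_top[of 0] in eventually_elim, simp)
  have \<Psi>lim: "\<Psi> r \<longlonglongrightarrow> g (r * \<tau>\<^sup>2)" for r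
    unfolding \<Psi>_def X_def g_def
  proof (rule tilted_rejection_limit[OF arrD(1)[OF k] arrD(3)[OF k] ar root root \<tau>(1)])
    show "\<tau>\<^sup>2 = (1 - d) * 1\<^sup>2 * (\<integral>x. (k1 x)\<^sup>2 \<partial>P0) + d * 1\<^sup>2 * (\<integral>y. (k2 y)\<^sup>2 \<partial>Q0)" using \<tau>(2) by simp
    have "(\<integral>x. k1 x * (b1 x + r * k1 x) \<partial>P0) = (\<integral>x. k1 x * b1 x + r * (k1 x)\<^sup>2 \<partial>P0)"
      by (intro Bochner_Integration.integral_cong) (auto simp: power2_eq_square algebra_simps)
    then have e1: "(\<integral>x. k1 x * (b1 x + r * k1 x) \<partial>P0) = (\<integral>x. k1 x * b1 x \<partial>P0) + r * (\<integral>x. (k1 x)\<^sup>2 \<partial>P0)"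
      using L2_spaceD(2)[OF L2(2)] L2_integrable_mult[OF L2(2,1)] by simp
    have "(\<integral>x. k2 x * (b2 x + r * k2 x) \<partial>Q0) = (\<integral>x. k2 x * b2 x + r * (k2 x)\<^sup>2 \<partial>Q0)"
      by (intro Bochner_Integration.integral_cong) (auto simp: power2_eq_square algebra_simps)
    then have e2: "(\<integral>x. k2 x * (b2 x + r * k2 x) \<partial>Q0) = (\<integral>x. k2 x * b2 x \<partial>Q0) + r * (\<integral>x. (k2 x)\<^sup>2 \<partial>Q0)"
      using L2_spaceD(2)[OF L2(4)] L2_integrable_mult[OF L2(4,3)] by simp
    have "(1 - d) * (\<integral>x. k1 x * (b1 x + r * k1 x) \<partial>P0) + d * (\<integral>y. k2 y * (b2 y + r * k2 y) \<partial>Q0) =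
      ((1 - d) * (\<integral>x. k1 x * b1 x \<partial>P0) + d * (\<integral>y. k2 y * b2 y \<partial>Q0)) + r * \<tau>\<^sup>2"
      unfolding e1 e2 \<tau>(2) by (simp add: algebra_simps)
    then show "r * \<tau>\<^sup>2 = (1 - d) * 1 * (\<integral>x. k1 x * (b1 x + r * k1 x) \<partial>P0) + d * 1 * (\<integral>y. k2 y * (b2 y + r * k2 y) \<partial>Q0)"
      unfolding orth by simp
  qed
  define B where "B \<epsilon> = sinh (s * c) / sinh (\<epsilon> * (s * c))" for \<epsilon>
  define A where "A \<epsilon> = exp (s * c) + B \<epsilon> * exp (- (\<epsilon> * s) * c)" for \<epsilon>
  have NP: "0 \<le> \<zeta> s n * (\<Psi> s n - E s n) + B \<epsilon> * (\<zeta> (- (\<epsilon> * s)) n * (\<Psi> (- (\<epsilon> * s)) n - E (- (\<epsilon> * s)) n)) - A \<epsilon> * (\<zeta> 0 n * (\<Psi> 0 n - E 0 n))"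
    if "0 < \<epsilon>" for \<epsilon> n
    using two_sided_Neyman_Pearson[OF b k c s that \<phi>(1)[of n] \<phi>(2)[of _ n]]
    unfolding \<zeta>_def \<Psi>_def X_def E_def B_def A_def by blast
  \<comment> \<open>The loss caused by comparing at \<open>- \<epsilon> s\<close>: a multiplier of
    order 1 / \<epsilon> times an excess power of o(\<epsilon>). It selects \<epsilon> before n is
    sent to infinity.\<close>
  have "((\<lambda>\<epsilon>. sinh (s * c) * l (- (\<epsilon> * s)) / l s * ((g (\<epsilon> * - (s * \<tau>\<^sup>2)) - g 0) / sinh (\<epsilon> * (s * c)))) \<longlongrightarrow>
      sinh (s * c) * l (- (0 * s)) / l s * 0) (at_right 0)"
    unfolding g_def
  proof (rule tendsto_mult[OF _ two_sided_power_flat[OF c \<tau>(1)]])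
    show "((\<lambda>\<epsilon>. sinh (s * c) * l (- (\<epsilon> * s)) / l s) \<longlongrightarrow> sinh (s * c) * l (- (0 * s)) / l s) (at_right 0)"
      using lpos[of s] unfolding l_def by (intro tendsto_intros) auto
  qed (use c s in auto)
  then have "\<forall>\<^sub>F \<epsilon> in at_right 0. sinh (s * c) * l (- (\<epsilon> * s)) / l s * ((g (\<epsilon> * - (s * \<tau>\<^sup>2)) - g 0) / sinh (\<epsilon> * (s * c))) < \<eta> / 2"
    using \<eta> by (intro order_tendstoD(2)[where y=0]) auto
  then have "\<forall>\<^sub>F \<epsilon> in at_right 0. 0 < \<epsilon> \<and> sinh (s * c) * l (- (\<epsilon> * s)) / l s * ((g (\<epsilon> * - (s * \<tau>\<^sup>2)) - g 0) / sinh (\<epsilon> * (s * c))) < \<eta> / 2"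
    using eventually_at_right_less by (rule eventually_conj[rotated])
  then obtain \<epsilon> where \<epsilon>: "0 < \<epsilon>"
    and small: "sinh (s * c) * l (- (\<epsilon> * s)) / l s * ((g (\<epsilon> * - (s * \<tau>\<^sup>2)) - g 0) / sinh (\<epsilon> * (s * c))) < \<eta> / 2"
    using eventually_happens[of _ "at_right (0::real)"] trivial_limit_at_right_real by blast
  define r where "r = - (\<epsilon> * s)"
  have Bpos: "0 < B \<epsilon>" and Apos: "0 < A \<epsilon>"
    unfolding A_def B_def using two_sided_exp_combination(1,2)[OF c s \<epsilon>] by auto
  define u where "u = B \<epsilon> * l r / l s"
  define w where "w = A \<epsilon> * l 0 / l s"
  have uw: "0 < u" "0 < w" unfolding u_def w_def using Bpos Apos lpos by (auto intro!: divide_pos_pos mult_pos_pos)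
  have small': "u * (g (r * \<tau>\<^sup>2) - g 0) < \<eta> / 2"
    using small unfolding u_def B_def r_def by (simp add: mult_ac)
  \<comment> \<open>Slack granted to level and unbiasedness; weighted by the limits \<open>u\<close>
    and \<open>w\<close> of the two multipliers it adds up to \<open>\<eta> / 2\<close>.\<close>
  define \<delta> where "\<delta> = \<eta> / 2 / (u + w)"
  have "u + w \<noteq> 0" using uw by simp
  then have \<delta>: "0 < \<delta>" "(u + w) * \<delta> = \<eta> / 2"
    using uw \<eta> nonzero_eq_divide_eq[of "u + w" \<delta> "\<eta> / 2"] by (simp_all add: \<delta>_def mult.commute[of _ "u + w"])
  \<comment> \<open>The Neyman-Pearson inequality divided by \<open>\<zeta> s n\<close> and solved
    for \<open>E s n\<close>, with \<open>E r n\<close> and \<open>E 0 n\<close> replaced by their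
    worst admissible values.\<close>
  define bound where "bound n = \<Psi> s n + B \<epsilon> * (\<zeta> r n / \<zeta> s n) * (\<Psi> r n - (g 0 - \<delta>)) + A \<epsilon> * (\<zeta> 0 n / \<zeta> s n) * ((g 0 + \<delta>) - \<Psi> 0 n)" for n
  have "bound \<longlonglongrightarrow> g (s * \<tau>\<^sup>2) + B \<epsilon> * (l r / l s) * (g (r * \<tau>\<^sup>2) - (g 0 - \<delta>)) + A \<epsilon> * (l 0 / l s) * ((g 0 + \<delta>) - g (0 * \<tau>\<^sup>2))"
    unfolding bound_def using lpos[of s] by (intro tendsto_intros \<Psi>lim \<zeta>lim) auto
  moreover have "g (s * \<tau>\<^sup>2) + B \<epsilon> * (l r / l s) * (g (r * \<tau>\<^sup>2) - (g 0 - \<delta>)) + A \<epsilon> * (l 0 / l s) * ((g 0 + \<delta>) - g (0 * \<tau>\<^sup>2)) < g (s * \<tau>\<^sup>2) + \<eta>"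
  proof -
    have "B \<epsilon> * (l r / l s) * (g (r * \<tau>\<^sup>2) - (g 0 - \<delta>)) + A \<epsilon> * (l 0 / l s) * ((g 0 + \<delta>) - g (0 * \<tau>\<^sup>2)) =
      u * (g (r * \<tau>\<^sup>2) - g 0) + (u + w) * \<delta>" by (simp add: u_def w_def algebra_simps)
    then show ?thesis using small' \<delta>(2) by linarith
  qed
  ultimately have "\<forall>\<^sub>F n in sequentially. bound n < g (s * \<tau>\<^sup>2) + \<eta>" by (rule order_tendstoD(2))
  moreover have "\<forall>\<^sub>F n in sequentially. E 0 n \<le> g 0 + \<delta>" unfolding g_def by (rule level[OF \<delta>(1)])
  moreover have "\<forall>\<^sub>F n in sequentially. g 0 - \<delta> \<le> E r n" unfolding g_def r_def by (rule unbiased[OF \<epsilon> \<delta>(1)])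
  ultimately show ?thesis
  proof eventually_elim
    case (elim n)
    have "\<zeta> s n * E s n \<le> \<zeta> s n * \<Psi> s n + B \<epsilon> * (\<zeta> r n * (\<Psi> r n - E r n)) + A \<epsilon> * (\<zeta> 0 n * (E 0 n - \<Psi> 0 n))"
      using NP[OF \<epsilon>, of n] unfolding r_def by (simp add: algebra_simps)
    also have "\<dots> \<le> \<zeta> s n * \<Psi> s n + B \<epsilon> * (\<zeta> r n * (\<Psi> r n - (g 0 - \<delta>))) + A \<epsilon> * (\<zeta> 0 n * ((g 0 + \<delta>) - \<Psi> 0 n))"
      using elim Bpos Apos \<zeta>pos[of r n] \<zeta>pos[of 0 n] \<zeta>pos[of s n] by (intro add_mono mult_left_mono) auto
    also have "\<dots> = \<zeta> s n * bound n"
      using \<zeta>pos[of s n] unfolding bound_def by (simp add: field_simps)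
    finally have "E s n \<le> bound n" using \<zeta>pos[of s n] by simp
    then show ?case using elim by (simp add: g_def)
  qed
qed

end

section \<open>Implicit hypotheses and alternatives\<close>

lemma limsup_le_realI:
  assumes "\<And>\<eta>. 0 < \<eta> \<Longrightarrow> \<forall>\<^sub>F n in sequentially. f n \<le> a + \<eta>"
  shows "limsup (\<lambda>n. ereal (f n)) \<le> ereal a"
proof (rule ereal_le_epsilon2)
  fix \<eta> :: real assume "0 < \<eta>"
  from assms[OF this] have "\<forall>\<^sub>F n in sequentially. ereal (f n) \<le> ereal a + ereal \<eta>" by (auto elim: eventually_mono)
  then show "limsup (\<lambda>n. ereal (f n)) \<le> ereal a + ereal \<eta>" by (rule Limsup_bounded)
qed

lemma limsup_le_realD:
  assumes "limsup (\<lambda>n. ereal (f n)) \<le> ereal a" "0 < \<eta>"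
  shows "\<forall>\<^sub>F n in sequentially. f n \<le> a + \<eta>"
proof -
  have "\<forall>y>ereal a. \<forall>\<^sub>F n in sequentially. ereal (f n) < y" using assms(1) by (simp only: Limsup_le_iff)
  then have "\<forall>\<^sub>F n in sequentially. ereal (f n) < ereal (a + \<eta>)"
    by (rule allE[where x="ereal (a + \<eta>)"]) (use assms(2) in simp)
  then show ?thesis by eventually_elim simp
qed

lemma liminf_ge_realI:
  assumes "\<And>\<eta>. 0 < \<eta> \<Longrightarrow> \<forall>\<^sub>F n in sequentially. a - \<eta> \<le> f n"
  shows "ereal a \<le> liminf (\<lambda>n. ereal (f n))"
proof (rule ereal_le_epsilon2)
  fix \<eta> :: real assume "0 < \<eta>"
  from assms[OF this] have "\<forall>\<^sub>F n in sequentially. ereal (a - \<eta>) \<le> ereal (f n)" by (auto elim: eventually_mono)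
  then have "ereal (a - \<eta>) \<le> liminf (\<lambda>n. ereal (f n))" by (rule Liminf_bounded)
  then have "ereal (a - \<eta>) + ereal \<eta> \<le> liminf (\<lambda>n. ereal (f n)) + ereal \<eta>" by (rule add_right_mono)
  then show "ereal a \<le> liminf (\<lambda>n. ereal (f n)) + ereal \<eta>" by simp
qed

lemma liminf_ge_realD:
  assumes "ereal a \<le> liminf (\<lambda>n. ereal (f n))" "0 < \<eta>"
  shows "\<forall>\<^sub>F n in sequentially. a - \<eta> \<le> f n"
proof -
  have "\<forall>y<ereal a. \<forall>\<^sub>F n in sequentially. y < ereal (f n)" using assms(1) by (simp only: le_Liminf_iff)
  then have "\<forall>\<^sub>F n in sequentially. ereal (a - \<eta>) < ereal (f n)"
    by (rule allE[where x="ereal (a - \<eta>)"]) (use assms(2) in simp)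
  then show ?thesis by eventually_elim simp
qed

locale implicit_testing = two_sample P0 Q0 n1 n2 d
  for P0 :: "'a measure" and Q0 :: "'b measure" and n1 n2 :: "nat \<Rightarrow> nat" and d :: real +
  fixes A1 :: "'a measure" and A2 :: "'b measure" and F :: "'a measure set" and G :: "'b measure set"
    and k :: "('a \<times> 'b) measure \<Rightarrow> real" and kt :: "'a \<times> 'b \<Rightarrow> real" and kt1 :: "'a \<Rightarrow> real" and kt2 :: "'b \<Rightarrow> real"
    and \<alpha> :: real
  assumes families: "prob_family A1 F" "prob_family A2 G" "P0 \<in> F" "Q0 \<in> G"
    and gradient: "is_canonical_gradient k (P0 \<Otimes>\<^sub>M Q0) (prod_family F G) kt"
    and kt12: "kt1 \<in> L2_zero P0" "kt2 \<in> L2_zero Q0"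
    and kt_sum: "AE z in P0 \<Otimes>\<^sub>M Q0. kt z = (kt1 \<oplus>\<^sub>f kt2) z"
    and kt_nonzero: "L2_norm (P0 \<Otimes>\<^sub>M Q0) kt \<noteq> 0"
    and \<alpha>01: "0 < \<alpha>" "\<alpha> < 1"
    and cone_dense: "L2_dense_in (P0 \<Otimes>\<^sub>M Q0) (tangent_cone (P0 \<Otimes>\<^sub>M Q0) (prod_family F G))
           (tangent_space (P0 \<Otimes>\<^sub>M Q0) (prod_family F G))"
    and null_dense: "L2_dense_in (P0 \<Otimes>\<^sub>M Q0)
           (tangent_cone (P0 \<Otimes>\<^sub>M Q0) (prod_family F G) \<inter> tangent_null_space kt (P0 \<Otimes>\<^sub>M Q0) (prod_family F G))
           (tangent_null_space kt (P0 \<Otimes>\<^sub>M Q0) (prod_family F G))"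
begin

abbreviation M where "M \<equiv> P0 \<Otimes>\<^sub>M Q0"
abbreviation K where "K \<equiv> tangent_cone M (prod_family F G)"
abbreviation T where "T \<equiv> tangent_space M (prod_family F G)"

definition \<kappa>1 :: "'a \<Rightarrow> real" where "\<kappa>1 x = 1 / (1 - d) * kt1 x"
definition \<kappa>2 :: "'b \<Rightarrow> real" where "\<kappa>2 y = 1 / d * kt2 y"
text \<open>Limiting standard deviation of the statistic. Its square is also the pairing of the
  canonical gradient with \<kappa> and the weighted squared norm of \<kappa>; a shift by
  \<open>r\<close> times \<kappa> thus moves the functional and the mean of the statistic by the
  same amount.\<close>

definition \<sigma> :: real where "\<sigma> = sqrt (1 / (1 - d) * (\<integral>x. (kt1 x)\<^sup>2 \<partial>P0) + 1 / d * (\<integral>y. (kt2 y)\<^sup>2 \<partial>Q0))"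
definition c :: real where "c = crit_value \<alpha> d kt1 kt2 P0 Q0"

text \<open>Retains of a curve what the comparison uses: test means differ from those under a tilt
  asymptotically by at most the L2-distance of the tangents. The property is insensitive to changes
  of \<open>h\<close> on null sets, which the exactly additive version of a tangent
  requires.\<close>

definition approximates :: "(nat \<Rightarrow> 'a measure) \<Rightarrow> (nat \<Rightarrow> 'b measure) \<Rightarrow> ('a \<times> 'b \<Rightarrow> real) \<Rightarrow> bool" where
  "approximates P Q h \<longleftrightarrow> (\<forall>v1n v2n v1 v2 \<phi>. arr v1n v2n v1 v2 \<longrightarrow> test_sequence A1 A2 n1 n2 \<phi> \<longrightarrow>
     (\<exists>\<rho>. \<rho> \<longlonglongrightarrow> L2_norm M (\<lambda>z. h z - (v1 \<oplus>\<^sub>f v2) z) \<and>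
       (\<forall>n. \<bar>test_mean n1 n2 \<phi> P Q n - (\<integral>z. \<phi> n z * D v1n v2n n z \<partial>S n)\<bar> \<le> \<rho> n)))"

lemma approximatesD:
  assumes "approximates P Q h" "arr v1n v2n v1 v2" "test_sequence A1 A2 n1 n2 \<phi>"
    and "L2_norm M (\<lambda>z. h z - (v1 \<oplus>\<^sub>f v2) z) < \<eta>"
  shows "\<forall>\<^sub>F n in sequentially. \<bar>test_mean n1 n2 \<phi> P Q n - (\<integral>z. \<phi> n z * D v1n v2n n z \<partial>S n)\<bar> < \<eta>"
proof -
  obtain \<rho> where \<rho>: "\<rho> \<longlonglongrightarrow> L2_norm M (\<lambda>z. h z - (v1 \<oplus>\<^sub>f v2) z)"
    "\<forall>n. \<bar>test_mean n1 n2 \<phi> P Q n - (\<integral>z. \<phi> n z * D v1n v2n n z \<partial>S n)\<bar> \<le> \<rho> n"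
    using assms(1-3) unfolding approximates_def by blast
  have "\<forall>\<^sub>F n in sequentially. \<rho> n < \<eta>" by (rule order_tendstoD(2)[OF \<rho>(1) assms(4)])
  then show ?thesis by eventually_elim (use \<rho>(2) in \<open>auto intro: le_less_trans\<close>)
qed

lemma kt_L2: "kt \<in> L2_space M" and kt_T: "kt \<in> T" and kt1_L2: "kt1 \<in> L2_space P0" and kt2_L2: "kt2 \<in> L2_space Q0"
  using gradient kt12 tangent_space_L2 unfolding is_canonical_gradient_def is_gradient_def by (auto dest: L2_zeroD)

lemma \<kappa>_zero: "\<kappa>1 \<in> L2_zero P0" "\<kappa>2 \<in> L2_zero Q0"
  unfolding \<kappa>1_def[abs_def] \<kappa>2_def[abs_def] by (intro M1.L2_zero_cmult M2.L2_zero_cmult kt12)+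

lemma \<kappa>_T: "\<kappa>1 \<oplus>\<^sub>f \<kappa>2 \<in> T"
proof -
  note t = tangent_space_components[OF families kt_T kt12 kt_sum]
  show ?thesis unfolding direct_sum_def[abs_def] \<kappa>1_def \<kappa>2_def
    by (intro tangent_space_add tangent_space_cmult t)
qed

lemma inner_kt:
  assumes "v1 \<in> L2_zero P0" "v2 \<in> L2_zero Q0"
  shows "(\<integral>z. kt z * (v1 \<oplus>\<^sub>f v2) z \<partial>M) = (\<integral>x. kt1 x * v1 x \<partial>P0) + (\<integral>y. kt2 y * v2 y \<partial>Q0)"
proof -
  have v: "v1 \<oplus>\<^sub>f v2 \<in> L2_space M" by (intro direct_sum_L2 L2_zeroD(1) assms)
  have s: "kt1 \<oplus>\<^sub>f kt2 \<in> L2_space M" by (intro direct_sum_L2 kt1_L2 kt2_L2)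
  have "(\<integral>z. kt z * (v1 \<oplus>\<^sub>f v2) z \<partial>M) = (\<integral>z. (kt1 \<oplus>\<^sub>f kt2) z * (v1 \<oplus>\<^sub>f v2) z \<partial>M)"
    by (rule integral_cong_AE[OF borel_measurable_integrable[OF L2_integrable_mult[OF kt_L2 v]]
          borel_measurable_integrable[OF L2_integrable_mult[OF s v]]])
      (use kt_sum in \<open>eventually_elim, simp\<close>)
  then show ?thesis by (simp add: direct_sum_inner[OF kt12(1) assms(1) kt12(2) assms(2)])
qed

lemma \<sigma>_pos: "0 < \<sigma>"
proof -
  have "0 < (L2_norm M kt)\<^sup>2" using kt_nonzero by simp
  also have "L2_norm M kt = L2_norm M (kt1 \<oplus>\<^sub>f kt2)"
    by (rule L2_norm_cong_AE[OF L2_spaceD(1)[OF kt_L2] L2_spaceD(1)[OF direct_sum_L2[OF kt1_L2 kt2_L2]] kt_sum])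
  finally have pos: "0 < (\<integral>x. (kt1 x)\<^sup>2 \<partial>P0) + (\<integral>y. (kt2 y)\<^sup>2 \<partial>Q0)"
    using direct_sum_norm2[OF kt12] by (simp add: L2_norm_power2)
  have nn: "0 \<le> (\<integral>x. (kt1 x)\<^sup>2 \<partial>P0)" "0 \<le> (\<integral>y. (kt2 y)\<^sup>2 \<partial>Q0)" by auto
  show ?thesis unfolding \<sigma>_def real_sqrt_gt_0_iff
  proof (cases "0 < (\<integral>x. (kt1 x)\<^sup>2 \<partial>P0)")
    case True
    then show "0 < 1 / (1 - d) * (\<integral>x. (kt1 x)\<^sup>2 \<partial>P0) + 1 / d * (\<integral>y. (kt2 y)\<^sup>2 \<partial>Q0)"
      using d01 nn by (intro add_pos_nonneg mult_pos_pos) auto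
  next
    case False
    then have "0 < (\<integral>y. (kt2 y)\<^sup>2 \<partial>Q0)" using pos by linarith
    then show "0 < 1 / (1 - d) * (\<integral>x. (kt1 x)\<^sup>2 \<partial>P0) + 1 / d * (\<integral>y. (kt2 y)\<^sup>2 \<partial>Q0)"
      using d01 nn by (intro add_nonneg_pos mult_pos_pos) auto
  qed
qed

lemma \<sigma>_power2: "\<sigma>\<^sup>2 = 1 / (1 - d) * (\<integral>x. (kt1 x)\<^sup>2 \<partial>P0) + 1 / d * (\<integral>y. (kt2 y)\<^sup>2 \<partial>Q0)"
  using \<sigma>_pos unfolding \<sigma>_def by simp

lemma inner_kt_\<kappa>: "(\<integral>x. kt1 x * \<kappa>1 x \<partial>P0) + (\<integral>y. kt2 y * \<kappa>2 y \<partial>Q0) = \<sigma>\<^sup>2"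
proof -
  have "(\<lambda>x. kt1 x * \<kappa>1 x) = (\<lambda>x. 1 / (1 - d) * (kt1 x)\<^sup>2)" "(\<lambda>x. kt2 x * \<kappa>2 x) = (\<lambda>x. 1 / d * (kt2 x)\<^sup>2)"
    by (auto simp: \<kappa>1_def \<kappa>2_def power2_eq_square)
  then show ?thesis unfolding \<sigma>_power2 by simp
qed

lemma c_eq: "c = std_normal_quantile (1 - \<alpha> / 2) * \<sigma>"
  by (simp add: c_def crit_value_def \<sigma>_def)

lemma c_pos: "0 < c"
  unfolding c_eq using \<sigma>_pos \<alpha>01 by (intro mult_pos_pos std_normal_quantile_pos) auto

lemma power_level: "two_sided_power c \<sigma> 0 = \<alpha>"
  unfolding c_eq by (rule two_sided_power_level[OF \<alpha>01 \<sigma>_pos])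

text \<open>The gradient condition is a limit from the right, reached because \<open>t n\<close> is
  eventually positive; the factor \<open>a\<close> converts the scale \<open>t n\<close> into
  \<open>1 / sqrt n\<close>.\<close>

lemma local_param_eq:
  assumes curve: "L2_differentiable_curve (prod_family F G) e R g" and R0: "R 0 = M"
    and t: "t \<longlonglongrightarrow> 0" "0 < a" "(\<lambda>n. t n * sqrt (real n)) \<longlonglongrightarrow> a"
    and PQ: "\<And>n. R (t n) = P n \<Otimes>\<^sub>M Q n"
  shows "local_param k P0 Q0 P Q = a * (\<integral>z. kt z * g z \<partial>M)"
proof -
  have "\<forall>\<^sub>F n in sequentially. t n * sqrt (real n) > 0" by (rule order_tendstoD(1)[OF t(3,2)])
  then have tpos: "\<forall>\<^sub>F n in sequentially. t n > 0"
    by eventually_elim (metis mult_le_0_iff not_le real_sqrt_ge_zero of_nat_0_le_iff)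
  have t_at: "filterlim t (at_right 0) sequentially"
    using t(1) tpos by (auto simp: filterlim_at elim: eventually_mono)
  have "((\<lambda>t. (k (R t) - k M) / t) \<longlongrightarrow> (\<integral>z. kt z * g z \<partial>M)) (at_right 0)"
    using gradient curve R0 unfolding is_canonical_gradient_def is_gradient_def by blast
  from tendsto_mult[OF t(3) filterlim_compose[OF this t_at]]
  have "(\<lambda>n. t n * sqrt (real n) * ((k (R (t n)) - k M) / t n)) \<longlonglongrightarrow> a * (\<integral>z. kt z * g z \<partial>M)" .
  then have "(\<lambda>n. sqrt (real n) * (k (P n \<Otimes>\<^sub>M Q n) - k M)) \<longlonglongrightarrow> a * (\<integral>z. kt z * g z \<partial>M)"
    by (rule Lim_transform_eventually) (use tpos in \<open>eventually_elim, simp add: PQ\<close>)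
  then show ?thesis unfolding local_param_def by (rule limI)
qed

lemma approximates_curve:
  assumes curve: "L2_differentiable_curve (prod_family F G) e R g" and R0: "R 0 = M"
    and t: "t \<longlonglongrightarrow> 0" "0 < a" "(\<lambda>n. t n * sqrt (real n)) \<longlonglongrightarrow> a" "\<And>n. \<bar>t n\<bar> < e"
    and PQ: "\<And>n. R (t n) = P n \<Otimes>\<^sub>M Q n" "\<And>n. P n \<in> F" "\<And>n. Q n \<in> G"
  shows "approximates P Q (\<lambda>z. a * g z)"
  unfolding approximates_def by (intro allI impI) (rule curve_test_limit[OF families curve R0 t PQ])

text \<open>At the scale \<open>1 / sqrt n\<close> the tangent of the sequence is
  \<open>a g\<close>, with \<open>a\<close> the limit of \<open>t n * sqrt n\<close>. It is replaced
  by its exactly additive version, for which tilting arrays exist.\<close>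

lemma local_sequence_tangent:
  assumes "(P, Q) \<in> local_sequences F G P0 Q0"
  obtains w1 w2 where "w1 \<in> L2_zero P0" "w2 \<in> L2_zero Q0" "w1 \<oplus>\<^sub>f w2 \<in> T"
    "local_param k P0 Q0 P Q = (\<integral>x. kt1 x * w1 x \<partial>P0) + (\<integral>y. kt2 y * w2 y \<partial>Q0)"
    "approximates P Q (w1 \<oplus>\<^sub>f w2)"
proof -
  have "(\<forall>n. P n \<in> F \<and> Q n \<in> G) \<and> (\<exists>t. t \<longlonglongrightarrow> 0 \<and> (\<exists>a>0. (\<lambda>n. t n * sqrt (real n)) \<longlonglongrightarrow> a) \<and>
      (\<exists>e R g. L2_differentiable_curve (prod_family F G) e R g \<and> R 0 = M \<and>
         (\<forall>n. \<bar>t n\<bar> < e \<and> R (t n) = P n \<Otimes>\<^sub>M Q n)))"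
    using assms unfolding local_sequences_def mem_Collect_eq prod.case .
  then obtain t a e R g where t: "t \<longlonglongrightarrow> 0" "0 < a" "(\<lambda>n. t n * sqrt (real n)) \<longlonglongrightarrow> a"
    and curve: "L2_differentiable_curve (prod_family F G) e R g" and R0: "R 0 = M"
    and tR: "\<forall>n. \<bar>t n\<bar> < e \<and> R (t n) = P n \<Otimes>\<^sub>M Q n" and PQF: "\<forall>n. P n \<in> F \<and> Q n \<in> G"
    by (elim conjE exE) (rule that, assumption+)
  from tR have te: "\<And>n. \<bar>t n\<bar> < e" and PQ1: "\<And>n. R (t n) = P n \<Otimes>\<^sub>M Q n" by auto
  from PQF have "\<And>n. P n \<in> F" "\<And>n. Q n \<in> G" by auto
  note t = t te and PQ = PQ1 this
  have gK: "g \<in> K" using curve R0 unfolding tangent_cone_def by blast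
  then have g: "g \<in> L2_space M" using tangent_cone_L2 by blast
  obtain g1 g2 where g12: "g1 \<in> L2_zero P0" "g2 \<in> L2_zero Q0" and eq: "AE z in M. g z = (g1 \<oplus>\<^sub>f g2) z"
    by (rule tangent_cone_marginals[OF families gK]) blast
  define w1 where "w1 x = a * g1 x" for x
  define w2 where "w2 y = a * g2 y" for y
  have w: "w1 \<in> L2_zero P0" "w2 \<in> L2_zero Q0"
    unfolding w1_def[abs_def] w2_def[abs_def] by (intro M1.L2_zero_cmult M2.L2_zero_cmult g12)+
  have wL2: "w1 \<oplus>\<^sub>f w2 \<in> L2_space M" by (intro direct_sum_L2 L2_zeroD(1) w)
  have weq: "AE z in M. a * g z = (w1 \<oplus>\<^sub>f w2) z"
    using eq by eventually_elim (simp add: direct_sum_def w1_def w2_def distrib_left)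
  have agL2: "(\<lambda>z. a * g z) \<in> L2_space M" by (rule L2_space_cmult[OF g])
  have wT: "w1 \<oplus>\<^sub>f w2 \<in> T"
    by (rule tangent_space_cong_AE[OF tangent_space_cmult[OF subsetD[OF tangent_cone_subset_space gK]] L2_spaceD(1)[OF wL2] weq])
  have "local_param k P0 Q0 P Q = (\<integral>z. kt z * (a * g z) \<partial>M)"
    using local_param_eq[OF curve R0 t(1-3) PQ(1)] by (simp add: mult.left_commute)
  also have "\<dots> = (\<integral>z. kt z * (w1 \<oplus>\<^sub>f w2) z \<partial>M)"
    by (rule integral_cong_AE[OF borel_measurable_integrable[OF L2_integrable_mult[OF kt_L2 agL2]]
          borel_measurable_integrable[OF L2_integrable_mult[OF kt_L2 wL2]]])
      (use weq in \<open>eventually_elim, simp\<close>)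
  also note inner_kt[OF w]
  finally have lp: "local_param k P0 Q0 P Q = (\<integral>x. kt1 x * w1 x \<partial>P0) + (\<integral>y. kt2 y * w2 y \<partial>Q0)" .
  have norm_eq: "L2_norm M (\<lambda>z. a * g z - (v1 \<oplus>\<^sub>f v2) z) = L2_norm M (\<lambda>z. (w1 \<oplus>\<^sub>f w2) z - (v1 \<oplus>\<^sub>f v2) z)"
    if v: "arr v1n v2n v1 v2" for v1n v2n v1 v2
  proof -
    have vL2: "v1 \<oplus>\<^sub>f v2 \<in> L2_space M" by (rule L2_arrayD(3)[OF arr_direct_sum(1)[OF v]])
    show ?thesis
      by (rule L2_norm_cong_AE[OF L2_spaceD(1)[OF L2_space_diff[OF agL2 vL2]] L2_spaceD(1)[OF L2_space_diff[OF wL2 vL2]]])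
        (use weq in \<open>eventually_elim, simp\<close>)
  qed
  have "approximates P Q (w1 \<oplus>\<^sub>f w2)"
    unfolding approximates_def
  proof (intro allI impI)
    fix v1n v2n v1 v2 \<phi> assume v: "arr v1n v2n v1 v2" and \<phi>: "test_sequence A1 A2 n1 n2 \<phi>"
    show "\<exists>\<rho>. \<rho> \<longlonglongrightarrow> L2_norm M (\<lambda>z. (w1 \<oplus>\<^sub>f w2) z - (v1 \<oplus>\<^sub>f v2) z) \<and>
        (\<forall>n. \<bar>test_mean n1 n2 \<phi> P Q n - (\<integral>z. \<phi> n z * D v1n v2n n z \<partial>S n)\<bar> \<le> \<rho> n)"
      using approximates_curve[OF curve R0 t PQ] v \<phi> unfolding approximates_def norm_eq[OF v, symmetric] by blast
  qed
  from that[OF w wT lp this] show thesis .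
qed

text \<open>Conversely, a tangent is realised at scale \<open>a = 1\<close> by
  \<open>t n = 1 / sqrt n\<close>. It thereby yields a hypothesis or an alternative according to
  whether its pairing with the canonical gradient is 0.\<close>

lemma cone_sequence:
  assumes f: "f \<in> K"
  obtains P Q where "(P, Q) \<in> local_sequences F G P0 Q0" "local_param k P0 Q0 P Q = (\<integral>z. kt z * f z \<partial>M)"
    "approximates P Q f"
proof -
  obtain e R where curve: "L2_differentiable_curve (prod_family F G) e R f" and R0: "R 0 = M"
    using f unfolding tangent_cone_def by blast
  have e: "e > 0" and RF: "\<And>t. \<bar>t\<bar> < e \<Longrightarrow> R t \<in> prod_family F G"
    using curve unfolding L2_differentiable_curve_def by auto
  \<comment> \<open>Finitely many early values may fall outside the domain of the curve and are
    replaced by 0; at \<open>n = 0\<close> the quotient is 0 by convention.\<close>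
  define t where "t n = (if 1 / sqrt (real n) < e then 1 / sqrt (real n) else 0)" for n
  have te: "\<bar>t n\<bar> < e" for n using e by (auto simp: t_def)
  have inv0: "(\<lambda>n. 1 / sqrt (real n)) \<longlonglongrightarrow> 0" using sqrt_scaled_tendsto_0[OF tendsto_const[of 1]] .
  then have "\<forall>\<^sub>F n in sequentially. 1 / sqrt (real n) < e" by (rule order_tendstoD(2)) (rule e)
  then have teq: "\<forall>\<^sub>F n in sequentially. 1 / sqrt (real n) = t n" by eventually_elim (simp add: t_def)
  have t0: "t \<longlonglongrightarrow> 0" by (rule Lim_transform_eventually[OF inv0 teq])
  have t1: "(\<lambda>n. t n * sqrt (real n)) \<longlonglongrightarrow> 1"
  proof (rule tendsto_eventually)
    show "\<forall>\<^sub>F n in sequentially. t n * sqrt (real n) = 1"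
      using teq eventually_gt_at_top[of 0]
    proof eventually_elim
      case (elim n)
      then show ?case by (simp add: elim(1)[symmetric])
    qed
  qed
  have "\<forall>n. \<exists>P Q. P \<in> F \<and> Q \<in> G \<and> R (t n) = P \<Otimes>\<^sub>M Q"
    using RF[OF te] unfolding prod_family_def by blast
  then obtain P Q where PQ: "\<And>n. R (t n) = P n \<Otimes>\<^sub>M Q n" "\<And>n. P n \<in> F" "\<And>n. Q n \<in> G" by metis
  have "(P, Q) \<in> local_sequences F G P0 Q0"
    unfolding local_sequences_def mem_Collect_eq prod.case
  proof (intro conjI allI PQ(2,3) exI[of _ t] t0)
    show "\<exists>a>0. (\<lambda>n. t n * sqrt (real n)) \<longlonglongrightarrow> a" using t1 by (intro exI[of _ 1]) auto
    show "\<exists>e R g. L2_differentiable_curve (prod_family F G) e R g \<and> R 0 = M \<and> (\<forall>n. \<bar>t n\<bar> < e \<and> R (t n) = P n \<Otimes>\<^sub>M Q n)"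
      using curve R0 te PQ(1) by blast
  qed
  moreover have "local_param k P0 Q0 P Q = (\<integral>z. kt z * f z \<partial>M)"
    using local_param_eq[OF curve R0 t0 zero_less_one t1 PQ(1)] by simp
  moreover have "approximates P Q f"
    using approximates_curve[OF curve R0 t0 zero_less_one t1 te PQ] by simp
  ultimately show thesis by (rule that)
qed

section \<open>Limiting power of the proposed test\<close>

abbreviation H where "H \<equiv> implicit_hypotheses k F G P0 Q0"
abbreviation Alt where "Alt \<equiv> implicit_alternatives k F G P0 Q0"
abbreviation \<psi> where "\<psi> \<equiv> psi_test c n1 n2 kt1 kt2"

lemma T_stat_eq:
  "T_stat n1 n2 kt1 kt2 n z = sqrt (real n) / real (n1 n) * (\<Sum>i=1..n1 n. kt1 (fst z i)) +
     sqrt (real n) / real (n2 n) * (\<Sum>j=1..n2 n. kt2 (snd z j))"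
  by (simp add: T_stat_def case_prod_beta)

lemma psi_test_sequence: "test_sequence A1 A2 n1 n2 \<psi>"
proof -
  have s: "sets P0 = sets A1" "sets Q0 = sets A2" using families by (auto simp: prob_family_def)
  have [measurable]: "kt1 \<in> borel_measurable A1" "kt2 \<in> borel_measurable A2"
    using L2_spaceD(1)[OF kt1_L2] L2_spaceD(1)[OF kt2_L2] measurable_cong_sets[OF s(1) refl] measurable_cong_sets[OF s(2) refl] by auto
  have [measurable]: "T_stat n1 n2 kt1 kt2 n \<in> borel_measurable (sample_measure (n1 n) (n2 n) A1 A2)" for n
    unfolding T_stat_eq[abs_def] by measurable
  have "psi_test c n1 n2 kt1 kt2 n \<in> borel_measurable (sample_measure (n1 n) (n2 n) A1 A2)" for n
    unfolding psi_test_def[abs_def] by measurable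
  then show ?thesis by (auto simp: test_sequence_def psi_test_def)
qed

text \<open>The coefficients scaled by \<open>sqrt n\<close> tend to \<open>1 / (1 - d)\<close> and
  \<open>1 / d\<close>, which cancel the sample fractions in the limiting mean. What remains is the
  unweighted pairing with the canonical gradient, the same expression as for the local
  parameter.\<close>

lemma psi_tilted_limit:
  assumes v: "arr v1n v2n v1 v2"
  shows "(\<lambda>n. \<integral>z. \<psi> n z * D v1n v2n n z \<partial>S n) \<longlonglongrightarrow>
    two_sided_power c \<sigma> ((\<integral>x. kt1 x * v1 x \<partial>P0) + (\<integral>y. kt2 y * v2 y \<partial>Q0))"
proof -
  have c1: "(\<lambda>n. sqrt (real n) * (sqrt (real n) / real (n1 n))) \<longlonglongrightarrow> 1 / (1 - d)"
    using tendsto_divide[OF tendsto_const[of 1] fraction1] d01 by simp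
  have c2: "(\<lambda>n. sqrt (real n) * (sqrt (real n) / real (n2 n))) \<longlonglongrightarrow> 1 / d"
    using tendsto_divide[OF tendsto_const[of 1] fraction] d01 by simp
  have "(\<lambda>n. \<integral>z. (if c < \<bar>sqrt (real n) / real (n1 n) * (\<Sum>i=1..n1 n. kt1 (fst z i)) +
     sqrt (real n) / real (n2 n) * (\<Sum>j=1..n2 n. kt2 (snd z j))\<bar> then 1 else 0) * D v1n v2n n z \<partial>S n) \<longlonglongrightarrow>
     two_sided_power c \<sigma> ((\<integral>x. kt1 x * v1 x \<partial>P0) + (\<integral>y. kt2 y * v2 y \<partial>Q0))"
  proof (rule tilted_rejection_limit[OF M1.L2_array_const[OF kt12(1)] M2.L2_array_const[OF kt12(2)] v c1 c2 \<sigma>_pos])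
    show "\<sigma>\<^sup>2 = (1 - d) * (1 / (1 - d))\<^sup>2 * (\<integral>x. (kt1 x)\<^sup>2 \<partial>P0) + d * (1 / d)\<^sup>2 * (\<integral>y. (kt2 y)\<^sup>2 \<partial>Q0)"
      unfolding \<sigma>_power2 using d01 by (simp add: power2_eq_square)
  qed (use d01 in simp)
  then show ?thesis unfolding psi_test_def T_stat_eq .
qed

text \<open>The sequence is compared with the tilt along its own tangent, at distance 0.\<close>

lemma psi_limit:
  assumes PQ: "(P, Q) \<in> local_sequences F G P0 Q0"
  shows "test_mean n1 n2 \<psi> P Q \<longlonglongrightarrow> two_sided_power c \<sigma> (local_param k P0 Q0 P Q)"
proof -
  obtain w1 w2 where w: "w1 \<in> L2_zero P0" "w2 \<in> L2_zero Q0"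
    and lp: "local_param k P0 Q0 P Q = (\<integral>x. kt1 x * w1 x \<partial>P0) + (\<integral>y. kt2 y * w2 y \<partial>Q0)"
    and app: "approximates P Q (w1 \<oplus>\<^sub>f w2)"
    by (rule local_sequence_tangent[OF PQ]) blast
  obtain v1n v2n where v: "arr v1n v2n w1 w2" by (rule ex_arr[OF w])
  obtain \<rho> where \<rho>: "\<rho> \<longlonglongrightarrow> L2_norm M (\<lambda>z. (w1 \<oplus>\<^sub>f w2) z - (w1 \<oplus>\<^sub>f w2) z)"
    and le: "\<forall>n. \<bar>test_mean n1 n2 \<psi> P Q n - (\<integral>z. \<psi> n z * D v1n v2n n z \<partial>S n)\<bar> \<le> \<rho> n"
    using app v psi_test_sequence unfolding approximates_def by blast
  from \<rho> have "\<rho> \<longlonglongrightarrow> 0" by (simp add: L2_norm_def)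
  then have "(\<lambda>n. test_mean n1 n2 \<psi> P Q n - (\<integral>z. \<psi> n z * D v1n v2n n z \<partial>S n)) \<longlonglongrightarrow> 0"
    by (rule Lim_null_comparison[rotated]) (use le in auto)
  from tendsto_add[OF this psi_tilted_limit[OF v]] show ?thesis by (simp add: lp)
qed

text \<open>The limiting power is \<alpha> at 0 and nowhere smaller.\<close>

lemma psi_unbiased: "asymptotically_unbiased A1 A2 n1 n2 \<alpha> H Alt \<psi>"
  unfolding asymptotically_unbiased_def
proof (intro conjI psi_test_sequence ballI)
  fix x assume "x \<in> H"
  then obtain P Q where x: "x = (P, Q)" "(P, Q) \<in> local_sequences F G P0 Q0" "local_param k P0 Q0 P Q = 0"
    by (auto simp: implicit_hypotheses_def)
  have "(\<lambda>n. ereal (test_mean n1 n2 \<psi> P Q n)) \<longlonglongrightarrow> ereal \<alpha>"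
    using psi_limit[OF x(2)] by (simp add: x(3) power_level)
  from lim_imp_Limsup[OF _ this]
  show "case x of (P, Q) \<Rightarrow> limsup (\<lambda>n. ereal (test_mean n1 n2 \<psi> P Q n)) \<le> ereal \<alpha>" by (simp add: x(1))
next
  fix x assume "x \<in> Alt"
  then obtain P Q where x: "x = (P, Q)" "(P, Q) \<in> local_sequences F G P0 Q0"
    by (auto simp: implicit_alternatives_def)
  have "(\<lambda>n. ereal (test_mean n1 n2 \<psi> P Q n)) \<longlonglongrightarrow> ereal (two_sided_power c \<sigma> (local_param k P0 Q0 P Q))"
    using psi_limit[OF x(2)] by simp
  from lim_imp_Liminf[OF _ this] two_sided_power_ge[of c \<sigma> "local_param k P0 Q0 P Q"] c_pos \<sigma>_pos
  show "case x of (P, Q) \<Rightarrow> ereal \<alpha> \<le> liminf (\<lambda>n. ereal (test_mean n1 n2 \<psi> P Q n))" by (simp add: x(1) power_level)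
qed

section \<open>Bounds for an arbitrary asymptotically unbiased test sequence\<close>

context
  fixes \<phi> assumes \<phi>: "asymptotically_unbiased A1 A2 n1 n2 \<alpha> H Alt \<phi>"
begin

lemma phi_test: "test_sequence A1 A2 n1 n2 \<phi>"
  using \<phi> by (simp add: asymptotically_unbiased_def)

text \<open>A null direction need not be a tangent, but tangents of hypotheses are dense among null
  directions; half of \<eta> pays for the distance and half for the asymptotic level.\<close>

lemma null_level:
  assumes v: "arr v1n v2n v1 v2" and N: "v1 \<oplus>\<^sub>f v2 \<in> tangent_null_space kt M (prod_family F G)" and \<eta>: "0 < \<eta>"
  shows "\<forall>\<^sub>F n in sequentially. (\<integral>z. \<phi> n z * D v1n v2n n z \<partial>S n) \<le> \<alpha> + \<eta>"
proof -
  have "\<eta> / 2 > 0" using \<eta> by simp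
  then obtain f where f: "f \<in> K \<inter> tangent_null_space kt M (prod_family F G)"
    and near: "L2_norm M (\<lambda>z. (v1 \<oplus>\<^sub>f v2) z - f z) < \<eta> / 2"
    using null_dense N unfolding L2_dense_in_def L2_closure_def by blast
  obtain P Q where PQ: "(P, Q) \<in> local_sequences F G P0 Q0" "local_param k P0 Q0 P Q = (\<integral>z. kt z * f z \<partial>M)"
    and app: "approximates P Q f"
    using f by (auto intro: cone_sequence)
  have "(P, Q) \<in> H" using PQ f by (auto simp: implicit_hypotheses_def tangent_null_space_def)
  then have "limsup (\<lambda>n. ereal (test_mean n1 n2 \<phi> P Q n)) \<le> ereal \<alpha>"
    using \<phi> unfolding asymptotically_unbiased_def by blast
  from limsup_le_realD[OF this \<open>\<eta> / 2 > 0\<close>]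
    approximatesD[OF app v phi_test near[unfolded L2_norm_minus_commute[of M "v1 \<oplus>\<^sub>f v2"]]]
  show ?thesis by eventually_elim linarith
qed

text \<open>Unbiasedness is assumed for alternatives only, whereas the bound is wanted on the whole
  tangent space, null directions included; each of its elements is a limit of tangents with nonzero
  pairing.\<close>

lemma tangent_unbiased:
  assumes v: "arr v1n v2n v1 v2" and vT: "v1 \<oplus>\<^sub>f v2 \<in> T" and \<eta>: "0 < \<eta>"
  shows "\<forall>\<^sub>F n in sequentially. \<alpha> - \<eta> \<le> (\<integral>z. \<phi> n z * D v1n v2n n z \<partial>S n)"
proof -
  let ?v = "v1 \<oplus>\<^sub>f v2" and ?\<kappa> = "\<kappa>1 \<oplus>\<^sub>f \<kappa>2"
  have vL2: "?v \<in> L2_space M" and \<kappa>L2: "?\<kappa> \<in> L2_space M" using vT \<kappa>_T tangent_space_L2 by blast+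
  \<comment> \<open>A null direction is first moved along \<open>\<kappa>\<close>, so that its neighbours in the cone are alternatives.\<close>
  define B where "B = L2_norm M ?\<kappa> + 1"
  define \<delta> where "\<delta> = (if (\<integral>z. kt z * ?v z \<partial>M) = 0 then \<eta> / 4 / B else 0)"
  have \<kappa>n: "0 < B" unfolding B_def by (rule add_nonneg_pos) auto
  have \<delta>0: "0 \<le> \<delta>" using \<eta> \<kappa>n by (auto simp: \<delta>_def)
  have \<delta>\<kappa>: "\<delta> * L2_norm M ?\<kappa> \<le> \<eta> / 4"
  proof -
    have "\<delta> * L2_norm M ?\<kappa> \<le> \<delta> * B" using \<delta>0 by (intro mult_left_mono) (auto simp: B_def)
    also have "\<dots> \<le> \<eta> / 4" using \<eta> \<kappa>n by (auto simp: \<delta>_def)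
    finally show ?thesis .
  qed
  define u where "u z = ?v z + \<delta> * ?\<kappa> z" for z
  have uT: "u \<in> T" unfolding u_def[abs_def] by (intro tangent_space_add tangent_space_cmult vT \<kappa>_T)
  then have uL2: "u \<in> L2_space M" using tangent_space_L2 by blast
  have \<kappa>\<sigma>: "(\<integral>z. kt z * ?\<kappa> z \<partial>M) = \<sigma>\<^sup>2" using inner_kt[OF \<kappa>_zero] inner_kt_\<kappa> by simp
  have "(\<integral>z. kt z * u z \<partial>M) = (\<integral>z. kt z * ?v z + \<delta> * (kt z * ?\<kappa> z) \<partial>M)"
    by (intro Bochner_Integration.integral_cong) (auto simp: u_def algebra_simps)
  also have "\<dots> = (\<integral>z. kt z * ?v z \<partial>M) + \<delta> * \<sigma>\<^sup>2"
    using L2_integrable_mult[OF kt_L2 vL2] L2_integrable_mult[OF kt_L2 \<kappa>L2] by (simp add: \<kappa>\<sigma>)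
  finally have ku: "(\<integral>z. kt z * u z \<partial>M) \<noteq> 0" using \<sigma>_pos \<eta> \<kappa>n by (auto simp: \<delta>_def)
  \<comment> \<open>The first bound controls the distance; the second ensures by Cauchy-Schwarz that
    a tangent this close to \<open>u\<close> still has nonzero pairing with the canonical
    gradient.\<close>
  define \<epsilon> where "\<epsilon> = min (\<eta> / 4) (\<bar>\<integral>z. kt z * u z \<partial>M\<bar> / (L2_norm M kt + 1))"
  have ktn: "0 < L2_norm M kt + 1" by (rule add_nonneg_pos) auto
  have "\<epsilon> > 0" unfolding \<epsilon>_def using \<eta> ku ktn by simp
  then obtain f where f: "f \<in> K" and near: "L2_norm M (\<lambda>z. u z - f z) < \<epsilon>"
    using cone_dense uT unfolding L2_dense_in_def L2_closure_def by blast
  have fL2: "f \<in> L2_space M" using f tangent_cone_L2 by blast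
  have kf: "(\<integral>z. kt z * f z \<partial>M) \<noteq> 0"
  proof
    assume 0: "(\<integral>z. kt z * f z \<partial>M) = 0"
    have "(\<integral>z. kt z * (u z - f z) \<partial>M) = (\<integral>z. kt z * u z \<partial>M)"
      using L2_integrable_mult[OF kt_L2 uL2] L2_integrable_mult[OF kt_L2 fL2] 0 by (simp add: right_diff_distrib)
    then have "\<bar>\<integral>z. kt z * u z \<partial>M\<bar> \<le> L2_norm M kt * L2_norm M (\<lambda>z. u z - f z)"
      using L2_Cauchy_Schwarz[OF kt_L2 L2_space_diff[OF uL2 fL2]] by simp
    also have "\<dots> \<le> (L2_norm M kt + 1) * L2_norm M (\<lambda>z. u z - f z)" by (intro mult_right_mono) auto
    also have "\<dots> < (L2_norm M kt + 1) * (\<bar>\<integral>z. kt z * u z \<partial>M\<bar> / (L2_norm M kt + 1))"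
      using near ktn unfolding \<epsilon>_def by (intro mult_strict_left_mono) auto
    also have "\<dots> = \<bar>\<integral>z. kt z * u z \<partial>M\<bar>" using ktn by simp
    finally show False by simp
  qed
  have "L2_norm M (\<lambda>z. f z - ?v z) \<le> L2_norm M (\<lambda>z. f z - u z) + L2_norm M (\<lambda>z. u z - ?v z)"
    by (rule L2_norm_triangle_diff[OF fL2 uL2 vL2])
  also have "L2_norm M (\<lambda>z. u z - ?v z) = \<delta> * L2_norm M ?\<kappa>"
    using L2_norm_cmult[of M \<delta> ?\<kappa>] \<delta>0 by (simp add: u_def)
  also have "L2_norm M (\<lambda>z. f z - u z) < \<eta> / 4"
    using near unfolding \<epsilon>_def L2_norm_minus_commute[of M u] by simp
  finally have fv: "L2_norm M (\<lambda>z. f z - ?v z) < \<eta> / 2" using \<delta>\<kappa> by simp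
  obtain P Q where PQ: "(P, Q) \<in> local_sequences F G P0 Q0" "local_param k P0 Q0 P Q = (\<integral>z. kt z * f z \<partial>M)"
    and app: "approximates P Q f"
    by (rule cone_sequence[OF f])
  have "(P, Q) \<in> Alt" using PQ kf by (auto simp: implicit_alternatives_def)
  then have "ereal \<alpha> \<le> liminf (\<lambda>n. ereal (test_mean n1 n2 \<phi> P Q n))"
    using \<phi> unfolding asymptotically_unbiased_def by blast
  from liminf_ge_realD[OF this, of "\<eta> / 2"] \<eta>
  have "\<forall>\<^sub>F n in sequentially. \<alpha> - \<eta> / 2 \<le> test_mean n1 n2 \<phi> P Q n" by simp
  with approximatesD[OF app v phi_test fv] show ?thesis by eventually_elim linarith
qed

text \<open>With \<open>s = \<theta> / \<sigma>^2\<close> the part \<open>b = w - s \<kappa>\<close>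
  has pairing 0 with the canonical gradient; the same fact, read through \<kappa>, is the weighted
  orthogonality that the exponential family needs. The bound obtained is the two-sided power at
  \<open>s \<sigma>^2 = \<theta>\<close>, which is the limit for the proposed test.\<close>

lemma power_bound:
  assumes PQ: "(P, Q) \<in> Alt"
  shows "limsup (\<lambda>n. ereal (test_mean n1 n2 \<phi> P Q n)) \<le> ereal (lim (test_mean n1 n2 \<psi> P Q))"
proof -
  define \<theta> where "\<theta> = local_param k P0 Q0 P Q"
  have ls: "(P, Q) \<in> local_sequences F G P0 Q0" and \<theta>: "\<theta> \<noteq> 0"
    using PQ by (auto simp: implicit_alternatives_def \<theta>_def)
  obtain w1 w2 where w: "w1 \<in> L2_zero P0" "w2 \<in> L2_zero Q0" and wT: "w1 \<oplus>\<^sub>f w2 \<in> T"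
    and lp: "\<theta> = (\<integral>x. kt1 x * w1 x \<partial>P0) + (\<integral>y. kt2 y * w2 y \<partial>Q0)"
    and app: "approximates P Q (w1 \<oplus>\<^sub>f w2)"
    unfolding \<theta>_def by (rule local_sequence_tangent[OF ls]) blast
  define s where "s = \<theta> / \<sigma>\<^sup>2"
  have s: "s \<noteq> 0" "s * \<sigma>\<^sup>2 = \<theta>" using \<theta> \<sigma>_pos by (auto simp: s_def)
  define b1 where "b1 x = w1 x - s * \<kappa>1 x" for x
  define b2 where "b2 y = w2 y - s * \<kappa>2 y" for y
  have b: "b1 \<in> L2_zero P0" "b2 \<in> L2_zero Q0"
    unfolding b1_def[abs_def] b2_def[abs_def]
    by (intro M1.L2_zero_diff M2.L2_zero_diff M1.L2_zero_cmult M2.L2_zero_cmult w \<kappa>_zero)+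
  have bw: "(\<lambda>x. b1 x + s * \<kappa>1 x) = w1" "(\<lambda>y. b2 y + s * \<kappa>2 y) = w2" by (auto simp: b1_def b2_def)
  have bT: "(\<lambda>x. b1 x + r * \<kappa>1 x) \<oplus>\<^sub>f (\<lambda>y. b2 y + r * \<kappa>2 y) \<in> T" for r
  proof -
    have "(\<lambda>x. b1 x + r * \<kappa>1 x) \<oplus>\<^sub>f (\<lambda>y. b2 y + r * \<kappa>2 y) = (\<lambda>z. (w1 \<oplus>\<^sub>f w2) z + (r - s) * (\<kappa>1 \<oplus>\<^sub>f \<kappa>2) z)"
      by (auto simp: direct_sum_def b1_def b2_def algebra_simps)
    then show ?thesis using tangent_space_add[OF wT tangent_space_cmult[OF \<kappa>_T]] by simp
  qed
  have kb: "(\<integral>x. kt1 x * b1 x \<partial>P0) + (\<integral>y. kt2 y * b2 y \<partial>Q0) = 0"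
  proof -
    have "(\<integral>x. kt1 x * b1 x \<partial>P0) = (\<integral>x. kt1 x * w1 x - s * (kt1 x * \<kappa>1 x) \<partial>P0)"
      by (intro Bochner_Integration.integral_cong) (auto simp: b1_def algebra_simps)
    then have 1: "(\<integral>x. kt1 x * b1 x \<partial>P0) = (\<integral>x. kt1 x * w1 x \<partial>P0) - s * (\<integral>x. kt1 x * \<kappa>1 x \<partial>P0)"
      using L2_integrable_mult[OF kt1_L2 L2_zeroD(1)[OF w(1)]] L2_integrable_mult[OF kt1_L2 L2_zeroD(1)[OF \<kappa>_zero(1)]] by simp
    have "(\<integral>x. kt2 x * b2 x \<partial>Q0) = (\<integral>x. kt2 x * w2 x - s * (kt2 x * \<kappa>2 x) \<partial>Q0)"
      by (intro Bochner_Integration.integral_cong) (auto simp: b2_def algebra_simps)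
    then have 2: "(\<integral>x. kt2 x * b2 x \<partial>Q0) = (\<integral>x. kt2 x * w2 x \<partial>Q0) - s * (\<integral>x. kt2 x * \<kappa>2 x \<partial>Q0)"
      using L2_integrable_mult[OF kt2_L2 L2_zeroD(1)[OF w(2)]] L2_integrable_mult[OF kt2_L2 L2_zeroD(1)[OF \<kappa>_zero(2)]] by simp
    have "s * (\<integral>x. kt1 x * \<kappa>1 x \<partial>P0) + s * (\<integral>x. kt2 x * \<kappa>2 x \<partial>Q0) = \<theta>"
      using inner_kt_\<kappa> s(2) by (simp add: distrib_left[symmetric])
    then show ?thesis unfolding 1 2 using lp by linarith
  qed
  obtain b1n b2n where ba: "arr b1n b2n b1 b2" by (rule ex_arr[OF b])
  obtain k1n k2n where ka: "arr k1n k2n \<kappa>1 \<kappa>2" by (rule ex_arr[OF \<kappa>_zero])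
  note ar = arr_add[OF ba ka]
  have sS: "sets (sample_measure (n1 n) (n2 n) A1 A2) = sets (S n)" for n
    using families by (intro sets_sample_measure_cong) (auto simp: prob_family_def)
  have \<phi>m: "\<phi> n \<in> borel_measurable (S n)" for n
    using phi_test unfolding test_sequence_def by (simp only: measurable_cong_sets[OF sS refl])
  have \<phi>01: "0 \<le> \<phi> n z \<and> \<phi> n z \<le> 1" if "z \<in> space (S n)" for n z
    using phi_test that unfolding test_sequence_def by (simp only: sets_eq_imp_space_eq[OF sS])
  have main: "\<forall>\<^sub>F n in sequentially. (\<integral>z. \<phi> n z * D (\<lambda>n x. b1n n x + s * k1n n x) (\<lambda>n y. b2n n y + s * k2n n y) n z \<partial>S n)
      \<le> two_sided_power c \<sigma> (s * \<sigma>\<^sup>2) + \<eta>" if "0 < \<eta>" for \<eta>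
  proof (rule asymptotic_two_sided_bound[OF ba ka c_pos s(1) \<sigma>_pos _ _ \<phi>m \<phi>01 _ _ that])
    have "(\<integral>x. (\<kappa>1 x)\<^sup>2 \<partial>P0) = (1 / (1 - d))\<^sup>2 * (\<integral>x. (kt1 x)\<^sup>2 \<partial>P0)" "(\<integral>x. (\<kappa>2 x)\<^sup>2 \<partial>Q0) = (1 / d)\<^sup>2 * (\<integral>x. (kt2 x)\<^sup>2 \<partial>Q0)"
      unfolding \<kappa>1_def \<kappa>2_def power_mult_distrib by simp_all
    then show "\<sigma>\<^sup>2 = (1 - d) * (\<integral>x. (\<kappa>1 x)\<^sup>2 \<partial>P0) + d * (\<integral>y. (\<kappa>2 y)\<^sup>2 \<partial>Q0)"
      unfolding \<sigma>_power2 using d01 by (simp add: power2_eq_square)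
    \<comment> \<open>The weights \<open>1 - d\<close> and \<open>d\<close> cancel the denominators
      in \<kappa>, turning the weighted pairing with \<kappa> into the plain pairing with the
      canonical gradient.\<close>
    have "(\<integral>x. \<kappa>1 x * b1 x \<partial>P0) = 1 / (1 - d) * (\<integral>x. kt1 x * b1 x \<partial>P0)" "(\<integral>x. \<kappa>2 x * b2 x \<partial>Q0) = 1 / d * (\<integral>x. kt2 x * b2 x \<partial>Q0)"
      unfolding \<kappa>1_def \<kappa>2_def mult.assoc by simp_all
    then show "(1 - d) * (\<integral>x. \<kappa>1 x * b1 x \<partial>P0) + d * (\<integral>y. \<kappa>2 y * b2 y \<partial>Q0) = 0"
      using kb d01 by simp
    fix \<eta> :: real assume \<eta>: "0 < \<eta>"
    \<comment> \<open>The index \<open>r = 0\<close> stands for \<open>b\<close> itself; the terms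
      with factor 0 keep the form in which the exponential family is indexed.\<close>
    have N: "(\<lambda>x. b1 x + 0 * \<kappa>1 x) \<oplus>\<^sub>f (\<lambda>y. b2 y + 0 * \<kappa>2 y) \<in> tangent_null_space kt M (prod_family F G)"
      unfolding tangent_null_space_def using bT[of 0] inner_kt[OF b] kb by simp
    show "\<forall>\<^sub>F n in sequentially. (\<integral>z. \<phi> n z * D (\<lambda>n x. b1n n x + 0 * k1n n x) (\<lambda>n y. b2n n y + 0 * k2n n y) n z \<partial>S n)
      \<le> two_sided_power c \<sigma> 0 + \<eta>"
      unfolding power_level by (rule null_level[OF ar N \<eta>])
    show "\<forall>\<^sub>F n in sequentially. two_sided_power c \<sigma> 0 - \<eta> \<le>
      (\<integral>z. \<phi> n z * D (\<lambda>n x. b1n n x + - (\<epsilon> * s) * k1n n x) (\<lambda>n y. b2n n y + - (\<epsilon> * s) * k2n n y) n z \<partial>S n)" for \<epsilon>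
      unfolding power_level by (rule tangent_unbiased[OF ar bT \<eta>])
  qed
  have lim: "lim (test_mean n1 n2 \<psi> P Q) = two_sided_power c \<sigma> \<theta>"
    unfolding \<theta>_def by (rule limI[OF psi_limit[OF ls]])
  show ?thesis unfolding lim
  proof (rule limsup_le_realI)
    fix \<eta> :: real assume "0 < \<eta>"
    then have "\<eta> / 2 > 0" by simp
    have "L2_norm M (\<lambda>z. (w1 \<oplus>\<^sub>f w2) z - (w1 \<oplus>\<^sub>f w2) z) < \<eta> / 2" using \<open>\<eta> / 2 > 0\<close> by (simp add: L2_norm_def)
    from approximatesD[OF app ar[of s, unfolded bw] phi_test this] main[OF \<open>\<eta> / 2 > 0\<close>]
    show "\<forall>\<^sub>F n in sequentially. test_mean n1 n2 \<phi> P Q n \<le> two_sided_power c \<sigma> \<theta> + \<eta>"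
      unfolding s(2) by eventually_elim linarith
  qed
qed

text \<open>Power at least \<alpha> holds asymptotically in every tangent direction, in particular
  in null directions as limits of alternatives, and the proposed test has limit \<alpha>
  there.\<close>

lemma hypothesis_bound:
  assumes PQ: "(P, Q) \<in> H"
  shows "ereal (lim (test_mean n1 n2 \<psi> P Q)) \<le> liminf (\<lambda>n. ereal (test_mean n1 n2 \<phi> P Q n))"
proof -
  have ls: "(P, Q) \<in> local_sequences F G P0 Q0" and lp: "local_param k P0 Q0 P Q = 0"
    using PQ by (auto simp: implicit_hypotheses_def)
  obtain w1 w2 where w: "w1 \<in> L2_zero P0" "w2 \<in> L2_zero Q0" and wT: "w1 \<oplus>\<^sub>f w2 \<in> T"
    and app: "approximates P Q (w1 \<oplus>\<^sub>f w2)"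
    by (rule local_sequence_tangent[OF ls]) blast
  obtain v1n v2n where v: "arr v1n v2n w1 w2" by (rule ex_arr[OF w])
  have lim: "lim (test_mean n1 n2 \<psi> P Q) = \<alpha>"
    using limI[OF psi_limit[OF ls]] by (simp add: lp power_level)
  show ?thesis unfolding lim
  proof (rule liminf_ge_realI)
    fix \<eta> :: real assume "0 < \<eta>"
    then have "\<eta> / 2 > 0" by simp
    have "L2_norm M (\<lambda>z. (w1 \<oplus>\<^sub>f w2) z - (w1 \<oplus>\<^sub>f w2) z) < \<eta> / 2" using \<open>\<eta> / 2 > 0\<close> by (simp add: L2_norm_def)
    from approximatesD[OF app v phi_test this] tangent_unbiased[OF v wT \<open>\<eta> / 2 > 0\<close>]
    show "\<forall>\<^sub>F n in sequentially. \<alpha> - \<eta> \<le> test_mean n1 n2 \<phi> P Q n" by eventually_elim linarith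
  qed
qed

end

lemma psi_optimal: "asymptotically_optimal_unbiased A1 A2 n1 n2 \<alpha> H Alt \<psi>"
  unfolding asymptotically_optimal_unbiased_def
proof (intro conjI psi_unbiased allI impI)
  show "\<forall>(P, Q)\<in>H \<union> Alt. convergent (test_mean n1 n2 \<psi> P Q)"
    using psi_limit by (auto simp: implicit_hypotheses_def implicit_alternatives_def intro: convergentI)
  fix \<phi> assume \<phi>: "asymptotically_unbiased A1 A2 n1 n2 \<alpha> H Alt \<phi>"
  show "\<forall>(P, Q)\<in>Alt. limsup (\<lambda>n. ereal (test_mean n1 n2 \<phi> P Q n)) \<le> ereal (lim (test_mean n1 n2 \<psi> P Q))"
    using power_bound[OF \<phi>] by blast
  show "\<forall>(P, Q)\<in>H. ereal (lim (test_mean n1 n2 \<psi> P Q)) \<le> liminf (\<lambda>n. ereal (test_mean n1 n2 \<phi> P Q n))"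
    using hypothesis_bound[OF \<phi>] by blast
qed

end

theorem mainTheorem15:
  fixes A1 :: "'a measure" and A2 :: "'b measure"
    and F :: "'a measure set" and G :: "'b measure set"
    and P0 :: "'a measure" and Q0 :: "'b measure"
    and k :: "('a \<times> 'b) measure \<Rightarrow> real"
    and kt :: "'a \<times> 'b \<Rightarrow> real" and kt1 :: "'a \<Rightarrow> real" and kt2 :: "'b \<Rightarrow> real"
    and \<alpha> d :: real and n1 n2 :: "nat \<Rightarrow> nat"
  assumes "prob_family A1 F" and "prob_family A2 G"
    and "P0 \<in> F" and "Q0 \<in> G"
    and "is_canonical_gradient k (P0 \<Otimes>\<^sub>M Q0) (prod_family F G) kt"
    and "kt1 \<in> L2_zero P0" and "kt2 \<in> L2_zero Q0"
    and "AE \<omega> in P0 \<Otimes>\<^sub>M Q0. kt \<omega> = kt1 (fst \<omega>) + kt2 (snd \<omega>)"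
    and "L2_norm (P0 \<Otimes>\<^sub>M Q0) kt \<noteq> 0"
    and "0 < \<alpha>" and "\<alpha> < 1"
    and "\<And>n. n1 n + n2 n = n"
    and "0 < d" and "d < 1"
    and "(\<lambda>n. real (n2 n) / real n) \<longlonglongrightarrow> d"
    and "L2_dense_in (P0 \<Otimes>\<^sub>M Q0)
           (tangent_cone (P0 \<Otimes>\<^sub>M Q0) (prod_family F G))
           (tangent_space (P0 \<Otimes>\<^sub>M Q0) (prod_family F G))"
    and "L2_dense_in (P0 \<Otimes>\<^sub>M Q0)
           (tangent_cone (P0 \<Otimes>\<^sub>M Q0) (prod_family F G)
              \<inter> tangent_null_space kt (P0 \<Otimes>\<^sub>M Q0) (prod_family F G))
           (tangent_null_space kt (P0 \<Otimes>\<^sub>M Q0) (prod_family F G))"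
  shows "asymptotically_optimal_unbiased A1 A2 n1 n2 \<alpha>
           (implicit_hypotheses k F G P0 Q0)
           (implicit_alternatives k F G P0 Q0)
           (psi_test (crit_value \<alpha> d kt1 kt2 P0 Q0) n1 n2 kt1 kt2)"
proof -
  interpret P0: prob_space P0 using assms(1,3) by (auto simp: prob_family_def)
  interpret Q0: prob_space Q0 using assms(2,4) by (auto simp: prob_family_def)
  interpret implicit_testing P0 Q0 n1 n2 d A1 A2 F G k kt kt1 kt2 \<alpha>
    by unfold_locales (use assms in \<open>simp_all add: direct_sum_def\<close>)
  show ?thesis using psi_optimal unfolding c_def .
qed

end
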